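(* For $R>0$, $T>0$ and $N\in\mathbb{N}$ let $C_{f}(T,R,N)$ be the event that, for every $t\in[0,T]$, the function $z\mapsto f(z,t)=\sum_{n=0}^\infty a_n(t)\frac{z^n}{\sqrt{n!}}$ has at least $N$ zeros in $D_R=\{z\in\mathbb{C}:|z|\le R\}$. Then for each fixed $R$, $$\limsup_{T\to\infty}\frac1T\log\mathbb{P}(C_f(T,R,N))\le -e^{\left(\frac16-o(1)\right)N\log N}$$ and $$\liminf_{T\to\infty}\frac1T\log\mathbb{P}(C_f(T,R,N))\ge -e^{\left(\frac12+o(1)\right)N\log N},$$ where each $o(1)$ denotes a quantity depending only on $R$ and $N$ that tends to $0$ as $N\to\infty$ with $R$ fixed.
   Context: The coefficients $a_n(t)$, $n\ge 0$, $t\ge0$, are i.i.d. complex stationary Ornstein-Uhlenbeck processes: $a_n(t)=e^{-t/2}B_n(e^t)$, where $B_n=\frac{1}{\sqrt2}(B_{n,1}+iB_{n,2})$ and all $B_{n,1},B_{n,2}$ are independent standard real Brownian motions started from $0$. With probability one $f(\cdot,t)$ is an entire function for all $t$ (the time dependent planar Gaussian analytic function). Zeros are counted with multiplicity. *)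

theory Defs
  imports "HOL-Probability.Probability" "HOL-Complex_Analysis.Complex_Analysis"
begin

text \<open>Only almost sure continuity and an almost sure starting value are required.\<close>

definition standard_brownian_motion :: "'a measure \<Rightarrow> (real \<Rightarrow> 'a \<Rightarrow> real) \<Rightarrow> bool" where
  "standard_brownian_motion M W \<longleftrightarrow>
     prob_space M \<and>
     (\<forall>t\<ge>0. W t \<in> borel_measurable M) \<and>
     (AE \<omega> in M. W 0 \<omega> = 0) \<and>
     (\<forall>s t. 0 \<le> s \<and> s < t \<longrightarrow>
        distributed M lborel (\<lambda>\<omega>. W t \<omega> - W s \<omega>) (normal_density 0 (sqrt (t - s)))) \<and>
     (\<forall>(\<tau> :: nat \<Rightarrow> real) k. 0 \<le> \<tau> 0 \<and> (\<forall>i<k. \<tau> i \<le> \<tau> (Suc i)) \<longrightarrow>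
        prob_space.indep_vars M (\<lambda>_. borel) (\<lambda>i \<omega>. W (\<tau> (Suc i)) \<omega> - W (\<tau> i) \<omega>) {..<k}) \<and>
     (AE \<omega> in M. continuous_on {0..} (\<lambda>t. W t \<omega>))"

text \<open>Each process is viewed as one random element of the product space of functions on
  \<open>{0..}\<close>, so the independence below is that of whole processes. The second index of \<open>B\<close>
  ranges over \<open>{1, 2}\<close>: the real and the imaginary part.\<close>

definition independent_brownian_motions ::
  "'a measure \<Rightarrow> (nat \<Rightarrow> nat \<Rightarrow> real \<Rightarrow> 'a \<Rightarrow> real) \<Rightarrow> bool" where
  "independent_brownian_motions M B \<longleftrightarrow>
     prob_space M \<and>
     (\<forall>n. \<forall>j\<in>{1, 2}. standard_brownian_motion M (B n j)) \<and>
     prob_space.indep_vars M (\<lambda>_. \<Pi>\<^sub>M t\<in>{0..}. borel)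
       (\<lambda>(n, j) \<omega>. \<lambda>t\<in>{0..}. B n j t \<omega>) (UNIV \<times> {1, 2})"

definition ou_coeff ::
  "(nat \<Rightarrow> nat \<Rightarrow> real \<Rightarrow> 'a \<Rightarrow> real) \<Rightarrow> nat \<Rightarrow> real \<Rightarrow> 'a \<Rightarrow> complex" where
  "ou_coeff B n t \<omega> =
     of_real (exp (- t / 2)) *
     (of_real (1 / sqrt 2) *
       (of_real (B n 1 (exp t) \<omega>) + \<i> * of_real (B n 2 (exp t) \<omega>)))"

definition planar_gaf ::
  "(nat \<Rightarrow> nat \<Rightarrow> real \<Rightarrow> 'a \<Rightarrow> real) \<Rightarrow> real \<Rightarrow> 'a \<Rightarrow> complex \<Rightarrow> complex" where
  "planar_gaf B t \<omega> z = (\<Sum>n. ou_coeff B n t \<omega> * (z ^ n / of_real (sqrt (fact n))))"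

text \<open>Zeros with multiplicity, meant for an entire \<open>g\<close> and a bounded \<open>S\<close>. The function that is
  identically zero needs its own case because \<^const>\<open>zorder\<close> carries no information there;
  otherwise the set summed over is finite.\<close>

definition zero_count :: "(complex \<Rightarrow> complex) \<Rightarrow> complex set \<Rightarrow> enat" where
  "zero_count g S =
     (if \<forall>z. g z = 0 then \<infinity> else enat (\<Sum>z\<in>{z\<in>S. g z = 0}. nat (zorder g z)))"

definition many_zeros_event ::
  "'a measure \<Rightarrow> (nat \<Rightarrow> nat \<Rightarrow> real \<Rightarrow> 'a \<Rightarrow> real) \<Rightarrow> real \<Rightarrow> real \<Rightarrow> nat \<Rightarrow> 'a set" where
  "many_zeros_event M B T R N =
     {\<omega> \<in> space M. \<forall>t\<in>{0..T}. enat N \<le> zero_count (planar_gaf B t \<omega>) (cball 0 R)}"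

text \<open>The function is entire for all times, and the paths are continuous, only up to a null set,
  and the event is measurable only up to that null set. Its probability is therefore taken in
  the completion of \<open>M\<close>.\<close>

definition many_zeros_prob ::
  "'a measure \<Rightarrow> (nat \<Rightarrow> nat \<Rightarrow> real \<Rightarrow> 'a \<Rightarrow> real) \<Rightarrow> real \<Rightarrow> real \<Rightarrow> nat \<Rightarrow> real" where
  "many_zeros_prob M B T R N = measure (completion M) (many_zeros_event M B T R N)"

text \<open>Logarithm of a probability with \<open>log 0 = -\<infinity>\<close>; the library has \<open>ln 0 = 0\<close> on the reals.\<close>

definition log_prob :: "real \<Rightarrow> ereal" where
  "log_prob p = (if p = 0 then -\<infinity> else ereal (ln p))"

end

theory Submission
  imports Defs "HOL-Real_Asymp.Real_Asymp"
begin

text \<open>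
  Write \<open>a n t\<close> for the coefficients and \<open>w n = r ^ n / sqrt (n!)\<close>. \<^bold>\<open>Upper bound.\<close> If the entire
  function \<open>f\<close> has \<open>N\<close> zeros in the disc of radius \<open>R\<close>, dividing them out and applying the maximum
  principle on the circle of radius \<open>r\<close>, with \<open>r\<close> of order \<open>sqrt N\<close>, gives \<open>\<bar>a 0 t\<bar> \<le> \<rho> * m t\<close>, where
  \<open>\<rho> = exp (- (N ln N) / 2 + O(N))\<close> and \<open>m t\<close> is the weighted sum of the \<open>\<bar>a n t\<bar>\<close> for \<open>n \<ge> 1\<close>. Sample at the
  times \<open>i * h\<close>. A Chernoff bound for the Brownian increments shows that \<open>m\<close> is at most
  \<open>exp (O(N)) / sqrt h\<close> at half of the sampling times, except with a probability that is exponentially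
  small in their number. These times depend on \<open>m\<close> only, hence are independent of \<open>a 0\<close>, which stays in a
  window of the size of its typical increment \<open>sqrt h\<close> at each of them with a probability that is
  exponentially small in their number as well. With \<open>h\<close> of order \<open>\<rho> * exp (O(N))\<close> both rates are of
  order \<open>1 / h\<close>; this is exponent \<open>1/2\<close>, better than the required \<open>1/6\<close>.

  \<^bold>\<open>Lower bound.\<close> By Rouche's theorem it suffices that the term of degree \<open>N\<close> dominates on the circle
  of radius \<open>R\<close>. This holds if \<open>\<bar>a N\<bar>\<close> stays above \<open>K\<close>, of order \<open>(N!) powr (1/4)\<close>, the lower coefficients
  stay below \<open>K * w N\<close> (now with \<open>r = R\<close>) up to a constant, and the higher ones below geometrically growing bounds. Keeping an
  Ornstein-Uhlenbeck process above \<open>K\<close> costs a rate of order \<open>K\<^sup>2\<close>, keeping it below \<open>\<delta>\<close> costs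
  \<open>1 / \<delta>\<^sup>2\<close>, and both are \<open>sqrt (N!)\<close> up to \<open>exp (O(N))\<close>.
\<close>


section \<open>Zeros of entire functions\<close>

text \<open>Every probability estimate has the form constant times \<open>exp (- rate * T)\<close>.
  Constants may depend on \<open>R\<close> and \<open>N\<close> as badly as they like, since they
  disappear from \<open>ln p / T\<close>; hence the crude treatment of starting values and of
  rounding \<open>T\<close> to whole blocks. Upper bound: over a long time the coefficients of
  positive index are large at some sampling times, so only the proportion of good times can be
  controlled. The good times form a random set, and the estimate for \<open>a 0\<close> therefore
  has to hold for every fixed set of times with an exponent that depends on its cardinality alone.
  Lower bound: infinitely many coefficients have to behave throughout \<open>[0, T]\<close>. A
  fourth moment bound makes the failure probability per unit of time of order
  \<open>L ^ (-4)\<close> for a threshold \<open>L\<close>, so geometrically growing thresholds give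
  a summable total rate, and the infinite intersection is reached as a decreasing limit of finite
  ones. Measurability: the event involves uncountably many times. Hurwitz's theorem makes "at least
  \<open>N\<close> zeros in the closed disc" a closed condition on suitably bounded coefficients, so
  rational times suffice.\<close>

lemma zeros_cball_finite:
  assumes "f holomorphic_on UNIV" "f w \<noteq> 0"
  shows "finite {z \<in> cball 0 r. f z = 0}"
proof (rule ccontr)
  assume "infinite {z \<in> cball 0 r. f z = 0}"
  then obtain \<xi> where \<xi>: "\<xi> islimpt {z \<in> cball 0 r. f z = 0}"
    using compact_cball[of "0::complex" r] unfolding compact_eq_Bolzano_Weierstrass
    by (metis (no_types, lifting) mem_Collect_eq subsetI)
  have "f w = 0"
    by (rule analytic_continuation[of f UNIV "{z \<in> cball 0 r. f z = 0}" \<xi>]) (use assms \<xi> in auto)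
  with assms show False by simp
qed

lemma zero_count_eq_sum:
  assumes "f w \<noteq> 0"
  shows "zero_count f S = enat (\<Sum>z\<in>{z\<in>S. f z = 0}. nat (zorder f z))"
  using assms by (auto simp: zero_count_def)

lemma entire_nonzero_frequently:
  assumes "f holomorphic_on UNIV" "f w \<noteq> (0::complex)"
  shows "\<exists>\<^sub>F z in at p. f z \<noteq> 0"
proof -
  have "\<forall>\<^sub>F z in at p. f z \<noteq> 0 \<and> z \<in> UNIV"
    by (rule non_zero_neighbour_alt[of f UNIV p w]) (use assms in auto)
  then show ?thesis
    by (intro eventually_frequently) (auto elim: eventually_mono)
qed

lemma zorder_entire_nonneg:
  assumes "f holomorphic_on UNIV" "f w \<noteq> (0::complex)"
  shows "zorder f p \<ge> 0"
  by (rule zorder_ge_0[OF _ entire_nonzero_frequently[OF assms]])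
     (use assms(1) in \<open>auto simp: analytic_at intro!: exI[of _ UNIV]\<close>)

lemma zorder_entire_pos:
  assumes "f holomorphic_on UNIV" "f w \<noteq> (0::complex)"
  shows "zorder f p > 0 \<longleftrightarrow> f p = 0"
  by (rule zorder_pos_iff[of f UNIV]) (use assms entire_nonzero_frequently[OF assms] in auto)

text \<open>Rouche's theorem weights each zero by its winding number. For a circle the weight is 1
  inside and 0 outside, so the weighted sum over the larger disc \<open>s\<close> is the number of
  zeros inside.\<close>

lemma rouche_zero_count:
  assumes f: "f holomorphic_on UNIV" and g: "g holomorphic_on UNIV" and r: "r > 0"
    and less: "\<And>z. cmod z = r \<Longrightarrow> cmod (g z - f z) < cmod (f z)"
  shows "zero_count g (ball 0 r) = zero_count f (ball 0 r)"
proof -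
  have r1: "cmod (of_real r) = r" using r by simp
  have f0: "f (of_real r) \<noteq> 0" using less[OF r1] by auto
  have g0: "g (of_real r) \<noteq> 0" using less[OF r1] by auto
  define s :: "complex set" where "s = ball 0 (r + 1)"
  have fin: "finite {p \<in> s. h p = 0}" if "h holomorphic_on UNIV" "h (of_real r) \<noteq> 0" for h
    using zeros_cball_finite[OF that, of "r + 1"] by (rule rev_finite_subset) (auto simp: s_def)
  have *: "(\<Sum>p\<in>{p\<in>s. h p = 0}. winding_number (circlepath 0 r) p * of_int (zorder h p)) =
      of_nat (\<Sum>z\<in>{z\<in>ball 0 r. h z = 0}. nat (zorder h z))"
    if h: "h holomorphic_on UNIV" "h (of_real r) \<noteq> 0" "\<And>z. cmod z = r \<Longrightarrow> h z \<noteq> 0" for h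
  proof -
    have "(\<Sum>p\<in>{p\<in>s. h p = 0}. winding_number (circlepath 0 r) p * of_int (zorder h p)) =
        (\<Sum>p\<in>{p\<in>ball 0 r. h p = 0}. winding_number (circlepath 0 r) p * of_int (zorder h p))"
    proof (rule sum.mono_neutral_right)
      show "\<forall>p\<in>{p \<in> s. h p = 0} - {p \<in> ball 0 r. h p = 0}.
          winding_number (circlepath 0 r) p * of_int (zorder h p) = 0"
      proof
        fix p assume p: "p \<in> {p \<in> s. h p = 0} - {p \<in> ball 0 r. h p = 0}"
        then have "cmod p \<noteq> r" "\<not> cmod p < r" using h(3) by auto
        then have "p \<notin> cball 0 r" by auto
        then have "winding_number (circlepath 0 r) p = 0"
          using r by (intro winding_number_zero_outside[of _ "cball 0 r"]) (auto simp: sphere_def)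
        then show "winding_number (circlepath 0 r) p * of_int (zorder h p) = 0" by simp
      qed
    qed (use fin[OF h(1,2)] in \<open>auto simp: s_def\<close>)
    also have "\<dots> = (\<Sum>p\<in>{p\<in>ball 0 r. h p = 0}. of_nat (nat (zorder h p)))"
    proof (rule sum.cong)
      fix p assume "p \<in> {p \<in> ball 0 r. h p = 0}"
      then have "winding_number (circlepath 0 r) p = 1"
        by (intro winding_number_circlepath) (auto simp: dist_norm)
      moreover have "zorder h p \<ge> 0" by (rule zorder_entire_nonneg[OF h(1,2)])
      ultimately show "winding_number (circlepath 0 r) p * of_int (zorder h p) = of_nat (nat (zorder h p))"
        by (metis mult_1 of_int_of_nat_eq nat_0_le)
    qed auto
    finally show ?thesis by simp
  qed
  have "(\<Sum>p\<in>{p\<in>s. f p + (g p - f p) = 0}. winding_number (circlepath 0 r) p * of_int (zorder (\<lambda>p. f p + (g p - f p)) p)) =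
        (\<Sum>p\<in>{p\<in>s. f p = 0}. winding_number (circlepath 0 r) p * of_int (zorder f p))"
  proof (rule Rouche_theorem)
    show "finite {p \<in> s. f p + (g p - f p) = 0}" using fin[OF g g0] by simp
    show "finite {p \<in> s. f p = 0}" by (rule fin[OF f f0])
    show "f holomorphic_on s" "(\<lambda>p. g p - f p) holomorphic_on s"
      using f g by (auto intro!: holomorphic_intros intro: holomorphic_on_subset)
    show "path_image (circlepath 0 r) \<subseteq> s" using r by (auto simp: s_def)
    show "\<forall>z\<in>path_image (circlepath 0 r). cmod (g z - f z) < cmod (f z)"
      using r less by auto
    show "\<forall>z. z \<notin> s \<longrightarrow> winding_number (circlepath 0 r) z = 0"
      using r by (auto intro!: winding_number_zero_outside[of _ "cball 0 r"] simp: s_def sphere_def)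
  qed (auto simp: s_def)
  then have "(\<Sum>p\<in>{p\<in>s. g p = 0}. winding_number (circlepath 0 r) p * of_int (zorder g p)) =
        (\<Sum>p\<in>{p\<in>s. f p = 0}. winding_number (circlepath 0 r) p * of_int (zorder f p))" by simp
  moreover have "\<And>z. cmod z = r \<Longrightarrow> f z \<noteq> 0" "\<And>z. cmod z = r \<Longrightarrow> g z \<noteq> 0"
    using less by fastforce+
  ultimately have "(of_nat (\<Sum>z\<in>{z\<in>ball 0 r. g z = 0}. nat (zorder g z)) :: complex) =
     of_nat (\<Sum>z\<in>{z\<in>ball 0 r. f z = 0}. nat (zorder f z))"
    using *[OF g g0] *[OF f f0] by simp
  then show ?thesis
    unfolding zero_count_eq_sum[of f "of_real r", OF f0] zero_count_eq_sum[of g "of_real r", OF g0]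
    unfolding of_nat_eq_iff by simp
qed

text \<open>Boundedness of \<open>T\<close> makes its zero set finite; over an infinite set
  \<open>sum\<close> would return the default 0 and monotonicity could fail.\<close>

lemma zero_count_mono:
  assumes "f holomorphic_on UNIV" "S \<subseteq> T" "bounded T"
  shows "zero_count f S \<le> zero_count f T"
proof (cases "\<forall>z. f z = 0")
  case False
  then obtain w where w: "f w \<noteq> 0" by auto
  obtain r where "T \<subseteq> cball 0 r" using assms(3) bounded_subset_ballD[of T 0] ball_subset_cball by blast
  then have "finite {z \<in> T. f z = 0}"
    using zeros_cball_finite[OF assms(1) w, of r] by (elim rev_finite_subset) auto
  then show ?thesis
    unfolding zero_count_eq_sum[of f w, OF w] using assms(2) by (auto intro!: sum_mono2)
qed (auto simp: zero_count_def)

text \<open>Hurwitz: the closed disc is enlarged to a disc without further zeros, to which Rouche's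
  theorem applies.\<close>

lemma hurwitz_zero_count:
  assumes f: "f holomorphic_on UNIV" and R: "R > 0"
    and g: "\<And>k. g k holomorphic_on UNIV"
    and lim: "uniform_limit (cball 0 (R + 1)) g f sequentially"
    and N: "\<And>k :: nat. enat N \<le> zero_count (g k) (cball 0 R)"
  shows "enat N \<le> zero_count f (cball 0 R)"
proof (cases "\<forall>z. f z = 0")
  case False
  then obtain w where w: "f w \<noteq> 0" by auto
  define Z where "Z = {z \<in> cball 0 (R + 1). f z = 0} - cball 0 R"
  have Z: "finite Z" unfolding Z_def using zeros_cball_finite[OF f w] by blast
  \<comment> \<open>Halfway between \<open>R\<close> and the smallest modulus in \<open>Z\<close>.
    Inserting \<open>R + 1\<close> gives the minimum a value if \<open>Z\<close> is empty and keeps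
    the circle inside the region of uniform convergence.\<close>
  define r where "r = (R + Min (insert (R + 1) (cmod ` Z))) / 2"
  have "R < Min (insert (R + 1) (cmod ` Z))" using Z by (auto simp: Z_def)
  moreover have "Min (insert (R + 1) (cmod ` Z)) \<le> R + 1" using Z by auto
  moreover have Mz: "Min (insert (R + 1) (cmod ` Z)) \<le> cmod z" if "z \<in> Z" for z using Z that by auto
  ultimately have r: "R < r" "r < R + 1" and rz: "\<And>z. z \<in> Z \<Longrightarrow> r < cmod z"
    unfolding r_def by (auto simp: field_simps) (smt (verit) Mz)
  have fz: "f z \<noteq> 0" if "R < cmod z" "cmod z \<le> r" for z
    using that rz[of z] r by (force simp: Z_def)
  have cont: "continuous_on (sphere 0 r) (\<lambda>z. cmod (f z))"
    using f by (intro continuous_intros holomorphic_on_imp_continuous_on) (auto intro: holomorphic_on_subset)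
  obtain m where m: "m > 0" "\<And>z. cmod z = r \<Longrightarrow> m \<le> cmod (f z)"
  proof -
    have "sphere (0::complex) r \<noteq> {}" using r R by auto
    then obtain x where "x \<in> sphere 0 r" "\<forall>y\<in>sphere 0 r. cmod (f x) \<le> cmod (f y)"
      using continuous_attains_inf[OF compact_sphere _ cont] by blast
    then show ?thesis using that[of "cmod (f x)"] fz[of x] r by auto
  qed
  from uniform_limitD[OF lim m(1)] obtain k where k: "\<And>z. z \<in> cball 0 (R + 1) \<Longrightarrow> dist (g k z) (f z) < m"
    unfolding eventually_sequentially by blast
  have "zero_count (g k) (ball 0 r) = zero_count f (ball 0 r)"
  proof (rule rouche_zero_count[OF f g])
    show "r > 0" using r R by simp
    fix z :: complex assume z: "cmod z = r"
    then have "dist (g k z) (f z) < m" using r by (intro k) auto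
    with m(2)[OF z] show "cmod (g k z - f z) < cmod (f z)" by (simp add: dist_norm)
  qed
  moreover have "enat N \<le> zero_count (g k) (ball 0 r)"
    using N[of k] zero_count_mono[OF g, of "cball 0 R" "ball 0 r" k] r by force
  moreover have "{z \<in> ball 0 r. f z = 0} = {z \<in> cball 0 R. f z = 0}"
    using fz r by force
  ultimately show ?thesis
    by (simp add: zero_count_eq_sum[of f w, OF w])
qed (auto simp: zero_count_def)

lemma zero_count_monom:
  assumes "c \<noteq> 0" "r > 0"
  shows "zero_count (\<lambda>z. c * z ^ N) (ball 0 r) = enat N"
proof -
  have nz: "zero_count (\<lambda>z. c * z ^ N) S = enat (\<Sum>z\<in>{z\<in>S. c * z ^ N = 0}. nat (zorder (\<lambda>z. c * z ^ N) z))" for S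
    by (rule zero_count_eq_sum[where w = 1]) (use assms in simp)
  have z: "zorder (\<lambda>z. c * z ^ N) 0 = int N"
    by (rule zorder_eqI[of UNIV _ "\<lambda>_. c"]) (use assms in auto)
  show ?thesis
  proof (cases "N = 0")
    case False
    then have "{z \<in> ball 0 r. c * z ^ N = 0} = {0}" using assms by auto
    then show ?thesis using z by (simp add: nz)
  next
    case True
    then show ?thesis using assms nz[of "ball 0 r"] by simp
  qed
qed

text \<open>A form of Jensen's inequality: the polynomial \<open>P1\<close> of the zeros in the
  small disc is at least \<open>(r - R) ^ D\<close> on the circle and at most \<open>R ^ D\<close>
  at 0, where \<open>D\<close> is their total multiplicity, and the quotient obeys the maximum
  principle.\<close>

lemma zero_count_value_bound:
  assumes f: "f holomorphic_on UNIV" and R: "R > 0" and r: "r \<ge> 2 * R"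
    and N: "enat N \<le> zero_count f (cball 0 R)"
    and M: "\<And>z. cmod z = r \<Longrightarrow> cmod (f z) \<le> M"
  shows "cmod (f 0) \<le> (R / (r - R)) ^ N * M"
proof -
  have "cmod (of_real r) = r" using R r by simp
  from M[OF this] have M0: "M \<ge> 0" by (meson norm_ge_zero order_trans)
  show ?thesis
  proof (cases "f 0 = 0")
    case False
    note w = False
    \<comment> \<open>The factorization needs a polynomial with exactly the zeros of
      \<open>f\<close> on an open set containing the closed disc of radius \<open>r\<close>; hence
      all zeros in \<open>A\<close> are divided out first.\<close>
    define A :: "complex set" where "A = ball 0 (r + 1)"
    define Z where "Z = {z \<in> A. f z = 0}"
    have Z: "finite Z" unfolding Z_def
      using zeros_cball_finite[OF f w, of "r + 1"] by (rule rev_finite_subset) (auto simp: A_def)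
    define m where "m p = nat (zorder f p)" for p
    define P where "P z = (\<Prod>p\<in>Z. (z - p) ^ m p)" for z
    have zP: "zorder P q = int (m q)" if q: "q \<in> Z" for q
    proof (rule zorder_eqI[of UNIV _ "\<lambda>z. \<Prod>p\<in>Z - {q}. (z - p) ^ m p"])
      show "P w = (\<Prod>p\<in>Z - {q}. (w - p) ^ m p) * (w - q) powi int (m q)" if "w \<noteq> q" for w
        unfolding P_def using Z q by (simp add: prod.remove[of Z q] mult.commute)
    qed (use Z in \<open>auto intro!: holomorphic_intros\<close>)
    have m_pos: "m p > 0 \<longleftrightarrow> f p = 0" for p
      using zorder_entire_pos[OF f w, of p] by (auto simp: m_def)
    have P0: "P z = 0 \<longleftrightarrow> f z = 0" if "z \<in> A" for z
      using Z that m_pos by (auto simp: P_def Z_def)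
    have Ph: "P holomorphic_on UNIV" unfolding P_def by (intro holomorphic_intros)
    obtain h where h: "h holomorphic_on A" "\<And>z. z \<in> A \<Longrightarrow> f z = h z * P z"
    proof (rule holomorphic_zorder_factorization[of f A P])
      show "f holomorphic_on A" "P holomorphic_on A" using f Ph by (auto intro: holomorphic_on_subset)
      fix z assume z: "z \<in> A"
      show "P z = 0 \<longleftrightarrow> f z = 0" by (rule P0[OF z])
      show "zorder P z = zorder f z"
      proof (cases "f z = 0")
        case True
        then show ?thesis using z zP[of z] zorder_entire_nonneg[OF f w, of z] by (simp add: Z_def m_def)
      next
        case False
        then show ?thesis using P0[OF z] f Ph
          by (metis UNIV_I analytic_on_open analytic_on_subset open_UNIV subset_UNIV zorder_eq_0I)
      qed
    qed (auto simp: A_def)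
    define Z1 where "Z1 = {z \<in> cball 0 R. f z = 0}"
    have Z1: "Z1 \<subseteq> Z" using R r by (auto simp: Z1_def Z_def A_def)
    have Z1f: "finite Z1" using Z Z1 finite_subset by blast
    define P1 where "P1 z = (\<Prod>p\<in>Z1. (z - p) ^ m p)" for z
    \<comment> \<open>The zeros outside the small disc are multiplied back, because a lower bound on
      the circle is available only for the factors in \<open>P1\<close>.\<close>
    define q where "q z = h z * (\<Prod>p\<in>Z - Z1. (z - p) ^ m p)" for z
    have fq: "f z = P1 z * q z" if "z \<in> A" for z
      using h(2)[OF that] Z Z1 by (simp add: P_def P1_def q_def prod.subset_diff[OF Z1 Z] mult_ac)
    have qh: "q holomorphic_on A" unfolding q_def using h(1) by (intro holomorphic_intros)
    define D where "D = (\<Sum>p\<in>Z1. m p)"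
    have D: "D \<ge> N" using N unfolding zero_count_eq_sum[of f 0, OF w] by (simp add: D_def m_def Z1_def)
    have rR: "r - R > 0" using R r by simp
    have P1r: "cmod (P1 z) \<ge> (r - R) ^ D" if "cmod z = r" for z
    proof -
      have "(r - R) ^ D = (\<Prod>p\<in>Z1. (r - R) ^ m p)" by (simp add: D_def power_sum)
      also have "\<dots> \<le> (\<Prod>p\<in>Z1. cmod (z - p) ^ m p)"
      proof (intro prod_mono conjI power_mono)
        fix p assume "p \<in> Z1"
        then have "cmod p \<le> R" by (auto simp: Z1_def)
        then show "r - R \<le> cmod (z - p)" using norm_triangle_ineq2[of z p] that by simp
      qed (use rR in auto)
      finally show ?thesis by (simp add: P1_def norm_power flip: prod_norm)
    qed
    have P10: "cmod (P1 0) \<le> R ^ D"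
    proof -
      have "cmod (P1 0) = (\<Prod>p\<in>Z1. cmod p ^ m p)" by (simp add: P1_def norm_power flip: prod_norm)
      also have "\<dots> \<le> (\<Prod>p\<in>Z1. R ^ m p)"
        by (intro prod_mono conjI power_mono) (auto simp: Z1_def)
      finally show ?thesis by (simp add: D_def power_sum)
    qed
    have q0: "cmod (q 0) \<le> M / (r - R) ^ D"
    proof (rule maximum_modulus_frontier[of q "cball 0 r"])
      show "q holomorphic_on interior (cball 0 r)"
        by (rule holomorphic_on_subset[OF qh]) (auto simp: A_def)
      show "continuous_on (closure (cball 0 r)) q"
        by (rule holomorphic_on_imp_continuous_on, rule holomorphic_on_subset[OF qh]) (auto simp: A_def)
      fix z assume "z \<in> frontier (cball (0::complex) r)"
      then have z: "cmod z = r" using R r by auto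
      then have "(r - R) ^ D * cmod (q z) \<le> cmod (P1 z) * cmod (q z)"
        using P1r by (intro mult_right_mono) auto
      also have "\<dots> = cmod (f z)" using fq[of z] z by (simp add: A_def norm_mult)
      also have "\<dots> \<le> M" by (rule M[OF z])
      finally show "cmod (q z) \<le> M / (r - R) ^ D" using rR by (simp add: field_simps)
    qed (use R r in auto)
    have "cmod (f 0) = cmod (P1 0) * cmod (q 0)" using fq[of 0] R r by (simp add: A_def norm_mult)
    also have "\<dots> \<le> R ^ D * (M / (r - R) ^ D)"
      using P10 q0 R by (intro mult_mono) auto
    also have "\<dots> = (R / (r - R)) ^ D * M" by (simp add: power_divide)
    \<comment> \<open>The exponent can be lowered from \<open>D\<close> to \<open>N\<close> since
      \<open>r >= 2 * R\<close> makes the base at most 1.\<close>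
    also have "\<dots> \<le> (R / (r - R)) ^ N * M"
      using D R r M0 by (intro mult_right_mono power_decreasing) (auto simp: field_simps)
    finally show ?thesis .
  qed (use M0 R r in auto)
qed

section \<open>Estimates for normal variables\<close>

context prob_space begin

text \<open>Meant for dyadic chaining. There the second moment is too weak: the number
  \<open>2 ^ j\<close> of increments at level \<open>j\<close> would exactly cancel their variance,
  leaving nothing to sum.\<close>

lemma normal_fourth_moment_tail:
  assumes D: "distributed M lborel X (normal_density 0 \<sigma>)" and \<sigma>: "\<sigma> > 0" and x: "x > 0"
  shows "prob {\<omega> \<in> space M. \<bar>X \<omega>\<bar> > x} \<le> 3 * \<sigma> ^ 4 / x ^ 4"
proof -
  have [measurable]: "X \<in> borel_measurable M"
    using distributed_measurable[OF D] by simp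
  have hb: "has_bochner_integral lborel (\<lambda>x. normal_density 0 \<sigma> x * x ^ 4) (3 * \<sigma> ^ 4)"
    using normal_moment_even[OF \<sigma>, of 0 2] \<sigma> by (simp add: fact_numeral field_simps power_divide power_numeral_reduce)
  have int: "integrable M (\<lambda>\<omega>. X \<omega> ^ 4)"
    using distributed_integrable[OF D, of "\<lambda>x. x ^ 4"] hb by (auto simp: has_bochner_integral_iff)
  have ex: "expectation (\<lambda>\<omega>. X \<omega> ^ 4) = 3 * \<sigma> ^ 4"
    using distributed_integral[OF D, of "\<lambda>x. x ^ 4"] hb by (auto simp: has_bochner_integral_iff)
  have "prob {\<omega> \<in> space M. \<bar>X \<omega>\<bar> > x} \<le> prob {\<omega> \<in> space M. X \<omega> ^ 4 \<ge> x ^ 4}"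
  proof (rule finite_measure_mono)
    show "{\<omega> \<in> space M. \<bar>X \<omega>\<bar> > x} \<subseteq> {\<omega> \<in> space M. X \<omega> ^ 4 \<ge> x ^ 4}"
    proof safe
      fix \<omega> assume "\<bar>X \<omega>\<bar> > x"
      then have "x ^ 4 \<le> \<bar>X \<omega>\<bar> ^ 4" using x by (intro power_mono) auto
      then show "x ^ 4 \<le> X \<omega> ^ 4" by simp
    qed
  qed measurable
  also have "\<dots> \<le> expectation (\<lambda>\<omega>. X \<omega> ^ 4) / x ^ 4"
    by (rule integral_Markov_inequality_measure[OF int, where A="{}"]) (use x in auto)
  finally show ?thesis using ex by simp
qed

text \<open>Completing the square turns the density times \<open>exp (s * x)\<close>,
  \<open>s = 1\<close> or \<open>s = -1\<close>, into \<open>exp (\<sigma>\<^sup>2 / 2)\<close>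
  times a shifted density; the sum of the two cases dominates
  \<open>exp \<bar>x\<bar>\<close>.\<close>

lemma normal_exp_abs_moment:
  assumes D: "distributed M lborel X (normal_density 0 \<sigma>)" and \<sigma>: "\<sigma> > 0"
  shows "integrable M (\<lambda>\<omega>. exp \<bar>X \<omega>\<bar>)" "expectation (\<lambda>\<omega>. exp \<bar>X \<omega>\<bar>) \<le> 2 * exp (\<sigma>\<^sup>2 / 2)"
proof -
  have eq: "normal_density 0 \<sigma> x * exp (s * x) = exp (\<sigma>\<^sup>2 / 2) * normal_density (s * \<sigma>\<^sup>2) \<sigma> x"
    if "s\<^sup>2 = 1" for s x :: real
  proof -
    have "- (x - 0)\<^sup>2 / (2 * \<sigma>\<^sup>2) + s * x = \<sigma>\<^sup>2 / 2 + - (x - s * \<sigma>\<^sup>2)\<^sup>2 / (2 * \<sigma>\<^sup>2)"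
      using \<sigma> that by (simp add: field_simps power2_eq_square)
    then show ?thesis unfolding normal_density_def by (simp add: exp_add[symmetric] mult.assoc[symmetric])
  qed
  have hb: "has_bochner_integral lborel (\<lambda>x. normal_density 0 \<sigma> x * exp (s * x)) (exp (\<sigma>\<^sup>2 / 2))"
    if "s\<^sup>2 = 1" for s :: real
    unfolding eq[OF that] using \<sigma> by (auto simp: has_bochner_integral_iff)
  have "integrable lborel (\<lambda>x. normal_density 0 \<sigma> x * exp (1 * x) + normal_density 0 \<sigma> x * exp (-1 * x))"
    using hb[of 1] hb[of "-1"] by (intro Bochner_Integration.integrable_add) (auto simp: has_bochner_integral_iff)
  then have i1: "integrable lborel (\<lambda>x. normal_density 0 \<sigma> x * (exp x + exp (-x)))" by (simp add: distrib_left)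
  have v1: "(\<integral>x. normal_density 0 \<sigma> x * (exp x + exp (-x)) \<partial>lborel) = 2 * exp (\<sigma>\<^sup>2 / 2)"
    using hb[of 1] hb[of "-1"] by (simp add: distrib_left has_bochner_integral_iff)
  have le: "exp \<bar>x\<bar> \<le> exp x + exp (- x)" for x :: real
    by (cases "x \<ge> 0") auto
  have i2: "integrable lborel (\<lambda>x. normal_density 0 \<sigma> x * exp \<bar>x\<bar>)"
    by (rule Bochner_Integration.integrable_bound[OF i1])
       (auto intro!: always_eventually mult_left_mono le simp: abs_mult abs_of_nonneg)
  show "integrable M (\<lambda>\<omega>. exp \<bar>X \<omega>\<bar>)"
    using distributed_integrable[OF D, of "\<lambda>x. exp \<bar>x\<bar>"] i2 by auto
  have "expectation (\<lambda>\<omega>. exp \<bar>X \<omega>\<bar>) = (\<integral>x. normal_density 0 \<sigma> x * exp \<bar>x\<bar> \<partial>lborel)"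
    using distributed_integral[OF D, of "\<lambda>x. exp \<bar>x\<bar>"] by auto
  also have "\<dots> \<le> (\<integral>x. normal_density 0 \<sigma> x * (exp x + exp (-x)) \<partial>lborel)"
    by (rule integral_mono[OF i2 i1]) (auto intro!: mult_left_mono simp: abs_if)
  finally show "expectation (\<lambda>\<omega>. exp \<bar>X \<omega>\<bar>) \<le> 2 * exp (\<sigma>\<^sup>2 / 2)" using v1 by simp
qed

lemma normal_uminus:
  assumes "distributed M lborel X (normal_density 0 \<sigma>)" "\<sigma> > 0"
  shows "distributed M lborel (\<lambda>\<omega>. - X \<omega>) (normal_density 0 \<sigma>)"
  using normal_density_affine[OF assms, of "-1" 0] by simp

text \<open>The tail is bounded below by the mass of the single interval from
  \<open>x * \<sigma>\<close> to \<open>(x + 1) * \<sigma>\<close>, on which the density is smallest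
  at the right end.\<close>

lemma normal_upper_tail:
  assumes D: "distributed M lborel X (normal_density 0 \<sigma>)" and \<sigma>: "\<sigma> > 0" and x: "x \<ge> 0"
  shows "prob {\<omega> \<in> space M. X \<omega> > x * \<sigma>} \<ge> normal_density 0 1 (x + 1)"
proof -
  have [measurable]: "X \<in> borel_measurable M"
    using distributed_measurable[OF D] by simp
  have "ennreal (normal_density 0 1 (x + 1)) = (\<integral>\<^sup>+y. ennreal (normal_density 0 1 (x + 1) / \<sigma>) * indicator {x * \<sigma><..(x + 1) * \<sigma>} y \<partial>lborel)"
    using \<sigma> by (simp add: nn_integral_cmult_indicator algebra_simps ennreal_mult'[symmetric])
  also have "\<dots> \<le> (\<integral>\<^sup>+y. ennreal (normal_density 0 \<sigma> y) * indicator {x * \<sigma><..} y \<partial>lborel)"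
  proof (rule nn_integral_mono)
    fix y :: real
    show "ennreal (normal_density 0 1 (x + 1) / \<sigma>) * indicator {x * \<sigma><..(x + 1) * \<sigma>} y \<le> ennreal (normal_density 0 \<sigma> y) * indicator {x * \<sigma><..} y"
    proof (cases "y \<in> {x * \<sigma><..(x + 1) * \<sigma>}")
      case True
      then have "y\<^sup>2 \<le> ((x + 1) * \<sigma>)\<^sup>2" using x \<sigma>
        by (intro power_mono) (auto intro: order_trans[OF mult_nonneg_nonneg[OF x, of \<sigma>]])
      then have "y\<^sup>2 / \<sigma>\<^sup>2 \<le> (x + 1)\<^sup>2" using \<sigma> by (simp add: power_mult_distrib divide_le_eq)
      then have "exp (- (x + 1)\<^sup>2 / 2) \<le> exp (- y\<^sup>2 / (2 * \<sigma>\<^sup>2))" using \<sigma> by (simp add: field_simps)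
      then have "normal_density 0 1 (x + 1) / \<sigma> \<le> normal_density 0 \<sigma> y"
        using \<sigma> by (simp add: normal_density_def real_sqrt_mult field_simps)
      then show ?thesis using True by (auto simp: ennreal_leI)
    qed auto
  qed
  also have "\<dots> = emeasure M (X -` {x * \<sigma><..} \<inter> space M)"
    by (rule distributed_emeasure[OF D, symmetric]) simp
  also have "X -` {x * \<sigma><..} \<inter> space M = {\<omega> \<in> space M. X \<omega> > x * \<sigma>}" by auto
  finally show ?thesis by (simp add: emeasure_eq_measure)
qed

lemma normal_lower_tail:
  assumes D: "distributed M lborel X (normal_density 0 \<sigma>)" and \<sigma>: "\<sigma> > 0" and x: "x \<ge> 0"
  shows "prob {\<omega> \<in> space M. X \<omega> < - (x * \<sigma>)} \<ge> normal_density 0 1 (x + 1)"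
  using normal_upper_tail[OF normal_uminus[OF D \<sigma>] \<sigma> x] by (simp add: less_minus_iff)

lemma normal_half:
  assumes D: "distributed M lborel X (normal_density 0 \<sigma>)" and \<sigma>: "\<sigma> > 0"
  shows "prob {\<omega> \<in> space M. X \<omega> \<ge> 0} = 1 / 2" "prob {\<omega> \<in> space M. X \<omega> \<le> 0} = 1 / 2"
proof -
  have [measurable]: "X \<in> borel_measurable M"
    using distributed_measurable[OF D] by simp
  note D' = normal_uminus[OF D \<sigma>]
  have "distr M lborel X = distr M lborel (\<lambda>\<omega>. - X \<omega>)"
    using D D' by (simp add: distributed_def)
  then have "measure (distr M lborel X) {0..} = measure (distr M lborel (\<lambda>\<omega>. - X \<omega>)) {0..}" by simp
  then have e: "prob {\<omega> \<in> space M. X \<omega> \<ge> 0} = prob {\<omega> \<in> space M. X \<omega> \<le> 0}"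
    by (simp add: measure_distr vimage_def Int_def conj_commute)
  have "AE \<omega> in M. X \<omega> \<noteq> 0"
  proof -
    have "emeasure M (X -` {0} \<inter> space M) = (\<integral>\<^sup>+y. ennreal (normal_density 0 \<sigma> y) * indicator {0} y \<partial>lborel)"
      by (rule distributed_emeasure[OF D]) simp
    also have "\<dots> = 0" by (subst nn_integral_0_iff_AE) (auto intro: AE_mp[OF AE_lborel_singleton[of 0]])
    finally show ?thesis by (intro AE_I[of _ _ "X -` {0} \<inter> space M"]) auto
  qed
  then have "prob {\<omega> \<in> space M. X \<omega> \<ge> 0 \<and> X \<omega> \<le> 0} = 0"
    by (subst prob_eq_0) (auto elim!: eventually_mono)
  moreover have "prob ({\<omega> \<in> space M. X \<omega> \<ge> 0} \<union> {\<omega> \<in> space M. X \<omega> \<le> 0}) =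
      prob {\<omega> \<in> space M. X \<omega> \<ge> 0} + prob {\<omega> \<in> space M. X \<omega> \<le> 0} - prob ({\<omega> \<in> space M. X \<omega> \<ge> 0} \<inter> {\<omega> \<in> space M. X \<omega> \<le> 0})"
    by (rule measure_Un3) (auto simp: fmeasurable_eq_sets)
  moreover have "{\<omega> \<in> space M. X \<omega> \<ge> 0} \<union> {\<omega> \<in> space M. X \<omega> \<le> 0} = space M" by auto
  moreover have "{\<omega> \<in> space M. X \<omega> \<ge> 0} \<inter> {\<omega> \<in> space M. X \<omega> \<le> 0} = {\<omega> \<in> space M. X \<omega> \<ge> 0 \<and> X \<omega> \<le> 0}" by auto
  ultimately show "prob {\<omega> \<in> space M. X \<omega> \<ge> 0} = 1 / 2" "prob {\<omega> \<in> space M. X \<omega> \<le> 0} = 1 / 2"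
    using e prob_space by auto
qed

end

section \<open>Partial sums of independent variables\<close>

context prob_space begin

text \<open>This replaces the Markov property. Applying the predicates to restricted families
  guarantees that each of them reads its own block of indices only.\<close>

lemma indep_past_future:
  fixes \<xi> :: "nat \<Rightarrow> 'a \<Rightarrow> real"
  assumes ind: "indep_vars (\<lambda>_. borel) \<xi> {..<b}" and "a \<le> b"
    and P: "Measurable.pred (\<Pi>\<^sub>M l\<in>{..<a}. borel) P"
    and Q: "Measurable.pred (\<Pi>\<^sub>M l\<in>{a..<b}. borel) Q"
  shows "prob {\<omega> \<in> space M. P (\<lambda>l\<in>{..<a}. \<xi> l \<omega>) \<and> Q (\<lambda>l\<in>{a..<b}. \<xi> l \<omega>)} =
    prob {\<omega> \<in> space M. P (\<lambda>l\<in>{..<a}. \<xi> l \<omega>)} * prob {\<omega> \<in> space M. Q (\<lambda>l\<in>{a..<b}. \<xi> l \<omega>)}"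
proof -
  let ?X = "\<lambda>\<omega>. \<lambda>l\<in>{..<a}. \<xi> l \<omega>" and ?Y = "\<lambda>\<omega>. \<lambda>l\<in>{a..<b}. \<xi> l \<omega>"
  let ?MA = "\<Pi>\<^sub>M l\<in>{..<a}. borel :: real measure" and ?MB = "\<Pi>\<^sub>M l\<in>{a..<b}. borel :: real measure"
  have iv: "indep_var ?MA ?X ?MB ?Y"
    by (rule indep_var_restrict[OF ind]) (use \<open>a \<le> b\<close> in auto)
  have sp: "?X \<omega> \<in> space ?MA" "?Y \<omega> \<in> space ?MB" for \<omega>
    by (auto simp: space_PiM)
  have "prob ((\<lambda>\<omega>. (?X \<omega>, ?Y \<omega>)) -` ({x \<in> space ?MA. P x} \<times> {y \<in> space ?MB. Q y}) \<inter> space M) =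
    prob (?X -` {x \<in> space ?MA. P x} \<inter> space M) * prob (?Y -` {y \<in> space ?MB. Q y} \<inter> space M)"
    by (rule indep_varD[OF iv]) (use P Q in auto)
  moreover have "(\<lambda>\<omega>. (?X \<omega>, ?Y \<omega>)) -` ({x \<in> space ?MA. P x} \<times> {y \<in> space ?MB. Q y}) \<inter> space M =
      {\<omega> \<in> space M. P (?X \<omega>) \<and> Q (?Y \<omega>)}"
    "?X -` {x \<in> space ?MA. P x} \<inter> space M = {\<omega> \<in> space M. P (?X \<omega>)}"
    "?Y -` {y \<in> space ?MB. Q y} \<inter> space M = {\<omega> \<in> space M. Q (?Y \<omega>)}"
    using sp by auto
  ultimately show ?thesis by simp
qed

text \<open>Splitting on the sign of the partial sum makes the next constraint one-sided, so no
  conditioning on its exact value is needed.\<close>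

lemma confined_partial_sums:
  fixes \<xi> :: "nat \<Rightarrow> 'a \<Rightarrow> real"
  assumes ind: "indep_vars (\<lambda>_. borel) \<xi> {..<n}" and H: "H \<subseteq> {..<n}"
    and q: "\<And>i. i \<in> H \<Longrightarrow> q \<le> prob {\<omega> \<in> space M. \<xi> i \<omega> > d i}"
      "\<And>i. i \<in> H \<Longrightarrow> q \<le> prob {\<omega> \<in> space M. \<xi> i \<omega> < - d i}"
    and q1: "0 \<le> q" "q \<le> 1"
  shows "prob {\<omega> \<in> space M. \<forall>i\<in>H. \<bar>\<Sum>l\<le>i. \<xi> l \<omega>\<bar> \<le> d i} \<le> (1 - q) ^ card H"
  using ind H q
proof (induction n arbitrary: H)
  case (Suc n)
  have ind': "indep_vars (\<lambda>_. borel) \<xi> {..<n}"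
    by (rule indep_vars_subset[OF Suc.prems(1)]) auto
  have meas[measurable]: "\<xi> l \<in> borel_measurable M" if "l < Suc n" for l
    using Suc.prems(1) that unfolding indep_vars_def by auto
  define H' where "H' = H - {n}"
  have H': "H' \<subseteq> {..<n}" using Suc.prems(2) by (auto simp: H'_def less_Suc_eq)
  have fin: "finite H" using Suc.prems(2) finite_subset by blast
  let ?E = "{\<omega> \<in> space M. \<forall>i\<in>H'. \<bar>\<Sum>l\<le>i. \<xi> l \<omega>\<bar> \<le> d i}"
  have IH: "prob ?E \<le> (1 - q) ^ card H'"
    by (rule Suc.IH[OF ind' H']) (use Suc.prems(3,4) in \<open>auto simp: H'_def\<close>)
  have mE: "{\<omega> \<in> space M. (\<forall>i\<in>H'. \<bar>\<Sum>l\<le>i. \<xi> l \<omega>\<bar> \<le> d i)} \<in> events"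
  proof (rule sets.sets_Collect_finite_All)
    show "finite H'" using fin by (simp add: H'_def)
    fix i assume "i \<in> H'"
    then have "l \<le> i \<Longrightarrow> l < Suc n" for l using H' by auto
    then have "(\<lambda>\<omega>. \<Sum>l\<le>i. \<xi> l \<omega>) \<in> borel_measurable M" by (intro borel_measurable_sum) (auto intro!: meas)
    then show "{\<omega> \<in> space M. \<bar>\<Sum>l\<le>i. \<xi> l \<omega>\<bar> \<le> d i} \<in> events" by measurable
  qed
  show ?case
  proof (cases "n \<in> H")
    case False
    then have "H = H'" by (auto simp: H'_def)
    then show ?thesis using IH by simp
  next
    case True
    then have card: "card H = Suc (card H')" unfolding H'_def using fin True by (simp only: card_Suc_Diff1)
    define S where "S \<omega> = (\<Sum>l<n. \<xi> l \<omega>)" for \<omega>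
    have [measurable]: "S \<in> borel_measurable M" unfolding S_def by (intro borel_measurable_sum) auto
    let ?P = "\<lambda>x. \<forall>i\<in>H'. \<bar>\<Sum>l\<le>i. x l\<bar> \<le> d i"
    have P: "Measurable.pred (\<Pi>\<^sub>M l\<in>{..<n}. borel) (\<lambda>x. ?P x \<and> R (\<Sum>l<n. x l))"
      if "Measurable.pred borel R" for R :: "real \<Rightarrow> bool"
    proof (rule pred_intros_logic)
      have "(\<lambda>x. \<Sum>l<n. x l :: real) \<in> borel_measurable (\<Pi>\<^sub>M l\<in>{..<n}. borel)"
        by (rule borel_measurable_sum[of "{..<n}" "\<lambda>l x. x l"]) auto
      then show "Measurable.pred (\<Pi>\<^sub>M l\<in>{..<n}. borel) (\<lambda>x. R (\<Sum>l<n. x l))"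
        using that by (rule measurable_compose)
      show "Measurable.pred (\<Pi>\<^sub>M l\<in>{..<n}. borel) (\<lambda>x. ?P x)"
      proof (rule pred_intros_finite)
        show "finite H'" using fin by (simp add: H'_def)
        fix i assume "i \<in> H'"
        then have "(\<lambda>x. \<Sum>l\<le>i. x l :: real) \<in> borel_measurable (\<Pi>\<^sub>M l\<in>{..<n}. borel)"
          using H' by (intro borel_measurable_sum[of "{..i}" "\<lambda>l x. x l"] measurable_component_singleton) auto
        then show "Measurable.pred (\<Pi>\<^sub>M l\<in>{..<n}. borel) (\<lambda>x. \<bar>\<Sum>l\<le>i. x l\<bar> \<le> d i)" by measurable
      qed
    qed
    have rest: "(\<forall>i\<in>H'. \<bar>\<Sum>l\<le>i. (\<lambda>l\<in>{..<n}. \<xi> l \<omega>) l\<bar> \<le> d i) = (\<forall>i\<in>H'. \<bar>\<Sum>l\<le>i. \<xi> l \<omega>\<bar> \<le> d i)" for \<omega>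
      using H' by (intro ball_cong arg_cong2[where f="(\<le>)"] arg_cong[where f=abs] sum.cong) auto
    have prod: "prob {\<omega> \<in> space M. ((\<forall>i\<in>H'. \<bar>\<Sum>l\<le>i. \<xi> l \<omega>\<bar> \<le> d i) \<and> R (S \<omega>)) \<and> Q (\<xi> n \<omega>)} =
        prob {\<omega> \<in> space M. (\<forall>i\<in>H'. \<bar>\<Sum>l\<le>i. \<xi> l \<omega>\<bar> \<le> d i) \<and> R (S \<omega>)} * prob {\<omega> \<in> space M. Q (\<xi> n \<omega>)}"
      if R: "Measurable.pred borel R" and Q: "Measurable.pred borel Q" for R Q
    proof -
      have Q': "Measurable.pred (\<Pi>\<^sub>M l\<in>{n..<Suc n}. borel) (\<lambda>x. Q (x n))"
      proof -
        have [measurable]: "(\<lambda>x. x n) \<in> borel_measurable (\<Pi>\<^sub>M l\<in>{n..<Suc n}. borel)"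
          by (rule measurable_component_singleton) simp
        note [measurable] = Q
        show ?thesis by measurable
      qed
      show ?thesis
        using indep_past_future[OF Suc.prems(1) _ P[OF R] Q'] unfolding rest by (simp add: S_def)
    qed
    let ?A = "\<lambda>R. {\<omega> \<in> space M. (\<forall>i\<in>H'. \<bar>\<Sum>l\<le>i. \<xi> l \<omega>\<bar> \<le> d i) \<and> R (S \<omega>)}"
    have mA: "?A R \<in> events" if [measurable]: "Measurable.pred borel R" for R
    proof -
      have "{\<omega> \<in> space M. R (S \<omega>)} \<in> events" by measurable
      with mE have "?E \<inter> {\<omega> \<in> space M. R (S \<omega>)} \<in> events" by (rule sets.Int)
      moreover have "?A R = ?E \<inter> {\<omega> \<in> space M. R (S \<omega>)}" by blast
      ultimately show ?thesis by (simp only:)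
    qed
    have le1: "prob {\<omega> \<in> space M. \<xi> n \<omega> \<le> d n} \<le> 1 - q"
    proof -
      have "{\<omega> \<in> space M. \<xi> n \<omega> \<le> d n} = space M - {\<omega> \<in> space M. \<xi> n \<omega> > d n}" by auto
      then show ?thesis using Suc.prems(3)[OF True] by (simp add: prob_compl)
    qed
    have le2: "prob {\<omega> \<in> space M. \<xi> n \<omega> \<ge> - d n} \<le> 1 - q"
    proof -
      have "{\<omega> \<in> space M. \<xi> n \<omega> \<ge> - d n} = space M - {\<omega> \<in> space M. \<xi> n \<omega> < - d n}" by auto
      then show ?thesis using Suc.prems(4)[OF True] by (simp add: prob_compl)
    qed
    \<comment> \<open>If \<open>S >= 0\<close>, then staying within \<open>d n\<close> forces
      \<open>\<xi> n <= d n\<close>; if \<open>S < 0\<close>, it forces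
      \<open>\<xi> n >= - d n\<close>. Each one-sided event has probability at most
      \<open>1 - q\<close> and is independent of the past.\<close>
    let ?B1 = "{\<omega> \<in> space M. ((\<forall>i\<in>H'. \<bar>\<Sum>l\<le>i. \<xi> l \<omega>\<bar> \<le> d i) \<and> S \<omega> \<ge> 0) \<and> \<xi> n \<omega> \<le> d n}"
    let ?B2 = "{\<omega> \<in> space M. ((\<forall>i\<in>H'. \<bar>\<Sum>l\<le>i. \<xi> l \<omega>\<bar> \<le> d i) \<and> S \<omega> < 0) \<and> \<xi> n \<omega> \<ge> - d n}"
    have mB1: "?B1 \<in> events"
    proof -
      have "?B1 = ?A (\<lambda>s. s \<ge> 0) \<inter> {\<omega> \<in> space M. \<xi> n \<omega> \<le> d n}" by auto
      also have "\<dots> \<in> events" by (intro sets.Int mA) measurable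
      finally show ?thesis .
    qed
    have mB2: "?B2 \<in> events"
    proof -
      have "?B2 = ?A (\<lambda>s. s < 0) \<inter> {\<omega> \<in> space M. \<xi> n \<omega> \<ge> - d n}" by auto
      also have "\<dots> \<in> events" by (intro sets.Int mA) measurable
      finally show ?thesis .
    qed
    have "prob {\<omega> \<in> space M. \<forall>i\<in>H. \<bar>\<Sum>l\<le>i. \<xi> l \<omega>\<bar> \<le> d i} \<le> prob (?B1 \<union> ?B2)"
    proof (rule finite_measure_mono)
      show "{\<omega> \<in> space M. \<forall>i\<in>H. \<bar>\<Sum>l\<le>i. \<xi> l \<omega>\<bar> \<le> d i} \<subseteq> ?B1 \<union> ?B2"
      proof
        fix \<omega> assume \<omega>: "\<omega> \<in> {\<omega> \<in> space M. \<forall>i\<in>H. \<bar>\<Sum>l\<le>i. \<xi> l \<omega>\<bar> \<le> d i}"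
        then have "\<bar>S \<omega> + \<xi> n \<omega>\<bar> \<le> d n" using True by (auto simp: S_def lessThan_Suc_atMost[symmetric])
        then show "\<omega> \<in> ?B1 \<union> ?B2" using \<omega> by (auto simp: H'_def)
      qed
    qed (use mB1 mB2 in auto)
    also have "\<dots> \<le> prob ?B1 + prob ?B2" by (rule measure_Un_le[OF mB1 mB2])
    also have "\<dots> \<le> prob (?A (\<lambda>s. s \<ge> 0)) * (1 - q) + prob (?A (\<lambda>s. s < 0)) * (1 - q)"
      using le1 le2 by (subst (1 2) prod) (auto intro!: add_mono mult_left_mono)
    also have "\<dots> = (1 - q) * prob (?A (\<lambda>s. s \<ge> 0) \<union> ?A (\<lambda>s. s < 0))"
    proof -
      have "prob (?A (\<lambda>s. s \<ge> 0) \<union> ?A (\<lambda>s. s < 0)) = prob (?A (\<lambda>s. s \<ge> 0)) + prob (?A (\<lambda>s. s < 0))"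
        by (rule finite_measure_Union) (auto intro!: mA)
      then show ?thesis by (simp add: algebra_simps)
    qed
    also have "?A (\<lambda>s. s \<ge> 0) \<union> ?A (\<lambda>s. s < 0) = ?E" by auto
    also have "(1 - q) * prob ?E \<le> (1 - q) * (1 - q) ^ card H'"
      using IH q1 by (intro mult_left_mono) auto
    finally show ?thesis by (simp add: card)
  qed
qed (simp add: prob_space)

text \<open>Again the state enters only through its sign, so that two unconditional bounds on each block
  suffice.\<close>

lemma markov_blocks:
  fixes \<xi> :: "nat \<Rightarrow> 'a \<Rightarrow> real" and m :: nat
  defines "H i x \<equiv> \<Sum>l<Suc (i * m). x l" and "D i k x \<equiv> \<Sum>l=Suc (i * m)..<Suc (i * m + k). x l"
  assumes ind: "indep_vars (\<lambda>_. borel) \<xi> {..<Suc (n * m)}"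
    and I0: "I0 \<in> sets borel"
    and Bs: "\<And>i b. B i b \<in> sets borel"
    and p: "\<And>i b. i < n \<Longrightarrow> p \<le> prob {\<omega> \<in> space M. (\<forall>k\<le>m. \<bar>D i k (\<lambda>l. \<xi> l \<omega>)\<bar> \<le> y i) \<and> D i m (\<lambda>l. \<xi> l \<omega>) \<in> B i b}"
    and p0: "0 \<le> p"
  shows "prob {\<omega> \<in> space M. \<xi> 0 \<omega> \<in> I0} * p ^ n \<le> prob {\<omega> \<in> space M. \<xi> 0 \<omega> \<in> I0 \<and>
     (\<forall>i<n. (\<forall>k\<le>m. \<bar>D i k (\<lambda>l. \<xi> l \<omega>)\<bar> \<le> y i) \<and> D i m (\<lambda>l. \<xi> l \<omega>) \<in> B i (H i (\<lambda>l. \<xi> l \<omega>) \<ge> 0))}"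
  using ind p
proof (induction n)
  case (Suc n)
  have ind': "indep_vars (\<lambda>_. borel) \<xi> {..<Suc (n * m)}"
    by (rule indep_vars_subset[OF Suc.prems(1)]) auto
  have meas[measurable]: "\<xi> l \<in> borel_measurable M" if "l < Suc (Suc n * m)" for l
    using Suc.prems(1) that unfolding indep_vars_def by auto
  let ?\<xi> = "\<lambda>\<omega> l. \<xi> l \<omega>"
  \<comment> \<open>Variable 0 is the initial value and block \<open>i\<close> consists of the
    \<open>m\<close> indices from \<open>Suc (i * m)\<close> on. So \<open>C x i b\<close> reads
    block \<open>i\<close> only, and \<open>H i x\<close> reads what precedes it.\<close>
  define C where "C x i b \<longleftrightarrow> (\<forall>k\<le>m. \<bar>D i k x\<bar> \<le> y i) \<and> D i m x \<in> B i b" for x i b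
  define P where "P x \<longleftrightarrow> x 0 \<in> I0 \<and> (\<forall>i<n. C x i (H i x \<ge> 0))" for x
  have IH: "prob {\<omega> \<in> space M. \<xi> 0 \<omega> \<in> I0} * p ^ n \<le> prob {\<omega> \<in> space M. P (?\<xi> \<omega>)}"
    using Suc.IH[OF ind'] Suc.prems(2) by (simp add: P_def C_def)
  have pC: "p \<le> prob {\<omega> \<in> space M. C (?\<xi> \<omega>) n b}" for b
    using Suc.prems(2)[of n b] by (simp add: C_def)
  have D_meas: "(\<lambda>x. D i k x) \<in> borel_measurable (\<Pi>\<^sub>M l\<in>A. borel)" if "{Suc (i * m)..<Suc (i * m + k)} \<subseteq> A" for i k A
    unfolding D_def using that
    by (intro borel_measurable_sum[of _ "\<lambda>l x. x l"] measurable_component_singleton) auto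
  have H_meas: "(\<lambda>x. H i x) \<in> borel_measurable (\<Pi>\<^sub>M l\<in>A. borel)" if "{..<Suc (i * m)} \<subseteq> A" for i A
    unfolding H_def using that
    by (intro borel_measurable_sum[of _ "\<lambda>l x. x l"] measurable_component_singleton) auto
  have C_meas: "Measurable.pred (\<Pi>\<^sub>M l\<in>A. borel) (\<lambda>x. C x i b)" if A: "{Suc (i * m)..<Suc (i * m + m)} \<subseteq> A" for i b A
  proof -
    have [measurable]: "(\<lambda>x. D i k x) \<in> borel_measurable (\<Pi>\<^sub>M l\<in>A. borel)" if "k \<le> m" for k
      by (rule D_meas) (use A that in auto)
    have [measurable]: "B i b \<in> sets borel" by (rule Bs)
    have "Measurable.pred (\<Pi>\<^sub>M l\<in>A. borel) (\<lambda>x. \<forall>k\<in>{..m}. \<bar>D i k x\<bar> \<le> y i)"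
      by (rule pred_intros_finite) auto
    then have "Measurable.pred (\<Pi>\<^sub>M l\<in>A. borel) (\<lambda>x. (\<forall>k\<in>{..m}. \<bar>D i k x\<bar> \<le> y i) \<and> D i m x \<in> B i b)"
      by measurable
    moreover have "(\<lambda>x. C x i b) = (\<lambda>x. (\<forall>k\<in>{..m}. \<bar>D i k x\<bar> \<le> y i) \<and> D i m x \<in> B i b)"
      by (auto simp: fun_eq_iff C_def)
    ultimately show ?thesis by simp
  qed
  have sub: "{Suc (i * m)..<Suc (i * m + m)} \<subseteq> {..<Suc (n * m)}" "{..<Suc (i * m)} \<subseteq> {..<Suc (n * m)}" if "i < n" for i
  proof -
    have "Suc i * m \<le> n * m" using that by (intro mult_right_mono) auto
    then show "{Suc (i * m)..<Suc (i * m + m)} \<subseteq> {..<Suc (n * m)}" "{..<Suc (i * m)} \<subseteq> {..<Suc (n * m)}"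
      using that by auto
  qed
  have P_meas: "Measurable.pred (\<Pi>\<^sub>M l\<in>{..<Suc (n * m)}. borel) P"
  proof -
    let ?N = "\<Pi>\<^sub>M l\<in>{..<Suc (n * m)}. borel :: real measure"
    have [measurable]: "I0 \<in> sets borel" by (rule I0)
    have "Measurable.pred ?N (\<lambda>x. \<forall>i\<in>{..<n}. C x i (H i x \<ge> 0))"
    proof (rule pred_intros_finite)
      fix i assume "i \<in> {..<n}"
      then have i: "i < n" by simp
      note [measurable] = H_meas[OF sub(2)[OF i]] C_meas[OF sub(1)[OF i]]
      have eq: "C x i (H i x \<ge> 0) \<longleftrightarrow> (H i x \<ge> 0 \<and> C x i True) \<or> (H i x < 0 \<and> C x i False)" for x
        by (cases "H i x \<ge> 0") auto
      show "Measurable.pred ?N (\<lambda>x. C x i (H i x \<ge> 0))" unfolding eq by measurable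
    qed auto
    moreover have "Measurable.pred ?N (\<lambda>x. x 0 \<in> I0)" by measurable
    ultimately have "Measurable.pred ?N (\<lambda>x. x 0 \<in> I0 \<and> (\<forall>i\<in>{..<n}. C x i (H i x \<ge> 0)))"
      by (intro pred_intros_logic(3))
    moreover have "P = (\<lambda>x. x 0 \<in> I0 \<and> (\<forall>i\<in>{..<n}. C x i (H i x \<ge> 0)))"
      by (auto simp: fun_eq_iff P_def)
    ultimately show ?thesis by simp
  qed
  have agree: "D i k x = D i k x'" if "\<And>l. l \<in> {Suc (i * m)..<Suc (i * m + k)} \<Longrightarrow> x l = x' l" for i k and x x' :: "nat \<Rightarrow> real"
    unfolding D_def using that by (intro sum.cong) auto
  have C_rest: "C (\<lambda>l\<in>A. \<xi> l \<omega>) i b = C (?\<xi> \<omega>) i b" if A: "{Suc (i * m)..<Suc (i * m + m)} \<subseteq> A" for i b A \<omega>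
  proof -
    have "D i k (\<lambda>l\<in>A. \<xi> l \<omega>) = D i k (?\<xi> \<omega>)" if "k \<le> m" for k
    proof (rule agree)
      fix l assume "l \<in> {Suc (i * m)..<Suc (i * m + k)}"
      then have "l \<in> {Suc (i * m)..<Suc (i * m + m)}" using that by auto
      then show "(\<lambda>l\<in>A. \<xi> l \<omega>) l = \<xi> l \<omega>" using A by (simp add: subsetD)
    qed
    then show ?thesis by (simp add: C_def)
  qed
  have H_rest: "H i (\<lambda>l\<in>A. \<xi> l \<omega>) = H i (?\<xi> \<omega>)" if "{..<Suc (i * m)} \<subseteq> A" for i A \<omega>
    unfolding H_def using that by (intro sum.cong) auto
  have P_rest: "P (\<lambda>l\<in>{..<Suc (n * m)}. \<xi> l \<omega>) = P (?\<xi> \<omega>)" for \<omega>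
  proof -
    have "C (\<lambda>l\<in>{..<Suc (n * m)}. \<xi> l \<omega>) i (H i (\<lambda>l\<in>{..<Suc (n * m)}. \<xi> l \<omega>) \<ge> 0) = C (?\<xi> \<omega>) i (H i (?\<xi> \<omega>) \<ge> 0)"
      if "i < n" for i
      unfolding C_rest[OF sub(1)[OF that]] H_rest[OF sub(2)[OF that]] ..
    then show ?thesis unfolding P_def by auto
  qed
  have R_meas: "Measurable.pred (\<Pi>\<^sub>M l\<in>{..<Suc (n * m)}. borel) (\<lambda>x. P x \<and> (H n x \<ge> 0) = b)" for b
  proof -
    note [measurable] = P_meas H_meas[of n "{..<Suc (n * m)}"]
    show ?thesis by measurable
  qed
  \<comment> \<open>For a fixed sign \<open>b\<close> the condition on block \<open>n\<close> is a
    fixed event of that block, so independence applies; the two signs are added up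
    afterwards.\<close>
  have prod: "prob {\<omega> \<in> space M. (P (?\<xi> \<omega>) \<and> (H n (?\<xi> \<omega>) \<ge> 0) = b) \<and> C (?\<xi> \<omega>) n b} =
      prob {\<omega> \<in> space M. P (?\<xi> \<omega>) \<and> (H n (?\<xi> \<omega>) \<ge> 0) = b} * prob {\<omega> \<in> space M. C (?\<xi> \<omega>) n b}" for b
  proof -
    have ind2: "indep_vars (\<lambda>_. borel) \<xi> {..<Suc (n * m + m)}"
      using Suc.prems(1) by (simp add: add.commute)
    show ?thesis
      using indep_past_future[OF ind2 _ R_meas[of b] C_meas[of n "{Suc (n * m)..<Suc (n * m + m)}" b]]
      by (simp add: P_rest C_rest H_rest)
  qed
  have m1: "{\<omega> \<in> space M. P (?\<xi> \<omega>) \<and> (H n (?\<xi> \<omega>) \<ge> 0) = b} \<in> events" for b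
  proof -
    have [measurable]: "(\<lambda>\<omega>. \<lambda>l\<in>{..<Suc (n * m)}. \<xi> l \<omega>) \<in> measurable M (\<Pi>\<^sub>M l\<in>{..<Suc (n * m)}. borel)"
      by (rule measurable_restrict) (auto intro!: meas)
    note [measurable] = R_meas[of b]
    have "{\<omega> \<in> space M. (\<lambda>x. P x \<and> (H n x \<ge> 0) = b) (\<lambda>l\<in>{..<Suc (n * m)}. \<xi> l \<omega>)} \<in> events"
      by measurable
    then show ?thesis by (simp add: P_rest H_rest)
  qed
  have m2: "{\<omega> \<in> space M. C (?\<xi> \<omega>) n b} \<in> events" for b
  proof -
    let ?A = "{Suc (n * m)..<Suc (n * m + m)}"
    have [measurable]: "(\<lambda>\<omega>. \<lambda>l\<in>?A. \<xi> l \<omega>) \<in> measurable M (\<Pi>\<^sub>M l\<in>?A. borel)"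
      by (rule measurable_restrict) (auto intro!: meas)
    note [measurable] = C_meas[of n ?A b]
    have "{\<omega> \<in> space M. C (\<lambda>l\<in>?A. \<xi> l \<omega>) n b} \<in> events"
      by measurable
    then show ?thesis by (simp add: C_rest)
  qed
  let ?B = "\<lambda>b. {\<omega> \<in> space M. (P (?\<xi> \<omega>) \<and> (H n (?\<xi> \<omega>) \<ge> 0) = b) \<and> C (?\<xi> \<omega>) n b}"
  have m3: "?B b \<in> events" for b
  proof -
    have "?B b = {\<omega> \<in> space M. P (?\<xi> \<omega>) \<and> (H n (?\<xi> \<omega>) \<ge> 0) = b} \<inter> {\<omega> \<in> space M. C (?\<xi> \<omega>) n b}" by auto
    then show ?thesis using m1 m2 by auto
  qed
  have "prob {\<omega> \<in> space M. \<xi> 0 \<omega> \<in> I0} * p ^ Suc n \<le> prob {\<omega> \<in> space M. P (?\<xi> \<omega>)} * p"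
    using IH p0 by (simp add: mult.assoc[symmetric] mult_right_mono mult.commute[of p])
  also have "{\<omega> \<in> space M. P (?\<xi> \<omega>)} = {\<omega> \<in> space M. P (?\<xi> \<omega>) \<and> (H n (?\<xi> \<omega>) \<ge> 0) = True} \<union>
      {\<omega> \<in> space M. P (?\<xi> \<omega>) \<and> (H n (?\<xi> \<omega>) \<ge> 0) = False}" by auto
  also have "prob \<dots> = prob {\<omega> \<in> space M. P (?\<xi> \<omega>) \<and> (H n (?\<xi> \<omega>) \<ge> 0) = True} +
      prob {\<omega> \<in> space M. P (?\<xi> \<omega>) \<and> (H n (?\<xi> \<omega>) \<ge> 0) = False}"
    by (rule finite_measure_Union[OF m1 m1]) auto
  also have "\<dots> * p \<le> prob (?B True) + prob (?B False)"
    unfolding prod distrib_right by (intro add_mono mult_left_mono pC) auto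
  also have "\<dots> = prob (?B True \<union> ?B False)"
    by (rule finite_measure_Union[OF m3 m3, symmetric]) auto
  also have "?B True \<union> ?B False = {\<omega> \<in> space M. P (?\<xi> \<omega>) \<and> C (?\<xi> \<omega>) n (H n (?\<xi> \<omega>) \<ge> 0)}"
    (is "?L = ?R")
  proof (rule set_eqI)
    fix \<omega> show "\<omega> \<in> ?L \<longleftrightarrow> \<omega> \<in> ?R"
      by (cases "H n (?\<xi> \<omega>) \<ge> 0") auto
  qed
  also have "?R = {\<omega> \<in> space M. \<xi> 0 \<omega> \<in> I0 \<and> (\<forall>i<Suc n. C (?\<xi> \<omega>) i (H i (?\<xi> \<omega>) \<ge> 0))}"
    by (auto simp: P_def less_Suc_eq)
  finally show ?case by (simp only: C_def)
next
  case 0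
  show ?case by simp
qed

end

section \<open>Brownian motion\<close>

text \<open>A dyadic point of level \<open>J + 1\<close> is either of level \<open>J\<close> or one
  step of level \<open>J + 1\<close> to the right of such a point, so each level contributes at most
  one increment.\<close>

lemma chaining_bound:
  fixes g :: "real \<Rightarrow> real"
  assumes d: "\<And>j k. k < 2 ^ j \<Longrightarrow> \<bar>g (a + real (Suc k) * l / 2 ^ j) - g (a + real k * l / 2 ^ j)\<bar> \<le> d j"
    and k: "k \<le> 2 ^ J"
  shows "\<bar>g (a + real k * l / 2 ^ J) - g a\<bar> \<le> (\<Sum>j\<le>J. d j)"
  using k
proof (induction J arbitrary: k)
  case 0
  have "0 \<le> d 0" using d[of 0 0] by (meson abs_ge_zero order_trans zero_less_one power_0 zero_less_power zero_less_numeral)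
  moreover have "k = 0 \<or> k = 1" using 0 by auto
  ultimately show ?case using d[of 0 0] by auto
next
  case (Suc J)
  have d0: "0 \<le> d (Suc J)" using d[of 0 "Suc J"] by (meson abs_ge_zero order_trans zero_less_power zero_less_numeral)
  have even: "\<bar>g (a + real (2 * k') * l / 2 ^ Suc J) - g a\<bar> \<le> (\<Sum>j\<le>J. d j)" if "k' \<le> 2 ^ J" for k'
    using Suc.IH[OF that] by simp
  show ?case
  proof (cases "even k")
    case True
    then obtain k' where k': "k = 2 * k'" by auto
    show ?thesis using even[of k'] Suc.prems d0 unfolding k' by (simp del: of_nat_mult)
  next
    case False
    then obtain k' where k': "k = Suc (2 * k')" by (auto elim: oddE)
    have "2 * k' < 2 * 2 ^ J" using Suc.prems k' by simp
    then have "k' \<le> 2 ^ J" "2 * k' < 2 ^ Suc J" by auto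
    from even[OF this(1)] d[OF this(2)] show ?thesis unfolding k' by (simp del: of_nat_Suc of_nat_mult)
  qed
qed

locale brownian_motion = prob_space M for M :: "'a measure" +
  fixes W :: "real \<Rightarrow> 'a \<Rightarrow> real"
  assumes bm: "standard_brownian_motion M W"
begin

lemma W_measurable [measurable]: "t \<ge> 0 \<Longrightarrow> W t \<in> borel_measurable M"
  using bm by (simp add: standard_brownian_motion_def)

lemma W_0: "AE \<omega> in M. W 0 \<omega> = 0"
  using bm by (simp add: standard_brownian_motion_def)

lemma W_continuous: "AE \<omega> in M. continuous_on {0..} (\<lambda>t. W t \<omega>)"
  using bm by (simp add: standard_brownian_motion_def)

lemma W_increment:
  "0 \<le> s \<Longrightarrow> s < t \<Longrightarrow> distributed M lborel (\<lambda>\<omega>. W t \<omega> - W s \<omega>) (normal_density 0 (sqrt (t - s)))"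
  using bm by (simp add: standard_brownian_motion_def)

lemma W_indep:
  assumes "0 \<le> \<tau> 0" "\<And>i. i < k \<Longrightarrow> \<tau> i \<le> \<tau> (Suc i)"
  shows "indep_vars (\<lambda>_. borel) (\<lambda>i \<omega>. W (\<tau> (Suc i)) \<omega> - W (\<tau> i) \<omega>) {..<k}"
  using bm assms by (simp add: standard_brownian_motion_def)

section \<open>Oscillation of Brownian motion over an interval\<close>

text \<open>Only dyadic points are used, which keeps the condition countable and hence measurable;
  continuity extends it to the whole interval.\<close>

definition osc_le :: "real \<Rightarrow> real \<Rightarrow> real \<Rightarrow> 'a \<Rightarrow> bool" where
  "osc_le a l x \<omega> \<longleftrightarrow> (\<forall>J k. k \<le> 2 ^ J \<longrightarrow> \<bar>W (a + real k * l / 2 ^ J) \<omega> - W a \<omega>\<bar> \<le> x)"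

lemma osc_le_measurable [measurable]:
  assumes "a \<ge> 0" "l \<ge> 0" shows "Measurable.pred M (osc_le a l x)"
proof -
  have [measurable]: "W (a + real k * l / 2 ^ J) \<in> borel_measurable M" "W a \<in> borel_measurable M" for k J :: nat
    using assms by (auto intro!: W_measurable)
  show ?thesis unfolding osc_le_def[abs_def] by measurable
qed

text \<open>At dyadic level \<open>j\<close> the threshold is \<open>x / 10 * (9 / 10) ^ j\<close>; since \<open>2 * (9 / 10) ^ 4 > 1\<close>, the
  fourth moment bounds of the levels are summable, with sum at most 150000.\<close>

lemma osc_le_bound:
  assumes a: "a \<ge> 0" and l: "l > 0" and x: "x > 0"
  shows "prob {\<omega> \<in> space M. \<not> osc_le a l x \<omega>} \<le> 150000 * l\<^sup>2 / x ^ 4"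
proof -
  define d where "d j = x * (9 / 10) ^ j / 10" for j :: nat
  have d: "d j > 0" for j using x by (simp add: d_def)
  have dsum: "(\<Sum>j\<le>J. d j) \<le> x" for J
  proof -
    have "(\<Sum>j\<le>J. d j) = x / 10 * (\<Sum>j\<le>J. (9 / 10) ^ j)" by (simp add: d_def sum_distrib_left)
    also have "(\<Sum>j\<le>J. (9 / 10 :: real) ^ j) = (1 - (9 / 10) ^ Suc J) / (1 / 10)"
      by (subst sum_gp0) simp
    also have "x / 10 * \<dots> \<le> x" using x by (simp add: field_simps)
    finally show ?thesis .
  qed
  define A where "A j = (\<Union>k<2 ^ j. {\<omega> \<in> space M. \<bar>W (a + real (Suc k) * l / 2 ^ j) \<omega> - W (a + real k * l / 2 ^ j) \<omega>\<bar> > d j})" for j :: nat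
  have [measurable]: "W (a + real k * l / 2 ^ J) \<in> borel_measurable M" "W (a + (1 + real k) * l / 2 ^ J) \<in> borel_measurable M" for k J :: nat
    using assms by (auto intro!: W_measurable)
  have Am: "A j \<in> events" for j unfolding A_def by (intro sets.finite_UN) (auto simp: add.commute)
  \<comment> \<open>Here \<open>30000 = 3 * 10 ^ 4\<close> comes from the fourth moment and the
    factor \<open>1 / 10\<close> in \<open>d\<close>, and
    \<open>5000 / 6561 = 1 / (2 * (9 / 10) ^ 4)\<close> is the ratio of successive levels. The sum
    has the constant \<open>30000 * 6561 / 1561\<close>, below 150000.\<close>
  define c where "c j = 30000 * l\<^sup>2 / x ^ 4 * (5000 / 6561) ^ j" for j :: nat
  have Ab: "prob (A j) \<le> c j" for j
  proof -
    have "prob (A j) \<le> (\<Sum>k<2 ^ j. prob {\<omega> \<in> space M. \<bar>W (a + real (Suc k) * l / 2 ^ j) \<omega> - W (a + real k * l / 2 ^ j) \<omega>\<bar> > d j})"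
      unfolding A_def by (rule measure_UNION_le) (auto simp: add.commute)
    also have "\<dots> \<le> (\<Sum>k<(2::nat) ^ j. 3 * (l / 2 ^ j)\<^sup>2 / d j ^ 4)"
    proof (rule sum_mono)
      fix k :: nat
      have eq: "(a + real (Suc k) * l / 2 ^ j) - (a + real k * l / 2 ^ j) = l / 2 ^ j" by (simp add: field_simps)
      have D: "distributed M lborel (\<lambda>\<omega>. W (a + real (Suc k) * l / 2 ^ j) \<omega> - W (a + real k * l / 2 ^ j) \<omega>) (normal_density 0 (sqrt (l / 2 ^ j)))"
        using W_increment[of "a + real k * l / 2 ^ j" "a + real (Suc k) * l / 2 ^ j"] a l unfolding eq
        by (simp add: divide_strict_right_mono)
      have "sqrt (l / 2 ^ j) ^ 4 = (l / 2 ^ j)\<^sup>2"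
        using l power_mult[of "sqrt (l / 2 ^ j)" 2 2] by simp
      then show "prob {\<omega> \<in> space M. \<bar>W (a + real (Suc k) * l / 2 ^ j) \<omega> - W (a + real k * l / 2 ^ j) \<omega>\<bar> > d j} \<le> 3 * (l / 2 ^ j)\<^sup>2 / d j ^ 4"
        using normal_fourth_moment_tail[OF D _ d, of j] l by simp
    qed
    also have "\<dots> = c j"
    proof -
      have "(((9::real) / 10) ^ j) ^ 4 = (6561 / 10000) ^ j" 
        unfolding power_mult[symmetric] mult.commute[of j 4] by (simp add: power_mult power_divide)
      moreover have "(5000 / 6561 :: real) ^ j = 1 / (2 ^ j * (6561 / 10000) ^ j)"
        by (simp add: power_mult_distrib[symmetric] power_one_over[symmetric] del: power_one_over)
      moreover have "E * (3 * (l / E)\<^sup>2 / (x * A / 10) ^ 4) = 30000 * l\<^sup>2 / x ^ 4 * (1 / (E * A ^ 4))"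
        if "E > 0" "A > 0" for E A :: real
        using that x by (simp add: field_simps power2_eq_square)
      from this[of "2 ^ j" "(9 / 10) ^ j"]
      have "2 ^ j * (3 * (l / 2 ^ j)\<^sup>2 / (x * (9 / 10) ^ j / 10) ^ 4) = 30000 * l\<^sup>2 / x ^ 4 * (1 / (2 ^ j * ((9 / 10) ^ j) ^ 4))"
        by simp
      ultimately show ?thesis unfolding c_def d_def by simp
    qed
    finally show ?thesis .
  qed
  have c_sums: "c sums (30000 * l\<^sup>2 / x ^ 4 * (1 / (1 - 5000 / 6561)))"
    unfolding c_def by (intro sums_mult geometric_sums) simp
  have sA: "summable (\<lambda>j. prob (A j))"
    by (rule summable_comparison_test'[OF sums_summable[OF c_sums], of 0]) (use Ab in auto)
  have "prob {\<omega> \<in> space M. \<not> osc_le a l x \<omega>} \<le> prob (\<Union>j. A j)"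
  proof (rule finite_measure_mono)
    show "{\<omega> \<in> space M. \<not> osc_le a l x \<omega>} \<subseteq> (\<Union>j. A j)"
    proof (rule subsetI, rule ccontr)
      fix \<omega> assume w: "\<omega> \<in> {\<omega> \<in> space M. \<not> osc_le a l x \<omega>}" and n: "\<omega> \<notin> (\<Union>j. A j)"
      have "\<bar>W (a + real (Suc k) * l / 2 ^ j) \<omega> - W (a + real k * l / 2 ^ j) \<omega>\<bar> \<le> d j" if "k < 2 ^ j" for k j
        using n w that unfolding A_def by force
      from chaining_bound[of "\<lambda>t. W t \<omega>", OF this] dsum have "osc_le a l x \<omega>"
        unfolding osc_le_def by (blast intro: order_trans)
      with w show False by simp
    qed
  qed (use Am in auto)
  also have "\<dots> \<le> (\<Sum>j. prob (A j))"
    by (rule finite_measure_subadditive_countably[OF _ sA]) (use Am in auto)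
  also have "\<dots> \<le> (\<Sum>j. c j)"
    by (rule suminf_le[OF Ab sA sums_summable[OF c_sums]])
  also have "\<dots> = 30000 * l\<^sup>2 / x ^ 4 * (1 / (1 - 5000 / 6561))" using c_sums by (simp add: sums_iff)
  also have "\<dots> \<le> 150000 * l\<^sup>2 / x ^ 4" using x by (simp add: field_simps)
  finally show ?thesis .
qed

text \<open>The time \<open>t\<close> is the limit of dyadic points \<open>u J\<close> obtained by
  rounding down, and the bound passes to the limit by continuity of the path.\<close>

lemma osc_le_everywhere:
  assumes cont: "continuous_on {0..} (\<lambda>t. W t \<omega>)" and a: "a \<ge> 0" and o: "osc_le a l x \<omega>"
    and t: "a \<le> t" "t \<le> a + l"
  shows "\<bar>W t \<omega> - W a \<omega>\<bar> \<le> x"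
proof (cases "t = a")
  case True
  then show ?thesis using o[unfolded osc_le_def, rule_format, of 0 0] by simp
next
  case False
  then have l: "l > 0" using t by simp
  define u where "u J = a + real (nat \<lfloor>(t - a) / l * 2 ^ J\<rfloor>) * l / 2 ^ J" for J :: nat
  define v where "v = (t - a) / l"
  have v: "0 \<le> v" "v \<le> 1" using t l by (auto simp: v_def field_simps)
  have "(\<lambda>J. real (nat \<lfloor>v * 2 ^ J\<rfloor>) / 2 ^ J) \<longlonglongrightarrow> v"
  proof (rule real_tendsto_sandwich)
    show "\<forall>\<^sub>F J in sequentially. v - (1 / 2) ^ J \<le> real (nat \<lfloor>v * 2 ^ J\<rfloor>) / 2 ^ J"
    proof (rule always_eventually, rule allI)
      fix J
      have "v * 2 ^ J - 1 \<le> real (nat \<lfloor>v * 2 ^ J\<rfloor>)" by linarith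
      then have "(v * 2 ^ J - 1) / 2 ^ J \<le> real (nat \<lfloor>v * 2 ^ J\<rfloor>) / 2 ^ J" by (intro divide_right_mono) auto
      then show "v - (1 / 2) ^ J \<le> real (nat \<lfloor>v * 2 ^ J\<rfloor>) / 2 ^ J" by (simp add: diff_divide_distrib power_one_over)
    qed
    show "\<forall>\<^sub>F J in sequentially. real (nat \<lfloor>v * 2 ^ J\<rfloor>) / 2 ^ J \<le> v"
    proof (rule always_eventually, rule allI)
      fix J
      have "0 \<le> v * 2 ^ J" using v by simp
      then have "real (nat \<lfloor>v * 2 ^ J\<rfloor>) \<le> v * 2 ^ J" by linarith
      then show "real (nat \<lfloor>v * 2 ^ J\<rfloor>) / 2 ^ J \<le> v" by (simp add: divide_le_eq)
    qed
    have "(\<lambda>J. v - (1 / 2) ^ J) \<longlonglongrightarrow> v - 0" by (intro tendsto_intros LIMSEQ_power_zero) simp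
    then show "(\<lambda>J. v - (1 / 2) ^ J) \<longlonglongrightarrow> v" by simp
  qed simp
  then have "(\<lambda>J. a + real (nat \<lfloor>v * 2 ^ J\<rfloor>) / 2 ^ J * l) \<longlonglongrightarrow> a + v * l" by (intro tendsto_intros)
  moreover have "u = (\<lambda>J. a + real (nat \<lfloor>v * 2 ^ J\<rfloor>) / 2 ^ J * l)"
    by (simp add: u_def v_def fun_eq_iff)
  moreover have "a + v * l = t" using l by (simp add: v_def)
  ultimately have u: "u \<longlonglongrightarrow> t" by simp
  have u0: "u J \<in> {0..}" for J using a l by (simp add: u_def)
  have "(\<lambda>J. W (u J) \<omega>) \<longlonglongrightarrow> W t \<omega>"
    by (rule continuous_on_tendsto_compose[OF cont u]) (use u0 t a in auto)
  then have "(\<lambda>J. \<bar>W (u J) \<omega> - W a \<omega>\<bar>) \<longlonglongrightarrow> \<bar>W t \<omega> - W a \<omega>\<bar>" by (intro tendsto_intros)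
  moreover have "\<bar>W (u J) \<omega> - W a \<omega>\<bar> \<le> x" for J
    unfolding u_def
  proof (rule o[unfolded osc_le_def, rule_format])
    have "v * 2 ^ J \<le> 1 * 2 ^ J" using v by (intro mult_right_mono) auto
    then have "\<lfloor>v * 2 ^ J\<rfloor> \<le> 2 ^ J" by (metis floor_le_iff floor_mono floor_of_int mult_1 of_int_numeral of_int_power)
    then show "nat \<lfloor>(t - a) / l * 2 ^ J\<rfloor> \<le> 2 ^ J" by (simp add: v_def nat_le_iff)
  qed
  ultimately show ?thesis by (intro LIMSEQ_le_const2) auto
qed

end

context prob_space begin

lemma normal_interval_pos:
  assumes D: "distributed M lborel X (normal_density 0 \<sigma>)" and \<sigma>: "\<sigma> > 0" and ab: "a < b"
  shows "prob {\<omega> \<in> space M. X \<omega> \<in> {a..b}} > 0"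
proof -
  have [measurable]: "X \<in> borel_measurable M"
    using distributed_measurable[OF D] by simp
  have "emeasure M (X -` {a..b} \<inter> space M) = (\<integral>\<^sup>+y. ennreal (normal_density 0 \<sigma> y) * indicator {a..b} y \<partial>lborel)"
    by (rule distributed_emeasure[OF D]) simp
  moreover have "(\<integral>\<^sup>+y. ennreal (normal_density 0 \<sigma> y) * indicator {a..b} y \<partial>lborel) \<noteq> 0"
  proof
    assume "(\<integral>\<^sup>+y. ennreal (normal_density 0 \<sigma> y) * indicator {a..b} y \<partial>lborel) = 0"
    then have "AE y in lborel. ennreal (normal_density 0 \<sigma> y) * indicator {a..b} y = 0"
      by (subst (asm) nn_integral_0_iff_AE) auto
    then have "AE y in lborel. y \<notin> {a..b}"
    proof eventually_elim
      case (elim y)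
      then show ?case using normal_density_pos[OF \<sigma>, of 0 y] by (auto simp: indicator_def split: if_splits)
    qed
    then have "emeasure lborel {a..b} = 0" by (subst (asm) AE_iff_measurable[of "{a..b}"]) auto
    then show False using ab by simp
  qed
  moreover have "X -` {a..b} \<inter> space M = {\<omega> \<in> space M. X \<omega> \<in> {a..b}}" by auto
  ultimately have "ennreal (prob {\<omega> \<in> space M. X \<omega> \<in> {a..b}}) \<noteq> 0" by (metis emeasure_eq_measure)
  then show ?thesis by (auto simp: zero_less_measure_iff)
qed

lemma prob_conj_ge:
  assumes [measurable]: "Measurable.pred M P" "Measurable.pred M Q"
    and "a \<le> prob {\<omega> \<in> space M. Q \<omega>}" "prob {\<omega> \<in> space M. \<not> P \<omega>} \<le> b"
  shows "a - b \<le> prob {\<omega> \<in> space M. P \<omega> \<and> Q \<omega>}"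
proof -
  have "prob {\<omega> \<in> space M. Q \<omega>} \<le> prob ({\<omega> \<in> space M. P \<omega> \<and> Q \<omega>} \<union> {\<omega> \<in> space M. \<not> P \<omega>})"
    by (intro finite_measure_mono) auto
  also have "\<dots> \<le> prob {\<omega> \<in> space M. P \<omega> \<and> Q \<omega>} + prob {\<omega> \<in> space M. \<not> P \<omega>}"
    by (intro measure_Un_le) auto
  finally show ?thesis using assms by linarith
qed

end

section \<open>Lower bounds for the probability of staying in a region\<close>

context brownian_motion begin

text \<open>At a fixed dyadic level \<open>J\<close> this is \<open>markov_blocks\<close> for
  finitely many increments. The bound does not depend on \<open>J\<close>, and the events of level
  \<open>J\<close> decrease to the one with full oscillation control.\<close>

lemma block_lower:
  fixes s :: "nat \<Rightarrow> real"
  assumes s0: "0 \<le> s 0" and s: "\<And>i. s i < s (Suc i)"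
    and I0: "I0 \<in> sets borel" and Bs: "\<And>i b. B i b \<in> sets borel" and p0: "0 \<le> p"
    and p: "\<And>i b. i < n \<Longrightarrow> p \<le> prob {\<omega> \<in> space M. osc_le (s i) (s (Suc i) - s i) (y i) \<omega> \<and> W (s (Suc i)) \<omega> - W (s i) \<omega> \<in> B i b}"
  shows "prob {\<omega> \<in> space M. W (s 0) \<omega> - W 0 \<omega> \<in> I0} * p ^ n \<le> prob {\<omega> \<in> space M. W (s 0) \<omega> - W 0 \<omega> \<in> I0 \<and>
    (\<forall>i<n. osc_le (s i) (s (Suc i) - s i) (y i) \<omega> \<and> W (s (Suc i)) \<omega> - W (s i) \<omega> \<in> B i (W (s i) \<omega> - W 0 \<omega> \<ge> 0))}"
proof -
  have s_nonneg: "0 \<le> s i" for i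
    by (induction i) (use s0 s in \<open>auto intro: order_trans less_imp_le\<close>)
  define C where "C J i \<omega> b \<longleftrightarrow> (\<forall>k\<le>2 ^ J. \<bar>W (s i + real k * (s (Suc i) - s i) / 2 ^ J) \<omega> - W (s i) \<omega>\<bar> \<le> y i) \<and>
     W (s (Suc i)) \<omega> - W (s i) \<omega> \<in> B i b" for J :: nat and i \<omega> b
  have mW[measurable]: "W (s i + real k * (s (Suc i) - s i) / 2 ^ J) \<in> borel_measurable M" "W (s i) \<in> borel_measurable M" "W 0 \<in> borel_measurable M" for i k J
  proof -
    have "0 \<le> s i + real k * (s (Suc i) - s i) / 2 ^ J" using s_nonneg[of i] s[of i] by simp
    then show "W (s i + real k * (s (Suc i) - s i) / 2 ^ J) \<in> borel_measurable M" "W (s i) \<in> borel_measurable M" "W 0 \<in> borel_measurable M"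
      using s_nonneg[of i] by (auto intro!: W_measurable)
  qed
  note [measurable] = I0 Bs
  have mC[measurable]: "Measurable.pred M (\<lambda>\<omega>. C J i \<omega> b)" for J i b
    unfolding C_def by measurable
  define E where "E J = {\<omega> \<in> space M. W (s 0) \<omega> - W 0 \<omega> \<in> I0 \<and> (\<forall>i<n. C J i \<omega> (W (s i) \<omega> - W 0 \<omega> \<ge> 0))}" for J
  have mE: "E J \<in> events" for J
  proof -
    have eq: "C J i \<omega> (x \<ge> 0) \<longleftrightarrow> (x \<ge> 0 \<and> C J i \<omega> True) \<or> (x < 0 \<and> C J i \<omega> False)" for i \<omega> and x :: real
      by (cases "x \<ge> 0") auto
    show ?thesis unfolding E_def eq by measurable
  qed
  have level: "prob {\<omega> \<in> space M. W (s 0) \<omega> - W 0 \<omega> \<in> I0} * p ^ n \<le> prob (E J)" for J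
  proof -
    define m where "m = (2::nat) ^ J"
    have m: "m > 0" by (simp add: m_def)
    \<comment> \<open>After the initial time 0, these are the level-\<open>J\<close> points of all
      blocks in order. The last point of a block is the first of the next one, so the formula for
      index \<open>Suc (i * m + k)\<close> also holds for \<open>k = m\<close>.\<close>
    define \<tau> where "\<tau> l = (case l of 0 \<Rightarrow> 0 | Suc l \<Rightarrow> s (l div m) + real (l mod m) * (s (Suc (l div m)) - s (l div m)) / real m)" for l
    have \<tau>_0: "\<tau> 0 = 0" by (simp add: \<tau>_def)
    have \<tau>: "\<tau> (Suc (i * m + k)) = s i + real k * (s (Suc i) - s i) / real m" if "k \<le> m" for i k
    proof (cases "k = m")
      case True
      then have "i * m + k = Suc i * m" by simp
      then show ?thesis using True m by (simp add: \<tau>_def)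
    next
      case False
      then have "k < m" using that by simp
      then show ?thesis using m by (simp add: \<tau>_def)
    qed
    have \<tau>_mono: "\<tau> l \<le> \<tau> (Suc l)" for l
    proof (cases l)
      case 0
      then show ?thesis using s0 by (simp add: \<tau>_def)
    next
      case (Suc l')
      define i k where "i = l' div m" and "k = l' mod m"
      have l': "l' = i * m + k" "k < m" using m by (auto simp: i_def k_def)
      have "\<tau> (Suc (i * m + k)) \<le> \<tau> (Suc (i * m + Suc k))"
        using l'(2) s[of i] m by (subst (1 2) \<tau>) (auto intro!: divide_right_mono mult_right_mono)
      then show ?thesis unfolding Suc l' by simp
    qed
    define \<xi> where "\<xi> l \<omega> = W (\<tau> (Suc l)) \<omega> - W (\<tau> l) \<omega>" for l \<omega>
    have ind: "indep_vars (\<lambda>_. borel) \<xi> {..<Suc (n * m)}"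
      unfolding \<xi>_def by (rule W_indep) (auto simp: \<tau>_0 \<tau>_mono)
    have D: "(\<Sum>l=Suc (i * m)..<Suc (i * m + k). \<xi> l \<omega>) = W (s i + real k * (s (Suc i) - s i) / 2 ^ J) \<omega> - W (s i) \<omega>"
      if "k \<le> m" for i k \<omega>
      using sum_Suc_diff'[of "Suc (i * m)" "Suc (i * m + k)" "\<lambda>l. W (\<tau> l) \<omega>"] \<tau>[OF that, of i] \<tau>[of 0 i]
      by (simp add: \<xi>_def m_def)
    have Dm: "(\<Sum>l=Suc (i * m)..<Suc (i * m + m). \<xi> l \<omega>) = W (s (Suc i)) \<omega> - W (s i) \<omega>" for i \<omega>
      using D[of m \<omega> i] by (simp add: m_def)
    have H: "(\<Sum>l<Suc (i * m). \<xi> l \<omega>) = W (s i) \<omega> - W 0 \<omega>" for i \<omega>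
      using sum_lessThan_telescope[of "\<lambda>l. W (\<tau> l) \<omega>" "Suc (i * m)"] \<tau>[of 0 i] \<tau>_0
      unfolding \<xi>_def by simp
    have \<xi>0: "\<xi> 0 \<omega> = W (s 0) \<omega> - W 0 \<omega>" for \<omega> using H[of \<omega> 0] by simp
    have C: "C J i \<omega> b \<longleftrightarrow> (\<forall>k\<le>m. \<bar>\<Sum>l=Suc (i * m)..<Suc (i * m + k). \<xi> l \<omega>\<bar> \<le> y i) \<and> (\<Sum>l=Suc (i * m)..<Suc (i * m + m). \<xi> l \<omega>) \<in> B i b" for i \<omega> b
      unfolding C_def Dm using D by (simp add: m_def)
    have pJ: "p \<le> prob {\<omega> \<in> space M. C J i \<omega> b}" if "i < n" for i b
    proof -
      note p[OF that, of b]
      also have "prob {\<omega> \<in> space M. osc_le (s i) (s (Suc i) - s i) (y i) \<omega> \<and> W (s (Suc i)) \<omega> - W (s i) \<omega> \<in> B i b} \<le> prob {\<omega> \<in> space M. C J i \<omega> b}"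
        by (rule finite_measure_mono) (auto simp: C_def osc_le_def)
      finally show ?thesis .
    qed
    have "prob {\<omega> \<in> space M. \<xi> 0 \<omega> \<in> I0} * p ^ n \<le> prob {\<omega> \<in> space M. \<xi> 0 \<omega> \<in> I0 \<and>
     (\<forall>i<n. (\<forall>k\<le>m. \<bar>\<Sum>l=Suc (i * m)..<Suc (i * m + k). \<xi> l \<omega>\<bar> \<le> y i) \<and> (\<Sum>l=Suc (i * m)..<Suc (i * m + m). \<xi> l \<omega>) \<in> B i ((\<Sum>l<Suc (i * m). \<xi> l \<omega>) \<ge> 0))}"
      by (rule markov_blocks[OF ind I0 Bs _ p0]) (use pJ in \<open>simp add: C\<close>)
    then show ?thesis unfolding E_def C \<xi>0 H by simp
  qed
  have dec: "decseq E"
  proof (rule decseq_SucI)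
    fix J
    have "C J i \<omega> b" if c: "C (Suc J) i \<omega> b" for i \<omega> b
      unfolding C_def
    proof (intro conjI allI impI)
      fix k :: nat assume "k \<le> 2 ^ J"
      then have "2 * k \<le> 2 ^ Suc J" by simp
      with c have "\<bar>W (s i + real (2 * k) * (s (Suc i) - s i) / 2 ^ Suc J) \<omega> - W (s i) \<omega>\<bar> \<le> y i"
        unfolding C_def by blast
      then show "\<bar>W (s i + real k * (s (Suc i) - s i) / 2 ^ J) \<omega> - W (s i) \<omega>\<bar> \<le> y i" by simp
    qed (use c in \<open>simp add: C_def\<close>)
    then show "E (Suc J) \<subseteq> E J" unfolding E_def by blast
  qed
  have "(\<lambda>J. prob (E J)) \<longlonglongrightarrow> prob (\<Inter>J. E J)"
    by (rule finite_Lim_measure_decseq) (use mE dec in auto)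
  then have "prob {\<omega> \<in> space M. W (s 0) \<omega> - W 0 \<omega> \<in> I0} * p ^ n \<le> prob (\<Inter>J. E J)"
    using level by (intro LIMSEQ_le_const) auto
  also have "(\<Inter>J. E J) = {\<omega> \<in> space M. W (s 0) \<omega> - W 0 \<omega> \<in> I0 \<and>
    (\<forall>i<n. osc_le (s i) (s (Suc i) - s i) (y i) \<omega> \<and> W (s (Suc i)) \<omega> - W (s i) \<omega> \<in> B i (W (s i) \<omega> - W 0 \<omega> \<ge> 0))}"
    unfolding E_def C_def osc_le_def by auto
  finally show ?thesis .
qed

text \<open>Only rational times occur, so that the event is measurable.\<close>

definition stays :: "real \<Rightarrow> real set \<Rightarrow> 'a \<Rightarrow> bool" where
  "stays T S \<omega> \<longleftrightarrow> (\<forall>t\<in>\<rat> \<inter> {0..T}. exp (- t / 2) * W (exp t) \<omega> \<in> S)"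

lemma stays_measurable [measurable]:
  assumes [measurable]: "S \<in> sets borel" shows "Measurable.pred M (stays T S)"
proof -
  have [measurable]: "W (exp t) \<in> borel_measurable M" for t by (rule W_measurable) simp
  have "stays T S = (\<lambda>\<omega>. \<forall>r. of_rat r \<in> {0..T} \<longrightarrow> exp (- of_rat r / 2) * W (exp (of_rat r)) \<omega> \<in> S)"
    by (auto simp: stays_def fun_eq_iff Rats_def)
  also have "Measurable.pred M \<dots>" by measurable
  finally show ?thesis .
qed

text \<open>The grid \<open>s i = g ^ i\<close> in the Brownian time is a grid of mesh \<open>ln g\<close> for the
  Ornstein-Uhlenbeck process.\<close>

lemma geometric_stays:
  fixes g :: real
  assumes g: "g > 1" and T: "T \<le> real n * ln g" "0 < n"
    and I0: "I0 \<in> sets borel" and Bs: "\<And>i b. B i b \<in> sets borel" and p0: "0 \<le> p" and S: "S \<in> sets borel"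
    and p: "\<And>i b. p \<le> prob {\<omega> \<in> space M. osc_le (g ^ i) (g ^ Suc i - g ^ i) (y i) \<omega> \<and> W (g ^ Suc i) \<omega> - W (g ^ i) \<omega> \<in> B i b}"
    and init: "\<And>x. x \<in> I0 \<Longrightarrow> P 0 x"
    and step: "\<And>i x d. P i x \<Longrightarrow> \<bar>d\<bar> \<le> y i \<Longrightarrow> d \<in> B i (x \<ge> 0) \<Longrightarrow> P (Suc i) (x + d)"
    and stay: "\<And>i x d u. P i x \<Longrightarrow> \<bar>d\<bar> \<le> y i \<Longrightarrow> g ^ i \<le> u \<Longrightarrow> u \<le> g ^ Suc i \<Longrightarrow> (x + d) / sqrt u \<in> S"
  shows "prob {\<omega> \<in> space M. W 1 \<omega> - W 0 \<omega> \<in> I0} * p ^ n \<le> prob {\<omega> \<in> space M. stays T S \<omega>}"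
proof -
  let ?E = "{\<omega> \<in> space M. W (g ^ 0) \<omega> - W 0 \<omega> \<in> I0 \<and>
    (\<forall>i<n. osc_le (g ^ i) (g ^ Suc i - g ^ i) (y i) \<omega> \<and> W (g ^ Suc i) \<omega> - W (g ^ i) \<omega> \<in> B i (W (g ^ i) \<omega> - W 0 \<omega> \<ge> 0))}"
  have "prob {\<omega> \<in> space M. W (g ^ 0) \<omega> - W 0 \<omega> \<in> I0} * p ^ n \<le> prob ?E"
    by (rule block_lower) (use g I0 Bs p0 p in auto)
  also have "\<dots> \<le> prob {\<omega> \<in> space M. stays T S \<omega>}"
  proof (rule finite_measure_mono_AE)
    show "{\<omega> \<in> space M. stays T S \<omega>} \<in> events" using stays_measurable[OF S, of T] by (simp add: pred_def)
    show "AE \<omega> in M. \<omega> \<in> ?E \<longrightarrow> \<omega> \<in> {\<omega> \<in> space M. stays T S \<omega>}"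
      using W_0 W_continuous
    proof eventually_elim
      case (elim \<omega>)
      show ?case
      proof
        assume \<omega>: "\<omega> \<in> ?E"
        have osc: "\<bar>W u \<omega> - W (g ^ i) \<omega>\<bar> \<le> y i" if "i < n" "g ^ i \<le> u" "u \<le> g ^ Suc i" for u i
          by (rule osc_le_everywhere[OF elim(2), of "g ^ i" "g ^ Suc i - g ^ i"]) (use \<omega> that g in auto)
        \<comment> \<open>\<open>P\<close> is an invariant of the position at grid times. Since
          \<open>W 0 = 0\<close> almost surely, the sign available to \<open>B\<close>, that of the
          increment from time 0, is the sign of the position.\<close>
        have P: "P i (W (g ^ i) \<omega>)" if "i \<le> n" for i
          using that
        proof (induction i)
          case 0
          then show ?case using \<omega> elim init by auto
        next
          case (Suc i)
          have "P (Suc i) (W (g ^ i) \<omega> + (W (g ^ Suc i) \<omega> - W (g ^ i) \<omega>))"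
          proof (rule step)
            show "P i (W (g ^ i) \<omega>)" using Suc by simp
            show "\<bar>W (g ^ Suc i) \<omega> - W (g ^ i) \<omega>\<bar> \<le> y i"
              by (rule osc) (use Suc.prems g in auto)
            show "W (g ^ Suc i) \<omega> - W (g ^ i) \<omega> \<in> B i (W (g ^ i) \<omega> \<ge> 0)"
              using \<omega> elim(1) Suc.prems by auto
          qed
          then show ?case by simp
        qed
        have grid: "\<exists>i<k. g ^ i \<le> u \<and> u \<le> g ^ Suc i" if "1 \<le> u" "u \<le> g ^ k" "0 < k" for u k
          using that
        proof (induction k)
          case (Suc k)
          show ?case
          proof (cases "u \<le> g ^ k \<and> 0 < k")
            case True
            then show ?thesis using Suc by (auto simp: less_Suc_eq)
          next
            case False
            then show ?thesis using Suc.prems by (intro exI[of _ k]) auto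
          qed
        qed simp
        have "stays T S \<omega>" unfolding stays_def
        proof
          fix t assume "t \<in> \<rat> \<inter> {0..T}"
          then have t: "0 \<le> t" "t \<le> real n * ln g" using T by auto
          have "exp t \<le> exp (real n * ln g)" using t by simp
          also have "\<dots> = g ^ n" using g by (simp add: exp_of_nat_mult)
          finally obtain i where i: "i < n" "g ^ i \<le> exp t" "exp t \<le> g ^ Suc i"
            using grid[of "exp t" n] t T by auto
          have "(W (g ^ i) \<omega> + (W (exp t) \<omega> - W (g ^ i) \<omega>)) / sqrt (exp t) \<in> S"
            by (rule stay[OF P osc]) (use i in auto)
          moreover have "sqrt (exp t) = exp (t / 2)" by (simp add: real_sqrt_unique exp_double[symmetric])
          ultimately show "exp (- t / 2) * W (exp t) \<omega> \<in> S"
            by (simp add: exp_minus field_simps)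
        qed
        then show "\<omega> \<in> {\<omega> \<in> space M. stays T S \<omega>}" using \<omega> by simp
      qed
    qed
  qed
  finally show ?thesis by simp
qed

end

lemma normal_density_le_1: "normal_density 0 1 x \<le> 1"
proof -
  have "1 / sqrt (2 * pi) \<le> 1" using pi_ge_two by (simp add: real_le_rsqrt divide_le_eq)
  then have "normal_density 0 1 x \<le> 1 * 1" unfolding normal_density_def by (intro mult_mono) auto
  then show ?thesis by simp
qed

text \<open>By \<open>normal_upper_tail\<close>, \<open>1000 * tail_const\<close> bounds from below
  the probability that a normal variable exceeds its standard deviation. The divisor makes the
  failure probability of the oscillation bound in \<open>stays_large\<close> at most half of
  that.\<close>

definition tail_const :: real where "tail_const = normal_density 0 1 2 / 1000"

lemma tail_const: "0 < tail_const" "tail_const \<le> 1 / 1000"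
  using normal_density_le_1[of 2] by (simp_all add: tail_const_def normal_density_pos)

context brownian_motion begin

text \<open>Brownian scaling: an oscillation bound proportional to \<open>sqrt (g ^ i)\<close> on a
  block of length \<open>(g - 1) * g ^ i\<close> fails with a probability that is bounded
  independently of \<open>i\<close>.\<close>

lemma osc_increment_bound:
  fixes g :: real
  assumes g: "g > 1" and y: "y > 0" and q: "q \<le> prob {\<omega> \<in> space M. W (g ^ Suc i) \<omega> - W (g ^ i) \<omega> \<in> B}"
    and B: "B \<in> sets borel"
  shows "q - 150000 * (g - 1)\<^sup>2 / y ^ 4 \<le> prob {\<omega> \<in> space M. osc_le (g ^ i) (g ^ Suc i - g ^ i) (y * sqrt (g ^ i)) \<omega> \<and>
    W (g ^ Suc i) \<omega> - W (g ^ i) \<omega> \<in> B}"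
proof (rule prob_conj_ge[OF _ _ q])
  have gi: "g ^ i > 0" "g ^ Suc i - g ^ i = g ^ i * (g - 1)" using g by (auto simp: algebra_simps)
  have [measurable]: "W (g ^ i) \<in> borel_measurable M" "W (g ^ Suc i) \<in> borel_measurable M" using g by (auto intro!: W_measurable)
  show "Measurable.pred M (osc_le (g ^ i) (g ^ Suc i - g ^ i) (y * sqrt (g ^ i)))"
    using gi g by (intro osc_le_measurable) auto
  note [measurable] = B
  show "Measurable.pred M (\<lambda>\<omega>. W (g ^ Suc i) \<omega> - W (g ^ i) \<omega> \<in> B)" by measurable
  have "prob {\<omega> \<in> space M. \<not> osc_le (g ^ i) (g ^ Suc i - g ^ i) (y * sqrt (g ^ i)) \<omega>} \<le>
     150000 * (g ^ Suc i - g ^ i)\<^sup>2 / (y * sqrt (g ^ i)) ^ 4"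
    using gi g y by (intro osc_le_bound) auto
  also have "(y * sqrt (g ^ i)) ^ 4 = y ^ 4 * (g ^ i)\<^sup>2"
    using gi power_mult[of "sqrt (g ^ i)" 2 2] by (simp add: power_mult_distrib)
  also have "150000 * (g ^ Suc i - g ^ i)\<^sup>2 / (y ^ 4 * (g ^ i)\<^sup>2) = 150000 * (g - 1)\<^sup>2 / y ^ 4"
    using gi g y by (simp add: power_mult_distrib)
  finally show "prob {\<omega> \<in> space M. \<not> osc_le (g ^ i) (g ^ Suc i - g ^ i) (y * sqrt (g ^ i)) \<omega>} \<le> 150000 * (g - 1)\<^sup>2 / y ^ 4" .
qed

lemma geometric_increment:
  fixes g :: real
  assumes "g > 1"
  shows "distributed M lborel (\<lambda>\<omega>. W (g ^ Suc i) \<omega> - W (g ^ i) \<omega>) (normal_density 0 (sqrt (g - 1) * sqrt (g ^ i)))"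
proof -
  have "g ^ Suc i - g ^ i = (g - 1) * g ^ i" by (simp add: algebra_simps)
  then have "sqrt (g ^ Suc i - g ^ i) = sqrt (g - 1) * sqrt (g ^ i)" by (simp only: real_sqrt_mult)
  then show ?thesis using W_increment[of "g ^ i" "g ^ Suc i"] assms by simp
qed

text \<open>Rounding \<open>T / h\<close> up to a positive number of blocks costs at most two
  further factors \<open>p\<close>, which go into the constant.\<close>

lemma exponential_rate:
  assumes h: "h > 0" and p: "0 < p" "p \<le> 1" and c0: "c0 > 0"
    and b: "\<And>T n. 0 \<le> T \<Longrightarrow> 0 < n \<Longrightarrow> T \<le> real n * h \<Longrightarrow> c0 * p ^ n \<le> f T"
  shows "\<exists>c>0. \<forall>T\<ge>0. c * exp (- (ln (1 / p) / h) * T) \<le> f T"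
proof (intro exI[of _ "c0 * p\<^sup>2"] conjI allI impI)
  fix T :: real assume T: "0 \<le> T"
  define n where "n = nat \<lceil>T / h\<rceil> + 1"
  have "0 \<le> T / h" using T h by simp
  then have n: "T / h \<le> real n" "real n \<le> T / h + 2" unfolding n_def by linarith+
  have "exp (- (ln (1 / p) / h) * T) * p\<^sup>2 = exp ((T / h + 2) * ln p)"
  proof -
    have "exp ((T / h + 2) * ln p) = exp (T / h * ln p) * exp (2 * ln p)" by (simp add: distrib_right exp_add)
    also have "exp (2 * ln p) = p\<^sup>2" using exp_of_nat_mult[of 2 "ln p"] p by simp
    also have "T / h * ln p = - (ln (1 / p) / h) * T" using p by (simp add: ln_div)
    finally show ?thesis by simp
  qed
  also have "\<dots> \<le> exp (real n * ln p)"
    using n(2) p by (auto intro!: mult_right_mono_neg)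
  also have "\<dots> = p ^ n" using p by (simp add: exp_of_nat_mult)
  finally have "c0 * p\<^sup>2 * exp (- (ln (1 / p) / h) * T) \<le> c0 * p ^ n" using c0 by (simp add: mult_ac)
  also have "\<dots> \<le> f T" using n(1) h by (intro b T) (auto simp: n_def field_simps)
  finally show "c0 * p\<^sup>2 * exp (- (ln (1 / p) / h) * T) \<le> f T" .
qed (use p c0 in auto)

text \<open>An increment that points towards the origin and is at most
  \<open>\<delta> * sqrt (g ^ i)\<close> in size cannot leave the window of the grid points. The
  direction has probability 1/2, and the oscillation bound fails with probability at most
  \<open>150000 / 800\<^sup>2 < 1 / 4\<close>, leaving 1/4 per block.\<close>

lemma stays_small:
  assumes \<delta>: "\<delta> > 0"
  shows "\<exists>c>0. \<forall>T\<ge>0. c * exp (- (ln 4 / ln (1 + \<delta>\<^sup>2 / 800)) * T) \<le> prob {\<omega> \<in> space M. stays T {- (2 * \<delta>)..2 * \<delta>} \<omega>}"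
proof -
  define g where "g = 1 + \<delta>\<^sup>2 / 800"
  have g: "g > 1" using \<delta> by (simp add: g_def)
  define c0 where "c0 = prob {\<omega> \<in> space M. W 1 \<omega> - W 0 \<omega> \<in> {- \<delta>..\<delta>}}"
  have c0: "c0 > 0" unfolding c0_def
    by (rule normal_interval_pos[OF W_increment]) (use \<delta> in auto)
  have "\<exists>c>0. \<forall>T\<ge>0. c * exp (- (ln (1 / (1 / 4)) / ln g) * T) \<le> prob {\<omega> \<in> space M. stays T {- (2 * \<delta>)..2 * \<delta>} \<omega>}"
  proof (rule exponential_rate[OF _ _ _ c0])
    fix T :: real and n :: nat assume T: "0 \<le> T" "0 < n" "T \<le> real n * ln g"
    show "c0 * (1 / 4) ^ n \<le> prob {\<omega> \<in> space M. stays T {- (2 * \<delta>)..2 * \<delta>} \<omega>}"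
      unfolding c0_def
    proof (rule geometric_stays[OF g T(3,2), where y = "\<lambda>i. \<delta> * sqrt (g ^ i)" and B = "\<lambda>i b. if b then {..0} else {0..}"
        and P = "\<lambda>i x. \<bar>x\<bar> \<le> \<delta> * sqrt (g ^ i)"])
      fix i b
      note D = geometric_increment[OF g, of i]
      have "sqrt (g - 1) * sqrt (g ^ i) > 0" using g by simp
      note half = normal_half[OF D this]
      have "1 / 2 - 150000 * (g - 1)\<^sup>2 / \<delta> ^ 4 \<le> prob {\<omega> \<in> space M. osc_le (g ^ i) (g ^ Suc i - g ^ i) (\<delta> * sqrt (g ^ i)) \<omega> \<and>
          W (g ^ Suc i) \<omega> - W (g ^ i) \<omega> \<in> (if b then {..0} else {0..})}"
        by (rule osc_increment_bound[OF g \<delta>]) (use half in auto)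
      moreover have "150000 * (g - 1)\<^sup>2 / \<delta> ^ 4 \<le> 1 / 4"
        using \<delta> by (simp add: g_def field_simps power2_eq_square power4_eq_xxxx)
      ultimately show "1 / 4 \<le> prob {\<omega> \<in> space M. osc_le (g ^ i) (g ^ Suc i - g ^ i) (\<delta> * sqrt (g ^ i)) \<omega> \<and>
          W (g ^ Suc i) \<omega> - W (g ^ i) \<omega> \<in> (if b then {..0} else {0..})}" by linarith
    next
      fix i :: nat and x d :: real
      assume "\<bar>x\<bar> \<le> \<delta> * sqrt (g ^ i)" "\<bar>d\<bar> \<le> \<delta> * sqrt (g ^ i)" "d \<in> (if 0 \<le> x then {..0} else {0..})"
      then have "\<bar>x + d\<bar> \<le> \<delta> * sqrt (g ^ i)" by (auto split: if_splits)
      also have "\<dots> \<le> \<delta> * sqrt (g ^ Suc i)" using g \<delta> by (intro mult_left_mono real_sqrt_le_mono power_increasing) auto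
      finally show "\<bar>x + d\<bar> \<le> \<delta> * sqrt (g ^ Suc i)" .
    next
      fix i :: nat and x d u :: real
      assume a: "\<bar>x\<bar> \<le> \<delta> * sqrt (g ^ i)" "\<bar>d\<bar> \<le> \<delta> * sqrt (g ^ i)" "g ^ i \<le> u"
      have u: "u > 0" using a(3) g by (meson less_le_trans zero_less_one zero_less_power less_trans)
      have "\<bar>x + d\<bar> \<le> 2 * \<delta> * sqrt (g ^ i)" using a by auto
      also have "\<dots> \<le> 2 * \<delta> * sqrt u" using a \<delta> by (intro mult_left_mono) auto
      finally have "- (2 * \<delta>) * sqrt u \<le> x + d" "x + d \<le> 2 * \<delta> * sqrt u" by (auto simp: abs_le_iff)
      then show "(x + d) / sqrt u \<in> {- (2 * \<delta>)..2 * \<delta>}" using u by (simp add: le_divide_eq divide_le_eq)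
    qed (auto)
  qed (use g in auto)
  then show ?thesis by (simp add: g_def)
qed

text \<open>The position at grid times is kept above \<open>3 * K * sqrt (g ^ i)\<close>, so an
  oscillation by a third of this still leaves room. The choice of \<open>g\<close> makes the
  required growth per block at most one standard deviation of the increment.\<close>

lemma stays_large:
  assumes K: "K \<ge> 1"
  shows "\<exists>c>0. \<forall>T\<ge>0. c * exp (- (ln (1 / (500 * tail_const)) / ln (1 + tail_const / K\<^sup>2)) * T) \<le> prob {\<omega> \<in> space M. stays T {K..} \<omega>}"
proof -
  define g where "g = 1 + tail_const / K\<^sup>2"
  have g: "g > 1" using K tail_const by (simp add: g_def)
  have gK: "g - 1 = tail_const / K\<^sup>2" by (simp add: g_def)
  have "tail_const / K\<^sup>2 \<le> tail_const / 1" using K tail_const by (intro divide_left_mono) auto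
  then have g2: "g \<le> 2" using tail_const by (simp add: g_def)
  define c0 where "c0 = prob {\<omega> \<in> space M. W 1 \<omega> - W 0 \<omega> \<in> {3 * K..}}"
  have c0: "c0 > 0"
  proof -
    have D: "distributed M lborel (\<lambda>\<omega>. W 1 \<omega> - W 0 \<omega>) (normal_density 0 1)"
      using W_increment[of 0 1] by simp
    have [measurable]: "W 1 \<in> borel_measurable M" "W 0 \<in> borel_measurable M" by auto
    have "0 < prob {\<omega> \<in> space M. W 1 \<omega> - W 0 \<omega> \<in> {3 * K..3 * K + 1}}"
      by (rule normal_interval_pos[OF D]) auto
    also have "\<dots> \<le> c0" unfolding c0_def by (rule finite_measure_mono) auto
    finally show ?thesis .
  qed
  have "\<exists>c>0. \<forall>T\<ge>0. c * exp (- (ln (1 / (500 * tail_const)) / ln g) * T) \<le> prob {\<omega> \<in> space M. stays T {K..} \<omega>}"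
  proof (rule exponential_rate[OF _ _ _ c0])
    fix T :: real and n :: nat assume T: "0 \<le> T" "0 < n" "T \<le> real n * ln g"
    show "c0 * (500 * tail_const) ^ n \<le> prob {\<omega> \<in> space M. stays T {K..} \<omega>}"
      unfolding c0_def
    proof (rule geometric_stays[OF g T(3,2), where y = "\<lambda>i. K * sqrt (g ^ i)" and B = "\<lambda>i b. {3 * K * (sqrt (g ^ Suc i) - sqrt (g ^ i))..}"
        and P = "\<lambda>i x. x \<ge> 3 * K * sqrt (g ^ i)"])
      fix i b
      note D = geometric_increment[OF g, of i]
      have \<sigma>: "sqrt (g - 1) * sqrt (g ^ i) > 0" using g by simp
      have [measurable]: "W (g ^ i) \<in> borel_measurable M" "W (g * g ^ i) \<in> borel_measurable M" using g by (auto intro!: W_measurable)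
      \<comment> \<open>Use \<open>sqrt g - 1 <= (g - 1) / 2\<close> and
        \<open>K * sqrt (g - 1) = sqrt tail_const\<close>; the remaining factor
        \<open>3 / 2 * sqrt tail_const\<close> is below 1.\<close>
      have le: "3 * K * (sqrt (g ^ Suc i) - sqrt (g ^ i)) \<le> 1 * (sqrt (g - 1) * sqrt (g ^ i))"
      proof -
        have "sqrt g \<le> 1 + (g - 1) / 2"
        proof (rule real_le_lsqrt)
          have "0 \<le> (g - 1)\<^sup>2" by simp
          then show "g \<le> (1 + (g - 1) / 2)\<^sup>2" by (simp add: power2_eq_square field_simps)
        qed (use g in auto)
        then have "sqrt g - 1 \<le> (g - 1) / 2" by linarith
        then have "3 * K * (sqrt g - 1) \<le> 3 * K * ((g - 1) / 2)" using K by (intro mult_left_mono) auto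
        also have "(g - 1) = sqrt (g - 1) * sqrt (g - 1)" using g by simp
        also have "sqrt (g - 1) = sqrt tail_const / K" using K by (simp add: gK real_sqrt_divide)
        also have "3 * K * (sqrt tail_const / K * (sqrt tail_const / K) / 2) = (3 / 2 * sqrt tail_const) * (sqrt tail_const / K)" using K by (simp only: field_simps) simp
        also have "\<dots> \<le> 1 * (sqrt tail_const / K)"
        proof (rule mult_right_mono)
          have "sqrt tail_const \<le> sqrt ((1/2)\<^sup>2)" using tail_const by (intro real_sqrt_le_mono) (auto simp: power2_eq_square)
          then show "3 / 2 * sqrt tail_const \<le> 1" by simp
        qed (use K tail_const in auto)
        also have "sqrt tail_const / K = sqrt (g - 1)" using K by (simp add: gK real_sqrt_divide)
        finally have "3 * K * (sqrt g - 1) \<le> sqrt (g - 1)" by simp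
        then have "3 * K * (sqrt g - 1) * sqrt (g ^ i) \<le> sqrt (g - 1) * sqrt (g ^ i)" using g by (intro mult_right_mono) auto
        then show ?thesis by (simp add: real_sqrt_mult algebra_simps)
      qed
      have "1000 * tail_const = normal_density 0 1 (1 + 1)" by (simp add: tail_const_def)
      also have "\<dots> \<le> prob {\<omega> \<in> space M. W (g ^ Suc i) \<omega> - W (g ^ i) \<omega> > 1 * (sqrt (g - 1) * sqrt (g ^ i))}"
        by (rule normal_upper_tail[OF D \<sigma>]) simp
      also have "\<dots> \<le> prob {\<omega> \<in> space M. W (g ^ Suc i) \<omega> - W (g ^ i) \<omega> \<in> {3 * K * (sqrt (g ^ Suc i) - sqrt (g ^ i))..}}"
        by (rule finite_measure_mono) (use le in auto)
      finally have "1000 * tail_const - 150000 * (g - 1)\<^sup>2 / K ^ 4 \<le> prob {\<omega> \<in> space M. osc_le (g ^ i) (g ^ Suc i - g ^ i) (K * sqrt (g ^ i)) \<omega> \<and>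
          W (g ^ Suc i) \<omega> - W (g ^ i) \<omega> \<in> {3 * K * (sqrt (g ^ Suc i) - sqrt (g ^ i))..}}"
        by (intro osc_increment_bound[OF g]) (use K in auto)
      moreover have "150000 * (g - 1)\<^sup>2 / K ^ 4 \<le> 500 * tail_const"
      proof -
        have "150000 * (g - 1)\<^sup>2 / K ^ 4 = (150000 * tail_const) * tail_const / K ^ 8"
          by (simp add: gK power_divide power2_eq_square flip: power_mult power_add) (simp add: eval_nat_numeral)
        also have "\<dots> \<le> 150000 * tail_const * tail_const / 1" using K tail_const by (intro divide_left_mono) auto
        also have "\<dots> \<le> 500 * tail_const" using mult_right_mono[of "150000 * tail_const" 500 tail_const] tail_const by simp
        finally show ?thesis .
      qed
      ultimately show "500 * tail_const \<le> prob {\<omega> \<in> space M. osc_le (g ^ i) (g ^ Suc i - g ^ i) (K * sqrt (g ^ i)) \<omega> \<and>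
          W (g ^ Suc i) \<omega> - W (g ^ i) \<omega> \<in> {3 * K * (sqrt (g ^ Suc i) - sqrt (g ^ i))..}}" by linarith
    next
      fix i :: nat and x d :: real
      assume "3 * K * sqrt (g ^ i) \<le> x" "d \<in> {3 * K * (sqrt (g ^ Suc i) - sqrt (g ^ i))..}"
      then show "3 * K * sqrt (g ^ Suc i) \<le> x + d" by (simp add: algebra_simps)
    next
      fix i :: nat and x d u :: real
      assume a: "3 * K * sqrt (g ^ i) \<le> x" "\<bar>d\<bar> \<le> K * sqrt (g ^ i)" "g ^ i \<le> u" "u \<le> g ^ Suc i"
      have u: "u > 0" using a(3) g by (meson less_le_trans zero_less_one zero_less_power less_trans)
      \<comment> \<open>Within a block \<open>sqrt u\<close> at most doubles, as
        \<open>g <= 2\<close>, and \<open>2 * K * sqrt (g ^ i)\<close> is what the oscillation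
        leaves.\<close>
      have "sqrt u \<le> sqrt g * sqrt (g ^ i)" using a(4) by (simp add: real_sqrt_mult[symmetric])
      also have "\<dots> \<le> 2 * sqrt (g ^ i)"
        using g g2 by (intro mult_right_mono real_le_lsqrt) auto
      finally have "K * sqrt u \<le> K * (2 * sqrt (g ^ i))" using K by (intro mult_left_mono) auto
      also have "\<dots> \<le> x + d" using a by auto
      finally show "(x + d) / sqrt u \<in> {K..}" using u by (simp add: le_divide_eq)
    qed (use tail_const K in auto)
  qed (use g tail_const in auto)
  then show ?thesis by (simp add: g_def)
qed

text \<open>Here the grid is \<open>4 ^ i\<close> and the oscillation allowed in a block is half the window, whence
  the constant \<open>150000 * 3\<^sup>2 * 2 ^ 4\<close>.\<close>

lemma stays_tail:
  assumes L: "L > 0" and T: "T \<le> real n * ln 4" "0 < n" and p0: "0 \<le> 1 - 21600000 / L ^ 4"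
  shows "(1 - 21600000 / L ^ 4) ^ Suc n \<le> prob {\<omega> \<in> space M. stays T {- L..L} \<omega>}"
proof -
  define p where "p = 1 - 21600000 / L ^ 4"
  have init: "p \<le> prob {\<omega> \<in> space M. W 1 \<omega> - W 0 \<omega> \<in> {- (L / 2)..L / 2}}"
  proof -
    have [measurable]: "W 1 \<in> borel_measurable M" "W 0 \<in> borel_measurable M" by auto
    have D: "distributed M lborel (\<lambda>\<omega>. W 1 \<omega> - W 0 \<omega>) (normal_density 0 1)"
      using W_increment[of 0 1] by simp
    have "{\<omega> \<in> space M. W 1 \<omega> - W 0 \<omega> \<in> {- (L / 2)..L / 2}} = space M - {\<omega> \<in> space M. \<bar>W 1 \<omega> - W 0 \<omega>\<bar> > L / 2}"
      by (auto simp: abs_real_def split: if_splits)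
    then have "prob {\<omega> \<in> space M. W 1 \<omega> - W 0 \<omega> \<in> {- (L / 2)..L / 2}} = 1 - prob {\<omega> \<in> space M. \<bar>W 1 \<omega> - W 0 \<omega>\<bar> > L / 2}"
      by (simp add: prob_compl)
    moreover have "prob {\<omega> \<in> space M. \<bar>W 1 \<omega> - W 0 \<omega>\<bar> > L / 2} \<le> 3 * 1 ^ 4 / (L / 2) ^ 4"
      by (rule normal_fourth_moment_tail[OF D]) (use L in auto)
    moreover have "3 * 1 ^ 4 / (L / 2) ^ 4 \<le> 21600000 / L ^ 4" using L by (simp add: power_divide divide_right_mono)
    ultimately show ?thesis by (simp add: p_def)
  qed
  \<comment> \<open>The ratio 4 doubles the admissible range \<open>L / 2 * sqrt (4 ^ i)\<close> in
    each block, exactly enough to absorb the oscillation. No direction has to be prescribed, so the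
    probability per block tends to 1 as \<open>L\<close> grows. The factor beyond
    \<open>p ^ n\<close> comes from the initial value.\<close>
  have "prob {\<omega> \<in> space M. W 1 \<omega> - W 0 \<omega> \<in> {- (L / 2)..L / 2}} * p ^ n \<le> prob {\<omega> \<in> space M. stays T {- L..L} \<omega>}"
  proof (rule geometric_stays[of 4, OF _ T, where y = "\<lambda>i. L / 2 * sqrt (4 ^ i)" and B = "\<lambda>i b. UNIV"
        and P = "\<lambda>i x. \<bar>x\<bar> \<le> L / 2 * sqrt (4 ^ i)"])
    fix i :: nat
    have "1 - 150000 * (4 - 1)\<^sup>2 / (L / 2) ^ 4 \<le> prob {\<omega> \<in> space M. osc_le (4 ^ i) (4 ^ Suc i - 4 ^ i) (L / 2 * sqrt (4 ^ i)) \<omega> \<and>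
          W (4 ^ Suc i) \<omega> - W (4 ^ i) \<omega> \<in> UNIV}"
      by (rule osc_increment_bound) (use L in \<open>auto simp: prob_space\<close>)
    then show "p \<le> prob {\<omega> \<in> space M. osc_le (4 ^ i) (4 ^ Suc i - 4 ^ i) (L / 2 * sqrt (4 ^ i)) \<omega> \<and>
          W (4 ^ Suc i) \<omega> - W (4 ^ i) \<omega> \<in> UNIV}" by (simp add: p_def power_divide)
  next
    fix i :: nat and x d :: real
    assume "\<bar>x\<bar> \<le> L / 2 * sqrt (4 ^ i)" "\<bar>d\<bar> \<le> L / 2 * sqrt (4 ^ i)"
    moreover have "sqrt (4 ^ Suc i) = 2 * sqrt (4 ^ i)" by (simp add: real_sqrt_mult)
    ultimately show "\<bar>x + d\<bar> \<le> L / 2 * sqrt (4 ^ Suc i)" by auto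
  next
    fix i :: nat and x d u :: real
    assume a: "\<bar>x\<bar> \<le> L / 2 * sqrt (4 ^ i)" "\<bar>d\<bar> \<le> L / 2 * sqrt (4 ^ i)" "4 ^ i \<le> u"
    have u: "u > 0" using a(3) by (meson less_le_trans zero_less_numeral zero_less_power)
    have "\<bar>x + d\<bar> \<le> L * sqrt (4 ^ i)" using a by auto
    also have "\<dots> \<le> L * sqrt u" using a L by (intro mult_left_mono) auto
    finally have "- L * sqrt u \<le> x + d" "x + d \<le> L * sqrt u" by (auto simp: abs_le_iff)
    then show "(x + d) / sqrt u \<in> {- L..L}" using u by (simp add: le_divide_eq divide_le_eq)
  qed (use p0 in \<open>auto simp: p_def\<close>)
  moreover have "p ^ Suc n \<le> prob {\<omega> \<in> space M. W 1 \<omega> - W 0 \<omega> \<in> {- (L / 2)..L / 2}} * p ^ n"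
    using init p0 by (auto simp: p_def intro!: mult_right_mono)
  ultimately show ?thesis by (simp add: p_def)
qed

section \<open>The Ornstein-Uhlenbeck process on an arithmetic grid\<close>

lemma ou_increment:
  assumes "h > 0"
  shows "distributed M lborel (\<lambda>\<omega>. W (exp (real (Suc i) * h)) \<omega> - W (exp (real i * h)) \<omega>)
    (normal_density 0 (exp (real (Suc i) * h / 2) * sqrt (1 - exp (- h))))"
proof -
  have "exp (real (Suc i) * h) - exp (real i * h) = exp (real (Suc i) * h) * (1 - exp (- h))"
  proof -
    have "real (Suc i) * h + - h = real i * h" by (simp add: algebra_simps)
    then have "exp (real i * h) = exp (real (Suc i) * h) * exp (- h)" by (simp only: exp_add[symmetric])
    then show ?thesis by (simp only: right_diff_distrib mult_1_right)
  qed
  moreover have "sqrt (exp (real (Suc i) * h)) = exp (real (Suc i) * h / 2)"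
    by (rule real_sqrt_unique) (simp_all add: exp_double[symmetric])
  ultimately have "sqrt (exp (real (Suc i) * h) - exp (real i * h)) = exp (real (Suc i) * h / 2) * sqrt (1 - exp (- h))"
    by (simp only: real_sqrt_mult)
  then show ?thesis using W_increment[of "exp (real i * h)" "exp (real (Suc i) * h)"] assms by simp
qed

text \<open>The increments are left unscaled, with the initial one at index 0, so that their partial
  sums are the Brownian path itself, as \<open>confined_partial_sums\<close> requires.\<close>

definition ou_noise :: "real \<Rightarrow> nat \<Rightarrow> 'a \<Rightarrow> real" where
  "ou_noise h l \<omega> = (case l of 0 \<Rightarrow> W 1 \<omega> - W 0 \<omega> | Suc i \<Rightarrow> W (exp (real (Suc i) * h)) \<omega> - W (exp (real i * h)) \<omega>)"

lemma ou_noise_indep: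
  assumes "h > 0"
  shows "indep_vars (\<lambda>_. borel) (ou_noise h) {..<n}"
proof -
  define \<tau> where "\<tau> l = (case l of 0 \<Rightarrow> 0 | Suc i \<Rightarrow> exp (real i * h))" for l
  have eq: "(\<lambda>i \<omega>. W (\<tau> (Suc i)) \<omega> - W (\<tau> i) \<omega>) = ou_noise h"
    by (auto simp: \<tau>_def ou_noise_def fun_eq_iff split: nat.split)
  have "indep_vars (\<lambda>_. borel) (\<lambda>i \<omega>. W (\<tau> (Suc i)) \<omega> - W (\<tau> i) \<omega>) {..<n}"
    by (rule W_indep) (use assms in \<open>auto simp: \<tau>_def mult_right_mono split: nat.split\<close>)
  then show ?thesis unfolding eq .
qed

lemma ou_noise_sum: "(\<Sum>l\<le>i. ou_noise h l \<omega>) = W (exp (real i * h)) \<omega> - W 0 \<omega>"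
  by (induction i) (auto simp: ou_noise_def)

lemma ou_noise_0: "distributed M lborel (ou_noise h 0) (normal_density 0 1)"
  using W_increment[of 0 1] by (simp add: ou_noise_def[abs_def])

lemma ou_noise_Suc:
  "h > 0 \<Longrightarrow> distributed M lborel (ou_noise h (Suc i)) (normal_density 0 (exp (real (Suc i) * h / 2) * sqrt (1 - exp (- h))))"
  using ou_increment[of h i] by (simp add: ou_noise_def[abs_def])

text \<open>In Brownian scale the window at grid time \<open>i\<close> is
  \<open>d * exp (real i * h / 2)\<close>, and for \<open>i > 0\<close> the last increment has
  standard deviation proportional to the same exponential. So the window is at most \<open>x\<close>
  standard deviations for every such \<open>i\<close>. Index 0 is left out because its noise has a
  different variance.\<close>

lemma ou_confined:
  assumes h: "h > 0" and H: "finite H" and x: "x \<ge> 0" "d \<le> x * sqrt (1 - exp (- h))"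
  shows "prob {\<omega> \<in> space M. \<forall>i\<in>H. \<bar>exp (- (real i * h) / 2) * W (exp (real i * h)) \<omega>\<bar> \<le> d}
    \<le> (1 - normal_density 0 1 (x + 1)) ^ card (H - {0})"
proof -
  define q where "q = normal_density 0 1 (x + 1)"
  obtain n where n: "H \<subseteq> {..<n}" using H by (meson finite_nat_bounded)
  define D where "D i = d * exp (real i * h / 2)" for i :: nat
  have s: "sqrt (1 - exp (- h)) > 0" using h by simp
  have q: "q \<le> prob {\<omega> \<in> space M. ou_noise h i \<omega> > D i}" "q \<le> prob {\<omega> \<in> space M. ou_noise h i \<omega> < - D i}"
    if i: "i \<noteq> 0" for i
  proof -
    obtain j where j: "i = Suc j" using i by (cases i) auto
    define \<sigma> where "\<sigma> = exp (real (Suc j) * h / 2) * sqrt (1 - exp (- h))"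
    have \<sigma>: "\<sigma> > 0" using s by (simp add: \<sigma>_def)
    have N: "distributed M lborel (ou_noise h i) (normal_density 0 \<sigma>)"
      unfolding j \<sigma>_def by (rule ou_noise_Suc[OF h])
    have [measurable]: "ou_noise h i \<in> borel_measurable M"
      using distributed_measurable[OF N] by simp
    have D: "D i \<le> x * \<sigma>"
      using mult_right_mono[OF x(2), of "exp (real i * h / 2)"] by (simp add: D_def \<sigma>_def j mult_ac)
    have "q \<le> prob {\<omega> \<in> space M. ou_noise h i \<omega> > x * \<sigma>}"
      unfolding q_def by (rule normal_upper_tail[OF N \<sigma> x(1)])
    also have "\<dots> \<le> prob {\<omega> \<in> space M. ou_noise h i \<omega> > D i}"
      by (rule finite_measure_mono) (use D in auto)
    finally show "q \<le> prob {\<omega> \<in> space M. ou_noise h i \<omega> > D i}" .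
    have "q \<le> prob {\<omega> \<in> space M. ou_noise h i \<omega> < - (x * \<sigma>)}"
      unfolding q_def by (rule normal_lower_tail[OF N \<sigma> x(1)])
    also have "\<dots> \<le> prob {\<omega> \<in> space M. ou_noise h i \<omega> < - D i}"
      by (rule finite_measure_mono) (use D in auto)
    finally show "q \<le> prob {\<omega> \<in> space M. ou_noise h i \<omega> < - D i}" .
  qed
  have q1: "q \<le> 1" by (rule order_trans[OF q(1)[of 1]]) auto
  have [measurable]: "ou_noise h i \<in> borel_measurable M" for i
    by (cases i) (use distributed_measurable[OF ou_noise_0[of h]] distributed_measurable[OF ou_noise_Suc[OF h]] in auto)
  have "prob {\<omega> \<in> space M. \<forall>i\<in>H. \<bar>exp (- (real i * h) / 2) * W (exp (real i * h)) \<omega>\<bar> \<le> d} \<le>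
    prob {\<omega> \<in> space M. \<forall>i\<in>H - {0}. \<bar>\<Sum>l\<le>i. ou_noise h l \<omega>\<bar> \<le> D i}"
  proof (rule finite_measure_mono_AE)
    show "{\<omega> \<in> space M. \<forall>i\<in>H - {0}. \<bar>\<Sum>l\<le>i. ou_noise h l \<omega>\<bar> \<le> D i} \<in> events" by measurable
    show "AE \<omega> in M. \<omega> \<in> {\<omega> \<in> space M. \<forall>i\<in>H. \<bar>exp (- (real i * h) / 2) * W (exp (real i * h)) \<omega>\<bar> \<le> d} \<longrightarrow>
      \<omega> \<in> {\<omega> \<in> space M. \<forall>i\<in>H - {0}. \<bar>\<Sum>l\<le>i. ou_noise h l \<omega>\<bar> \<le> D i}"
      using W_0
    proof eventually_elim
      case (elim \<omega>)
      have "\<bar>\<Sum>l\<le>i. ou_noise h l \<omega>\<bar> \<le> D i" if "\<bar>exp (- (real i * h) / 2) * W (exp (real i * h)) \<omega>\<bar> \<le> d" for i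
        using that by (simp add: ou_noise_sum elim D_def abs_mult exp_minus field_simps)
      then show ?case by auto
    qed
  qed
  also have "\<dots> \<le> (1 - q) ^ card (H - {0})"
    by (rule confined_partial_sums[OF ou_noise_indep[OF h, of n]]) (use n q q1 in \<open>auto simp: q_def\<close>)
  finally show ?thesis by (simp add: q_def)
qed

text \<open>The factor \<open>4 / h\<close> bounds the sum \<open>1 / (1 - exp (- h / 2))\<close> of the geometric weights.\<close>

lemma ou_sum_le_noise:
  assumes h: "0 < h" "h \<le> 1" and W0: "W 0 \<omega> = 0"
  shows "(\<Sum>i<n. \<bar>exp (- (real i * h) / 2) * W (exp (real i * h)) \<omega>\<bar>) \<le>
    4 / h * (\<Sum>l<n. exp (- (real l * h) / 2) * \<bar>ou_noise h l \<omega>\<bar>)"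
proof -
  define e where "e i = exp (- (real i * h) / 2)" for i :: nat
  have e: "e i > 0" for i by (simp add: e_def)
  have ediff: "e l * (h / 4) \<le> e l - e (Suc l)" for l
  proof -
    have "exp (- (h / 2)) \<le> 1 - h / 4"
    proof -
      have "(1 - h / 4) * (1 + h / 2) \<ge> 1" using h by (simp add: field_simps power2_eq_square)
      moreover have "1 + h / 2 \<le> exp (h / 2)" by (rule exp_ge_add_one_self)
      ultimately have "1 \<le> (1 - h / 4) * exp (h / 2)"
        using h by (elim order_trans) (intro mult_left_mono, auto)
      then show ?thesis by (simp add: exp_minus field_simps)
    qed
    then have "e l * exp (- (h / 2)) \<le> e l * (1 - h / 4)" using e[of l] by (intro mult_left_mono) auto
    moreover have "e (Suc l) = e l * exp (- (h / 2))"
    proof -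
      have "- (real (Suc l) * h) / 2 = - (real l * h) / 2 + - (h / 2)" by (simp add: field_simps)
      then show ?thesis by (simp only: e_def exp_add)
    qed
    ultimately show ?thesis by (simp add: right_diff_distrib)
  qed
  have tail: "(\<Sum>i\<in>{l..<n}. e i) \<le> 4 / h * e l" if "l \<le> n" for l
  proof -
    have "(\<Sum>i\<in>{l..<n}. e i) * (h / 4) \<le> (\<Sum>i\<in>{l..<n}. e i - e (Suc i))"
      unfolding sum_distrib_right by (rule sum_mono) (rule ediff)
    also have "\<dots> = - (\<Sum>i\<in>{l..<n}. e (Suc i) - e i)" by (simp add: sum_negf[symmetric])
    also have "\<dots> = e l - e n" using that by (subst sum_Suc_diff') auto
    also have "\<dots> \<le> e l" using e[of n] by simp
    finally show ?thesis using h by (simp add: field_simps)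
  qed
  have "(\<Sum>i<n. \<bar>exp (- (real i * h) / 2) * W (exp (real i * h)) \<omega>\<bar>) \<le> (\<Sum>i<n. \<Sum>l\<le>i. e i * \<bar>ou_noise h l \<omega>\<bar>)"
  proof (rule sum_mono)
    fix i
    have "\<bar>exp (- (real i * h) / 2) * W (exp (real i * h)) \<omega>\<bar> = e i * \<bar>\<Sum>l\<le>i. ou_noise h l \<omega>\<bar>"
      by (simp add: ou_noise_sum W0 e_def abs_mult)
    also have "\<dots> \<le> e i * (\<Sum>l\<le>i. \<bar>ou_noise h l \<omega>\<bar>)" using e[of i] by (intro mult_left_mono sum_abs) auto
    finally show "\<bar>exp (- (real i * h) / 2) * W (exp (real i * h)) \<omega>\<bar> \<le> (\<Sum>l\<le>i. e i * \<bar>ou_noise h l \<omega>\<bar>)"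
      by (simp add: sum_distrib_left)
  qed
  \<comment> \<open>Exchanging the sums collects, for each noise \<open>l\<close>, the weights of
    all later grid times.\<close>
  also have "\<dots> = (\<Sum>l<n. \<Sum>i\<in>{l..<n}. e i * \<bar>ou_noise h l \<omega>\<bar>)"
    unfolding sum.Sigma[OF finite_lessThan ballI[OF finite_atMost]] sum.Sigma[OF finite_lessThan ballI[OF finite_atLeastLessThan]]
    by (rule sum.reindex_bij_witness[of _ "\<lambda>(l, i). (i, l)" "\<lambda>(i, l). (l, i)"]) auto
  also have "\<dots> \<le> (\<Sum>l<n. 4 / h * e l * \<bar>ou_noise h l \<omega>\<bar>)"
    unfolding sum_distrib_right[symmetric] by (intro sum_mono mult_right_mono tail) auto
  finally show ?thesis by (simp add: sum_distrib_left e_def mult.assoc)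
qed

text \<open>Chernoff's bound for the normalized noises \<open>\<eta>\<close>. The parameter
  \<open>k\<close> will be the index of the coefficient: it makes the bounds summable over all
  coefficients.\<close>

lemma ou_sum_tail:
  assumes h: "0 < h" "h \<le> 1"
  shows "prob {\<omega> \<in> space M. (\<Sum>i<n. \<bar>exp (- (real i * h) / 2) * W (exp (real i * h)) \<omega>\<bar>) \<ge> 4 / sqrt h * (real n * (3 + k))}
    \<le> 2 * exp (1 / (2 * h)) * exp (- (real n * (1 + k)))"
proof -
  define \<eta> where "\<eta> l \<omega> = exp (- (real l * h) / 2) / sqrt h * ou_noise h l \<omega>" for l \<omega>
  have [measurable]: "ou_noise h i \<in> borel_measurable M" for i
    by (cases i) (use distributed_measurable[OF ou_noise_0[of h]] distributed_measurable[OF ou_noise_Suc[OF h(1)]] in auto)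
  have \<eta>_meas[measurable]: "\<eta> l \<in> borel_measurable M" for l unfolding \<eta>_def[abs_def] by measurable
  have \<eta>_0: "distributed M lborel (\<eta> 0) (normal_density 0 (1 / sqrt h))"
    using normal_density_affine[OF ou_noise_0[of h], of "1 / sqrt h" 0] h by (simp add: \<eta>_def[abs_def])
  have \<eta>_Suc: "distributed M lborel (\<eta> (Suc l)) (normal_density 0 (sqrt (1 - exp (- h)) / sqrt h))" for l
  proof -
    let ?a = "exp (- (real (Suc l) * h) / 2) / sqrt h"
    have a: "?a > 0" using h by simp
    have s: "0 < exp (real (Suc l) * h / 2) * sqrt (1 - exp (- h))" using h by simp
    have "distributed M lborel (\<eta> (Suc l)) (normal_density (0 + ?a * 0) (\<bar>?a\<bar> * (exp (real (Suc l) * h / 2) * sqrt (1 - exp (- h)))))"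
      using normal_density_affine[OF ou_noise_Suc[OF h(1), of l] s, of ?a 0] a h by (simp add: \<eta>_def[abs_def] del: of_nat_Suc)
    also have "\<bar>?a\<bar> * (exp (real (Suc l) * h / 2) * sqrt (1 - exp (- h))) = sqrt (1 - exp (- h)) / sqrt h"
    proof -
      have "exp (- x / 2) * exp (x / 2) = 1" for x :: real by (simp add: exp_add[symmetric])
      from this[of "real (Suc l) * h"]
      have "?a * (exp (real (Suc l) * h / 2) * sqrt (1 - exp (- h))) = 1 * (sqrt (1 - exp (- h)) / sqrt h)"
        by (metis (no_types, lifting) mult.assoc mult.commute times_divide_eq_left)
      then show ?thesis using a by (simp only: abs_of_pos mult_1_left)
    qed
    finally show ?thesis by simp
  qed
  have le1: "(sqrt (1 - exp (- h)) / sqrt h)\<^sup>2 \<le> 1"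
    using h exp_ge_add_one_self[of "- h"] by (simp add: power_divide)
  \<comment> \<open>For \<open>l > 0\<close> the variance of \<open>\<eta> l\<close> is
    \<open>(1 - exp (- h)) / h <= 1\<close>, and \<open>2 * exp (1 / 2) <= 4\<close>. The initial
    noise has variance \<open>1 / h\<close>; it enters once and only affects the constant in front.
    In the end \<open>4 ^ n <= exp (2 * n)\<close> uses up two of the three units in
    \<open>3 + k\<close>.\<close>
  define c where "c l = (if l = 0 then 2 * exp (1 / (2 * h)) else 4)" for l :: nat
  have int: "integrable M (\<lambda>\<omega>. exp \<bar>\<eta> l \<omega>\<bar>)" for l
    by (cases l) (use normal_exp_abs_moment(1)[OF \<eta>_0] normal_exp_abs_moment(1)[OF \<eta>_Suc] h in auto)
  have ex: "expectation (\<lambda>\<omega>. exp \<bar>\<eta> l \<omega>\<bar>) \<le> c l" for l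
  proof (cases l)
    case 0
    then show ?thesis using normal_exp_abs_moment(2)[OF \<eta>_0] h by (simp add: c_def power_divide mult.commute)
  next
    case (Suc l')
    have "expectation (\<lambda>\<omega>. exp \<bar>\<eta> l \<omega>\<bar>) \<le> 2 * exp ((sqrt (1 - exp (- h)) / sqrt h)\<^sup>2 / 2)"
      unfolding Suc by (rule normal_exp_abs_moment(2)[OF \<eta>_Suc]) (use h in auto)
    also have "\<dots> \<le> 2 * exp (1 / 2)" using le1 by simp
    also have "exp (1 / 2 :: real) \<le> 2"
      using exp_bound[of "1/2 :: real"] by (simp add: power2_eq_square)
    finally show ?thesis by (simp add: c_def Suc)
  qed
  have indE: "indep_vars (\<lambda>_. borel) (\<lambda>l \<omega>. exp \<bar>\<eta> l \<omega>\<bar>) {..<n}"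
    unfolding \<eta>_def by (rule indep_vars_compose2[OF ou_noise_indep[OF h(1)]]) measurable
  have prod: "expectation (\<lambda>\<omega>. \<Prod>l<n. exp \<bar>\<eta> l \<omega>\<bar>) = (\<Prod>l<n. expectation (\<lambda>\<omega>. exp \<bar>\<eta> l \<omega>\<bar>))"
    "integrable M (\<lambda>\<omega>. \<Prod>l<n. exp \<bar>\<eta> l \<omega>\<bar>)"
    using indep_vars_lebesgue_integral[OF _ indE] indep_vars_integrable[OF _ indE] int by auto
  have E: "expectation (\<lambda>\<omega>. \<Prod>l<n. exp \<bar>\<eta> l \<omega>\<bar>) \<le> 2 * exp (1 / (2 * h)) * 4 ^ n"
  proof (cases "n = 0")
    case True
    have "1 \<le> exp (1 / (2 * h))" using h by simp
    then have "1 \<le> 2 * exp (1 / (2 * h))" by linarith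
    then show ?thesis using True by (simp add: prob_space)
  next
    case False
    then have "expectation (\<lambda>\<omega>. \<Prod>l<n. exp \<bar>\<eta> l \<omega>\<bar>) \<le> (\<Prod>l<n. c l)"
      unfolding prod(1) by (intro prod_mono conjI ex) auto
    also have "\<dots> \<le> 2 * exp (1 / (2 * h)) * 4 ^ n"
      using False
    proof (induction n)
      case (Suc m)
      show ?case
      proof (cases "m = 0")
        case False
        then show ?thesis using Suc by (simp add: c_def mult_ac)
      qed (simp add: c_def)
    qed simp
    finally show ?thesis .
  qed

  have Wm[measurable]: "W (exp t) \<in> borel_measurable M" for t by (rule W_measurable) simp
  have "prob {\<omega> \<in> space M. (\<Sum>i<n. \<bar>exp (- (real i * h) / 2) * W (exp (real i * h)) \<omega>\<bar>) \<ge> 4 / sqrt h * (real n * (3 + k))}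
     \<le> prob {\<omega> \<in> space M. (\<Prod>l<n. exp \<bar>\<eta> l \<omega>\<bar>) \<ge> exp (real n * (3 + k))}"
  proof (rule finite_measure_mono_AE)
    show "{\<omega> \<in> space M. (\<Prod>l<n. exp \<bar>\<eta> l \<omega>\<bar>) \<ge> exp (real n * (3 + k))} \<in> events" by measurable
    show "AE \<omega> in M. \<omega> \<in> {\<omega> \<in> space M. (\<Sum>i<n. \<bar>exp (- (real i * h) / 2) * W (exp (real i * h)) \<omega>\<bar>) \<ge> 4 / sqrt h * (real n * (3 + k))} \<longrightarrow>
      \<omega> \<in> {\<omega> \<in> space M. (\<Prod>l<n. exp \<bar>\<eta> l \<omega>\<bar>) \<ge> exp (real n * (3 + k))}"
      using W_0
    proof eventually_elim
      case (elim \<omega>)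
      have "(\<Sum>l<n. \<bar>\<eta> l \<omega>\<bar>) = (\<Sum>l<n. exp (- (real l * h) / 2) * \<bar>ou_noise h l \<omega>\<bar>) / sqrt h"
        using h by (simp add: \<eta>_def abs_mult sum_divide_distrib)
      then have eq: "4 / h * (\<Sum>l<n. exp (- (real l * h) / 2) * \<bar>ou_noise h l \<omega>\<bar>) = 4 / sqrt h * (\<Sum>l<n. \<bar>\<eta> l \<omega>\<bar>)"
      proof -
        have "4 / h * s = 4 / sqrt h * (s / sqrt h)" for s
          using h by (metis less_imp_le mult.commute real_sqrt_mult_self abs_of_nonneg times_divide_times_eq times_divide_eq_left times_divide_eq_right divide_divide_eq_left')
        then show ?thesis using \<open>(\<Sum>l<n. \<bar>\<eta> l \<omega>\<bar>) = _\<close> by simp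
      qed
      have "4 / sqrt h * (real n * (3 + k)) \<le> 4 / sqrt h * (\<Sum>l<n. \<bar>\<eta> l \<omega>\<bar>)"
        if "(\<Sum>i<n. \<bar>exp (- (real i * h) / 2) * W (exp (real i * h)) \<omega>\<bar>) \<ge> 4 / sqrt h * (real n * (3 + k))"
        using ou_sum_le_noise[OF h elim, of n] that unfolding eq by linarith
      then show ?case using h by (auto simp: exp_sum[symmetric] divide_le_cancel)
    qed
  qed
  also have "\<dots> \<le> expectation (\<lambda>\<omega>. \<Prod>l<n. exp \<bar>\<eta> l \<omega>\<bar>) / exp (real n * (3 + k))"
    by (rule integral_Markov_inequality_measure[OF prod(2), where A="{}"]) (auto intro!: always_eventually prod_nonneg)
  also have "\<dots> \<le> 2 * exp (1 / (2 * h)) * 4 ^ n / exp (real n * (3 + k))"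
    by (intro divide_right_mono E) auto
  also have "\<dots> \<le> 2 * exp (1 / (2 * h)) * exp (real n * 2) / exp (real n * (3 + k))"
  proof -
    have "(4::real) \<le> exp 2"
    proof -
      have "2 \<le> exp (1::real)" using exp_ge_add_one_self[of 1] by simp
      then have "2 * 2 \<le> exp 1 * exp (1::real)" by (intro mult_mono) auto
      then show ?thesis by (simp add: exp_add[symmetric])
    qed
    then have "4 ^ n \<le> exp (2::real) ^ n" by (intro power_mono) auto
    then show ?thesis by (intro divide_right_mono mult_left_mono) (auto simp: exp_of_nat_mult)
  qed
  also have "\<dots> = 2 * exp (1 / (2 * h)) * exp (- (real n * (1 + k)))"
  proof -
    have "real n * 2 - real n * (3 + k) = - (real n * (1 + k))" by (simp add: algebra_simps)
    then have "exp (real n * 2) / exp (real n * (3 + k)) = exp (- (real n * (1 + k)))"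
      by (simp only: exp_diff[symmetric])
    then show ?thesis by (simp only: times_divide_eq_right[symmetric])
  qed
  finally show ?thesis .
qed

end

section \<open>Power series with weights \<open>1 / sqrt (n!)\<close>\<close>

text \<open>The inequality of arithmetic and geometric means for the factors
  \<open>sqrt ((1 / 2) ^ n)\<close> and \<open>sqrt ((2 * x\<^sup>2) ^ n / fact n)\<close>: the
  square root of the factorial gives way to a geometric and an exponential series.\<close>

lemma gaf_weight_le:
  assumes "x \<ge> 0"
  shows "x ^ n / sqrt (fact n) \<le> ((1 / 2) ^ n + (2 * x\<^sup>2) ^ n / fact n) / 2"
proof -
  define a b where "a = sqrt ((1 / 2) ^ n :: real)" and "b = sqrt ((2 * x\<^sup>2) ^ n / fact n)"
  have "a * b = sqrt ((1 / 2 * (2 * x\<^sup>2)) ^ n / fact n)"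
    by (simp only: a_def b_def real_sqrt_mult[symmetric] power_mult_distrib times_divide_eq_right)
  also have "\<dots> = sqrt ((x ^ n)\<^sup>2) / sqrt (fact n)"
    by (simp add: real_sqrt_divide power_mult[symmetric] mult.commute)
  also have "\<dots> = x ^ n / sqrt (fact n)" using assms by simp
  finally have ab: "a * b = x ^ n / sqrt (fact n)" .
  have "0 \<le> (a - b)\<^sup>2" by simp
  then have "a * b \<le> (a\<^sup>2 + b\<^sup>2) / 2" by (simp add: power2_eq_square algebra_simps)
  moreover have "a\<^sup>2 = (1 / 2) ^ n" "b\<^sup>2 = (2 * x\<^sup>2) ^ n / fact n" by (simp_all add: a_def b_def)
  ultimately show ?thesis using ab by simp
qed

text \<open>What matters later is the growth \<open>exp (O(x\<^sup>2))\<close>: at a radius of order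
  \<open>sqrt N\<close> it costs only \<open>exp (O(N))\<close>.\<close>

lemma gaf_weight_summable:
  assumes "x \<ge> 0"
  shows "summable (\<lambda>n. x ^ n / sqrt (fact n))" "(\<Sum>n. x ^ n / sqrt (fact n)) \<le> 2 * exp (2 * x\<^sup>2)"
proof -
  have s1: "(\<lambda>n. (1 / 2 :: real) ^ n) sums 2" using geometric_sums[of "1 / 2 :: real"] by simp
  have s2: "(\<lambda>n. (2 * x\<^sup>2) ^ n / fact n) sums exp (2 * x\<^sup>2)"
    using exp_converges[of "2 * x\<^sup>2"] by (simp add: divide_inverse mult.commute)
  have s: "(\<lambda>n. ((1 / 2) ^ n + (2 * x\<^sup>2) ^ n / fact n) / 2) sums ((2 + exp (2 * x\<^sup>2)) / 2)"
    by (intro sums_divide sums_add s1 s2)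
  show sm: "summable (\<lambda>n. x ^ n / sqrt (fact n))"
    by (rule summable_comparison_test'[OF sums_summable[OF s], of 0])
       (use gaf_weight_le[OF assms] assms in \<open>auto simp: abs_of_nonneg\<close>)
  have "(\<Sum>n. x ^ n / sqrt (fact n)) \<le> (2 + exp (2 * x\<^sup>2)) / 2"
    using suminf_le[OF gaf_weight_le[OF assms] sm sums_summable[OF s]] s by (simp add: sums_iff)
  also have "\<dots> \<le> 2 * exp (2 * x\<^sup>2)"
  proof -
    have "(2 + e) / 2 \<le> 2 * e" if "1 \<le> e" for e :: real using that by (simp add: field_simps)
    from this[of "exp (2 * x\<^sup>2)"] show ?thesis by (simp only: one_le_exp_iff) simp
  qed
  finally show "(\<Sum>n. x ^ n / sqrt (fact n)) \<le> 2 * exp (2 * x\<^sup>2)" .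
qed

lemma gaf_weight_linear_summable:
  assumes "x \<ge> 0"
  shows "summable (\<lambda>n. (real n + c) * (x ^ n / sqrt (fact n)))"
proof -
  have "summable (\<lambda>n. (2 * x) ^ n / sqrt (fact n) + \<bar>c\<bar> * (x ^ n / sqrt (fact n)))"
    using assms by (intro summable_add summable_mult gaf_weight_summable(1)) auto
  then show ?thesis
  proof (rule summable_comparison_test'[of _ 0])
    fix n :: nat
    have "real n \<le> 2 ^ n" using less_exp[of n] by (metis less_imp_le of_nat_le_iff of_nat_numeral of_nat_power)
    then have "\<bar>real n + c\<bar> \<le> 2 ^ n + \<bar>c\<bar>" by linarith
    then have "\<bar>real n + c\<bar> * (x ^ n / sqrt (fact n)) \<le> (2 ^ n + \<bar>c\<bar>) * (x ^ n / sqrt (fact n))"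
      using assms by (intro mult_right_mono) auto
    then show "norm ((real n + c) * (x ^ n / sqrt (fact n))) \<le> (2 * x) ^ n / sqrt (fact n) + \<bar>c\<bar> * (x ^ n / sqrt (fact n))"
    proof -
      have "norm ((real n + c) * (x ^ n / sqrt (fact n))) = \<bar>real n + c\<bar> * (x ^ n / sqrt (fact n))"
        using assms by (simp only: real_norm_def abs_mult) simp
      moreover have "(2 ^ n + \<bar>c\<bar>) * (x ^ n / sqrt (fact n)) = (2 * x) ^ n / sqrt (fact n) + \<bar>c\<bar> * (x ^ n / sqrt (fact n))"
        by (simp add: power_mult_distrib distrib_right add_divide_distrib)
      ultimately show ?thesis
        using \<open>\<bar>real n + c\<bar> * (x ^ n / sqrt (fact n)) \<le> (2 ^ n + \<bar>c\<bar>) * (x ^ n / sqrt (fact n))\<close> by (simp only:)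
    qed
  qed
qed

definition gaf_series :: "(nat \<Rightarrow> complex) \<Rightarrow> complex \<Rightarrow> complex" where
  "gaf_series c z = (\<Sum>n. c n * (z ^ n / of_real (sqrt (fact n))))"

lemma gaf_term_norm: "cmod (c * (z ^ n / of_real (sqrt (fact n)))) = cmod c * (cmod z ^ n / sqrt (fact n))"
  by (simp add: norm_mult norm_divide norm_power)

lemma gaf_series_summable:
  assumes "\<And>n. cmod (c n) \<le> L * (real n + 1)"
  shows "summable (\<lambda>n. cmod (c n) * (r ^ n / sqrt (fact n)))" (is "summable ?f")
proof -
  have "summable (\<lambda>n. L * ((real n + 1) * (\<bar>r\<bar> ^ n / sqrt (fact n))))"
    by (intro summable_mult gaf_weight_linear_summable) auto
  then show ?thesis
  proof (rule summable_comparison_test'[of _ 0])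
    fix n :: nat
    have "cmod (c n) * (\<bar>r\<bar> ^ n / sqrt (fact n)) \<le> L * (real n + 1) * (\<bar>r\<bar> ^ n / sqrt (fact n))"
      by (intro mult_right_mono assms) auto
    then show "norm (?f n) \<le> L * ((real n + 1) * (\<bar>r\<bar> ^ n / sqrt (fact n)))"
      by (simp add: abs_mult power_abs mult.assoc)
  qed
qed

lemma gaf_series_sums:
  assumes "\<And>n. cmod (c n) \<le> L * (real n + 1)"
  shows "(\<lambda>n. c n * (z ^ n / of_real (sqrt (fact n)))) sums gaf_series c z"
  unfolding gaf_series_def
  by (rule summable_sums, rule summable_norm_cancel)
     (use gaf_series_summable[OF assms, of "cmod z"] in \<open>simp only: gaf_term_norm\<close>)

lemma gaf_series_holomorphic:
  assumes "\<And>n. cmod (c n) \<le> L * (real n + 1)"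
  shows "gaf_series c holomorphic_on UNIV"
proof -
  have "gaf_series c holomorphic_on ball 0 r" for r
    by (rule power_series_holomorphic[of _ _ "\<lambda>n. c n / of_real (sqrt (fact n))"])
       (use gaf_series_sums[OF assms] in simp)
  moreover have "(UNIV :: complex set) = (\<Union>r. ball 0 r)"
  proof (rule set_eqI)
    fix z :: complex
    have "z \<in> ball 0 (cmod z + 1)" by simp
    then show "z \<in> UNIV \<longleftrightarrow> z \<in> (\<Union>r. ball 0 r)" by blast
  qed
  ultimately show ?thesis by (metis holomorphic_on_UN_open open_ball)
qed

lemma gaf_series_0: "gaf_series c 0 = c 0"
  unfolding gaf_series_def using suminf_finite[of "{0}" "\<lambda>n. c n * (0 ^ n / of_real (sqrt (fact n)))"] by auto

text \<open>Tannery's theorem, applied to the majorants \<open>e k n\<close>, which no longer depend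
  on \<open>z\<close>.\<close>

lemma gaf_series_uniform_limit:
  assumes b: "\<And>k n. cmod (c k n) \<le> L * (real n + 1)" and lim: "\<And>n. (\<lambda>k. c k n) \<longlonglongrightarrow> d n"
    and d: "\<And>n. cmod (d n) \<le> L * (real n + 1)"
  shows "uniform_limit (cball 0 r) (\<lambda>k. gaf_series (c k)) (gaf_series d) sequentially"
proof -
  define e where "e k n = cmod (c k n - d n) * (\<bar>r\<bar> ^ n / sqrt (fact n))" for k n
  have e0: "0 \<le> e k n" for k n by (simp add: e_def)
  have eb: "e k n \<le> 2 * L * (real n + 1) * (\<bar>r\<bar> ^ n / sqrt (fact n))" for k n
    unfolding e_def
  proof (rule mult_right_mono)
    have "cmod (c k n - d n) \<le> cmod (c k n) + cmod (d n)" by (rule norm_triangle_ineq4)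
    also have "\<dots> \<le> L * (real n + 1) + L * (real n + 1)" by (intro add_mono b d)
    finally show "cmod (c k n - d n) \<le> 2 * L * (real n + 1)" by simp
  qed auto
  have sb: "summable (\<lambda>n. 2 * L * (real n + 1) * (\<bar>r\<bar> ^ n / sqrt (fact n)))"
    unfolding mult.assoc by (intro summable_mult gaf_weight_linear_summable) auto
  have se: "summable (e k)" for k
    by (rule summable_comparison_test'[OF sb, of 0]) (use e0 eb in auto)
  have "(\<lambda>k. suminf (e k)) \<longlonglongrightarrow> (\<Sum>n. 0)"
  proof -
    have ek: "(\<lambda>k. e k n) \<longlonglongrightarrow> 0" for n
    proof -
      have "(\<lambda>k. cmod (c k n - d n) * (\<bar>r\<bar> ^ n / sqrt (fact n))) \<longlonglongrightarrow> cmod (d n - d n) * (\<bar>r\<bar> ^ n / sqrt (fact n))"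
        by (intro tendsto_intros lim)
      then show ?thesis by (simp add: e_def)
    qed
    show ?thesis
      by (rule tannerys_theorem[OF ek _ sb, THEN conjunct2, THEN conjunct2])
         (use e0 eb in \<open>auto intro!: always_eventually\<close>)
  qed
  then have lim0: "(\<lambda>k. suminf (e k)) \<longlonglongrightarrow> 0" by simp
  show ?thesis
  proof (rule uniform_limitI)
    fix \<epsilon> :: real assume "\<epsilon> > 0"
    then have "\<forall>\<^sub>F k in sequentially. suminf (e k) < \<epsilon>" using order_tendstoD(2)[OF lim0] by simp
    then show "\<forall>\<^sub>F k in sequentially. \<forall>z\<in>cball 0 r. dist (gaf_series (c k) z) (gaf_series d z) < \<epsilon>"
    proof eventually_elim
      case (elim k)
      show ?case
      proof
        fix z :: complex assume z: "z \<in> cball 0 r"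
        let ?g = "\<lambda>n. (c k n - d n) * (z ^ n / of_real (sqrt (fact n)))"
        have g: "cmod (?g n) \<le> e k n" for n
          unfolding gaf_term_norm e_def using z by (intro mult_left_mono divide_right_mono power_mono) auto
        have gs: "summable (\<lambda>n. cmod (?g n))"
          by (rule summable_comparison_test'[OF se, of 0]) (use g in auto)
        have "?g sums (gaf_series (c k) z - gaf_series d z)"
          using sums_diff[OF gaf_series_sums[of "c k" L z, OF b] gaf_series_sums[of d L z, OF d]] by (simp only: left_diff_distrib)
        then have "gaf_series (c k) z - gaf_series d z = suminf ?g" by (simp add: sums_iff)
        then have "dist (gaf_series (c k) z) (gaf_series d z) \<le> (\<Sum>n. cmod (?g n))"
          unfolding dist_norm using summable_norm[OF gs] by simp
        also have "\<dots> \<le> suminf (e k)" by (rule suminf_le[OF g gs se])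
        finally show "dist (gaf_series (c k) z) (gaf_series d z) < \<epsilon>" using elim by simp
      qed
    qed
  qed
qed

text \<open>Without the growth bound the set would not be closed: huge coefficients at an index that
  tends to infinity create zeros but vanish in the coordinatewise limit.\<close>

definition overcrowded :: "real \<Rightarrow> nat \<Rightarrow> real \<Rightarrow> (nat \<Rightarrow> complex) set" where
  "overcrowded R N L = {c. (\<forall>n. cmod (c n) \<le> L * (real n + 1)) \<and> enat N \<le> zero_count (gaf_series c) (cball 0 R)}"

text \<open>On a set of uniformly bounded coefficient sequences, coordinatewise convergence is locally
  uniform convergence of the entire functions.\<close>

lemma closed_overcrowded:
  assumes "R > 0"
  shows "closed (overcrowded R N L)"
  unfolding closed_sequential_limits
proof (intro allI impI, elim conjE)
  fix c :: "nat \<Rightarrow> nat \<Rightarrow> complex" and d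
  assume c: "\<forall>k. c k \<in> overcrowded R N L" and lim: "c \<longlonglongrightarrow> d"
  have limn: "(\<lambda>k. c k n) \<longlonglongrightarrow> d n" for n
    by (rule continuous_on_tendsto_compose[OF continuous_on_product_coordinates[of n] lim]) auto
  have b: "cmod (c k n) \<le> L * (real n + 1)" for k n using c by (simp add: overcrowded_def)
  have d: "cmod (d n) \<le> L * (real n + 1)" for n
    by (rule LIMSEQ_le_const2[OF tendsto_norm[OF limn]]) (use b in auto)
  have "enat N \<le> zero_count (gaf_series d) (cball 0 R)"
    by (rule hurwitz_zero_count[OF gaf_series_holomorphic[OF d] assms gaf_series_holomorphic[OF b] gaf_series_uniform_limit[OF b limn d]])
       (use c in \<open>simp add: overcrowded_def\<close>)
  then show "d \<in> overcrowded R N L" using d by (simp add: overcrowded_def)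
qed

section \<open>The measurable event\<close>

lemma ou_coeff_norm:
  fixes B :: "nat \<Rightarrow> nat \<Rightarrow> real \<Rightarrow> 'a \<Rightarrow> real" and t \<omega> n
  defines "X j \<equiv> exp (- t / 2) * B n j (exp t) \<omega>"
  shows "cmod (ou_coeff B n t \<omega>) \<le> \<bar>X 1\<bar> + \<bar>X 2\<bar>" "\<bar>X 1\<bar> \<le> 2 * cmod (ou_coeff B n t \<omega>)"
proof -
  have eq: "ou_coeff B n t \<omega> = Complex (X 1 / sqrt 2) (X 2 / sqrt 2)"
    by (simp add: ou_coeff_def X_def complex_eq_iff)
  have s2: "1 \<le> sqrt 2" by simp
  have "\<bar>X j / sqrt 2\<bar> \<le> \<bar>X j\<bar>" for j
    using mult_left_mono[OF s2, of "\<bar>X j\<bar>"] by (simp add: abs_divide divide_le_eq)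
  moreover have "cmod (ou_coeff B n t \<omega>) \<le> \<bar>X 1 / sqrt 2\<bar> + \<bar>X 2 / sqrt 2\<bar>"
    using cmod_le[of "ou_coeff B n t \<omega>"] by (simp add: eq)
  ultimately show "cmod (ou_coeff B n t \<omega>) \<le> \<bar>X 1\<bar> + \<bar>X 2\<bar>"
    by (meson add_mono order_trans)
  have "\<bar>X 1 / sqrt 2\<bar> \<le> cmod (ou_coeff B n t \<omega>)"
    using abs_Re_le_cmod[of "ou_coeff B n t \<omega>"] by (simp add: eq)
  then have "\<bar>X 1\<bar> \<le> sqrt 2 * cmod (ou_coeff B n t \<omega>)" by (simp add: abs_divide divide_le_eq mult.commute)
  also have "\<dots> \<le> 2 * cmod (ou_coeff B n t \<omega>)" by (intro mult_right_mono real_le_lsqrt) auto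
  finally show "\<bar>X 1\<bar> \<le> 2 * cmod (ou_coeff B n t \<omega>)" .
qed

locale gaf = prob_space M for M :: "'a measure" +
  fixes B :: "nat \<Rightarrow> nat \<Rightarrow> real \<Rightarrow> 'a \<Rightarrow> real"
  assumes ibm: "independent_brownian_motions M B"
begin

lemma bm: "j \<in> {1, 2} \<Longrightarrow> brownian_motion M (B n j)"
  using ibm by unfold_locales (auto simp: independent_brownian_motions_def)

lemma indep_paths:
  "indep_vars (\<lambda>_. \<Pi>\<^sub>M t\<in>{0..}. borel) (\<lambda>(n, j) \<omega>. \<lambda>t\<in>{0..}. B n j t \<omega>) (UNIV \<times> {1, 2})"
  using ibm by (simp add: independent_brownian_motions_def)

text \<open>Collects the almost sure properties of the paths: continuity in time, and growth at most
  linear in \<open>n\<close>, uniformly on compact time intervals, which makes the series entire at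
  all times simultaneously.\<close>

definition regular :: "'a \<Rightarrow> bool" where
  "regular \<omega> \<longleftrightarrow> (\<forall>n. \<forall>j\<in>{1, 2}. continuous_on {0..} (\<lambda>t. B n j t \<omega>)) \<and>
    (\<forall>S :: nat. \<exists>K. \<forall>n. \<forall>j\<in>{1, 2}. \<forall>s\<in>{0..real S}. \<bar>B n j s \<omega>\<bar> \<le> K * (real n + 1))"

text \<open>Borel-Cantelli: path \<open>n\<close> oscillates by more than \<open>n + 1\<close> on a
  fixed interval with probability \<open>O((n + 1) ^ (-4))\<close>.\<close>

lemma AE_eventually_bounded:
  assumes j: "j \<in> {1, 2}" and S: "S > 0"
  shows "AE \<omega> in M. \<forall>\<^sub>F n in sequentially. \<forall>s\<in>{0..S}. \<bar>B n j s \<omega>\<bar> \<le> real n + 1"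
proof -
  define A where "A n = {\<omega> \<in> space M. \<not> brownian_motion.osc_le (B n j) 0 S (real n + 1) \<omega>}" for n
  have A: "A n \<in> events" for n
    using brownian_motion.osc_le_measurable[OF bm[OF j, of n], of 0 S "real n + 1"] S by (simp add: A_def)
  have le: "prob (A n) \<le> 150000 * S\<^sup>2 * (1 / real (Suc n) ^ 2)" for n
  proof -
    have "prob (A n) \<le> 150000 * S\<^sup>2 / (real n + 1) ^ 4"
      unfolding A_def by (rule brownian_motion.osc_le_bound[OF bm[OF j]]) (use S in auto)
    also have "\<dots> \<le> 150000 * S\<^sup>2 / (real n + 1) ^ 2"
      by (intro divide_left_mono power_increasing) auto
    finally show ?thesis by (simp add: add.commute)
  qed
  have "summable (\<lambda>n. 1 / real (Suc n) ^ 2)"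
    using inverse_squares_sums by (auto simp: sums_iff)
  then have sm: "summable (\<lambda>n. prob (A n))"
    by (rule summable_comparison_test'[OF summable_mult[of _ "150000 * S\<^sup>2"], of _ 0 "\<lambda>n. prob (A n)"])
       (use le in \<open>simp only: real_norm_def abs_of_nonneg[OF measure_nonneg]\<close>)
  have "AE \<omega> in M. \<forall>\<^sub>F n in sequentially. \<omega> \<in> space M - A n"
    by (rule borel_cantelli_AE1[OF A _ sm]) (simp add: emeasure_eq_measure)
  moreover have "AE \<omega> in M. \<forall>n. B n j 0 \<omega> = 0"
    unfolding AE_all_countable using brownian_motion.W_0[OF bm[OF j]] by blast
  moreover have "AE \<omega> in M. \<forall>n. continuous_on {0..} (\<lambda>t. B n j t \<omega>)"
    unfolding AE_all_countable using brownian_motion.W_continuous[OF bm[OF j]] by blast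
  ultimately show ?thesis
  proof eventually_elim
    case (elim \<omega>)
    from elim(1) show ?case
    proof eventually_elim
      case (elim n)
      then have o: "brownian_motion.osc_le (B n j) 0 S (real n + 1) \<omega>" by (simp add: A_def)
      show ?case
      proof
        fix s assume "s \<in> {0..S}"
        then show "\<bar>B n j s \<omega>\<bar> \<le> real n + 1"
          using brownian_motion.osc_le_everywhere[OF bm[OF j] _ _ o, of s] \<open>\<forall>n. B n j 0 \<omega> = 0\<close>
            \<open>\<forall>n. continuous_on {0..} (\<lambda>t. B n j t \<omega>)\<close> by simp
      qed
    qed
  qed
qed

lemma AE_regular: "AE \<omega> in M. regular \<omega>"
proof -
  have cont: "AE \<omega> in M. \<forall>n. continuous_on {0..} (\<lambda>t. B n j t \<omega>)" if "j \<in> {1, 2}" for j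
    unfolding AE_all_countable using brownian_motion.W_continuous[OF bm[OF that]] by blast
  have ev: "AE \<omega> in M. \<forall>S::nat. \<forall>\<^sub>F n in sequentially. \<forall>s\<in>{0..real (Suc S)}. \<bar>B n j s \<omega>\<bar> \<le> real n + 1" if "j \<in> {1, 2}" for j
    unfolding AE_all_countable using AE_eventually_bounded[OF that] by simp
  have c1: "AE \<omega> in M. \<forall>n. continuous_on {0..} (\<lambda>t. B n 1 t \<omega>)" by (rule cont) simp
  have c2: "AE \<omega> in M. \<forall>n. continuous_on {0..} (\<lambda>t. B n 2 t \<omega>)" by (rule cont) simp
  have e1: "AE \<omega> in M. \<forall>S::nat. \<forall>\<^sub>F n in sequentially. \<forall>s\<in>{0..real (Suc S)}. \<bar>B n 1 s \<omega>\<bar> \<le> real n + 1" by (rule ev) simp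
  have e2: "AE \<omega> in M. \<forall>S::nat. \<forall>\<^sub>F n in sequentially. \<forall>s\<in>{0..real (Suc S)}. \<bar>B n 2 s \<omega>\<bar> \<le> real n + 1" by (rule ev) simp
  show ?thesis using c1 c2 e1 e2
  proof eventually_elim
    case (elim \<omega>)
    have cont: "continuous_on {0..} (\<lambda>t. B n j t \<omega>)" if "j \<in> {1, 2}" for n j using elim that by auto
    have "\<exists>K. \<forall>n. \<forall>j\<in>{1, 2}. \<forall>s\<in>{0..real S}. \<bar>B n j s \<omega>\<bar> \<le> K * (real n + 1)" for S :: nat
    proof -
      have "\<forall>\<^sub>F n in sequentially. (\<forall>s\<in>{0..real (Suc S)}. \<bar>B n 1 s \<omega>\<bar> \<le> real n + 1) \<and> (\<forall>s\<in>{0..real (Suc S)}. \<bar>B n 2 s \<omega>\<bar> \<le> real n + 1)"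
        using elim(3,4) by (intro eventually_conj) auto
      then obtain n0 where n0: "\<And>n s. n \<ge> n0 \<Longrightarrow> s \<in> {0..real (Suc S)} \<Longrightarrow> \<bar>B n 1 s \<omega>\<bar> \<le> real n + 1 \<and> \<bar>B n 2 s \<omega>\<bar> \<le> real n + 1"
        unfolding eventually_sequentially by blast
      have "\<exists>b. \<forall>s\<in>{0..real S}. \<bar>B n j s \<omega>\<bar> \<le> b" if "j \<in> {1, 2}" for n j
      proof -
        have "compact ((\<lambda>s. B n j s \<omega>) ` {0..real S})"
          by (intro compact_continuous_image continuous_on_subset[OF cont[OF that]]) auto
        then have "bounded ((\<lambda>s. B n j s \<omega>) ` {0..real S})" by (rule compact_imp_bounded)
        then show ?thesis by (auto simp: bounded_iff)
      qed
      then have "\<forall>n j. \<exists>b. j \<in> {1, 2} \<longrightarrow> (\<forall>s\<in>{0..real S}. \<bar>B n j s \<omega>\<bar> \<le> b)" by blast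
      then obtain b where b: "\<And>n j s. j \<in> {1, 2} \<Longrightarrow> s \<in> {0..real S} \<Longrightarrow> \<bar>B n j s \<omega>\<bar> \<le> b n j"
        unfolding choice_iff by blast
      \<comment> \<open>The finitely many paths not covered by Borel-Cantelli are bounded by
        compactness of the time interval; \<open>K\<close> adds up their bounds.\<close>
      define K where "K = 1 + (\<Sum>n<n0. \<bar>b n 1\<bar> + \<bar>b n 2\<bar>)"
      have K1: "1 \<le> K" by (auto simp: K_def intro!: sum_nonneg)
      have "\<bar>B n j s \<omega>\<bar> \<le> K * (real n + 1)" if j: "j \<in> {1, 2}" and s: "s \<in> {0..real S}" for n j s
      proof (cases "n < n0")
        case True
        have "\<bar>B n j s \<omega>\<bar> \<le> \<bar>b n 1\<bar> + \<bar>b n 2\<bar>" using b[OF j s, of n] j by auto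
        also have "\<dots> \<le> (\<Sum>n<n0. \<bar>b n 1\<bar> + \<bar>b n 2\<bar>)" using True by (intro member_le_sum) auto
        also have "\<dots> \<le> K * 1" by (simp add: K_def)
        also have "\<dots> \<le> K * (real n + 1)" using K1 by (intro mult_left_mono) auto
        finally show ?thesis .
      next
        case False
        then have "\<bar>B n j s \<omega>\<bar> \<le> 1 * (real n + 1)" using n0[of n s] j s by auto
        also have "\<dots> \<le> K * (real n + 1)" using K1 by (intro mult_right_mono) auto
        finally show ?thesis .
      qed
      then show ?thesis by blast
    qed
    then show ?case using cont unfolding regular_def by blast
  qed
qed

lemma planar_gaf_series: "planar_gaf B t \<omega> = gaf_series (\<lambda>n. ou_coeff B n t \<omega>)"
  by (simp add: planar_gaf_def gaf_series_def fun_eq_iff)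

lemma regular_coeff_bound:
  assumes "regular \<omega>"
  obtains L where "\<And>n t. 0 \<le> t \<Longrightarrow> t \<le> T \<Longrightarrow> cmod (ou_coeff B n t \<omega>) \<le> real L * (real n + 1)"
proof -
  obtain S :: nat where S: "exp T \<le> real S" using real_arch_simple by blast
  obtain K where K: "\<And>n j s. j \<in> {1, 2} \<Longrightarrow> s \<in> {0..real S} \<Longrightarrow> \<bar>B n j s \<omega>\<bar> \<le> K * (real n + 1)"
    using assms unfolding regular_def by blast
  obtain L :: nat where L: "2 * K \<le> real L" using real_arch_simple by blast
  show ?thesis
  proof (rule that[of L])
    fix n t assume t: "0 \<le> t" "t \<le> (T :: real)"
    have "exp t \<le> real S" using t S by (meson exp_le_cancel_iff order_trans)
    then have "\<bar>B n j (exp t) \<omega>\<bar> \<le> K * (real n + 1)" if "j \<in> {1, 2}" for j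
      using K[OF that, of "exp t" n] by simp
    moreover have "\<bar>exp (- t / 2) * b\<bar> \<le> \<bar>b\<bar>" for b
      using t by (simp add: abs_mult mult_left_le_one_le)
    ultimately have "\<bar>exp (- t / 2) * B n j (exp t) \<omega>\<bar> \<le> K * (real n + 1)" if "j \<in> {1, 2}" for j
      using that order_trans by blast
    from this[of 1] this[of 2] have "cmod (ou_coeff B n t \<omega>) \<le> 2 * K * (real n + 1)"
      using ou_coeff_norm(1)[of B n t \<omega>] by simp
    also have "\<dots> \<le> real L * (real n + 1)" using L by (intro mult_right_mono) auto
    finally show "cmod (ou_coeff B n t \<omega>) \<le> real L * (real n + 1)" .
  qed
qed

lemma ou_coeff_measurable [measurable]: "ou_coeff B n t \<in> borel_measurable M"
proof -
  have [measurable]: "B n 1 (exp t) \<in> borel_measurable M" "B n 2 (exp t) \<in> borel_measurable M"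
    using brownian_motion.W_measurable[OF bm] by auto
  show ?thesis unfolding ou_coeff_def[abs_def] by measurable
qed

text \<open>Countable intersections and unions of preimages of closed sets: a measurable substitute
  for the event with all real times. The bound \<open>L\<close> may depend on the time here.\<close>

definition rational_event :: "real \<Rightarrow> real \<Rightarrow> nat \<Rightarrow> 'a set" where
  "rational_event T R N = {\<omega> \<in> space M. \<forall>q. of_rat q \<in> {0..T} \<longrightarrow> (\<exists>L::nat. (\<lambda>n. ou_coeff B n (of_rat q) \<omega>) \<in> overcrowded R N (real L))}"

lemma rational_event_measurable:
  assumes "R > 0" shows "rational_event T R N \<in> events"
proof -
  have [measurable]: "(\<lambda>\<omega> n. ou_coeff B n t \<omega>) \<in> measurable M borel" for t
    by (rule measurable_coordinatewise_then_product) (rule ou_coeff_measurable)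
  have [measurable]: "overcrowded R N L \<in> sets borel" for L
    using closed_overcrowded[OF assms] by (rule borel_closed)
  show ?thesis unfolding rational_event_def by measurable
qed

text \<open>A regular path has one bound \<open>L\<close> for all of \<open>[0, T]\<close>, so all
  coefficient sequences at rational times lie in a single closed set. Approximating a real time from
  the left stays inside \<open>[0, T]\<close>, and time 0 is itself rational.\<close>

lemma many_zeros_event_rational:
  assumes R: "R > 0" and reg: "regular \<omega>" and \<omega>: "\<omega> \<in> space M"
  shows "\<omega> \<in> many_zeros_event M B T R N \<longleftrightarrow> \<omega> \<in> rational_event T R N"
proof -
  obtain L where L: "\<And>n t. 0 \<le> t \<Longrightarrow> t \<le> T \<Longrightarrow> cmod (ou_coeff B n t \<omega>) \<le> real L * (real n + 1)"
    using regular_coeff_bound[OF reg] by blast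
  let ?P = "\<lambda>t. (\<lambda>n. ou_coeff B n t \<omega>) \<in> overcrowded R N (real L)"
  have P: "?P t \<longleftrightarrow> enat N \<le> zero_count (planar_gaf B t \<omega>) (cball 0 R)" if "0 \<le> t" "t \<le> T" for t
    using L[OF that] by (simp add: overcrowded_def planar_gaf_series)
  show ?thesis
  proof
    assume "\<omega> \<in> many_zeros_event M B T R N"
    then have "?P t" if "0 \<le> t" "t \<le> T" for t
      using P[OF that] that by (auto simp: many_zeros_event_def)
    then show "\<omega> \<in> rational_event T R N"
      using \<omega> unfolding rational_event_def by (auto intro!: exI[of _ L])
  next
    assume r: "\<omega> \<in> rational_event T R N"
    have rat: "?P (of_rat q)" if q: "0 \<le> real_of_rat q" "real_of_rat q \<le> T" for q
    proof -
      have "\<exists>L'::nat. (\<lambda>n. ou_coeff B n (of_rat q) \<omega>) \<in> overcrowded R N (real L')"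
        using r q unfolding rational_event_def by simp
      then show ?thesis using L[OF q] by (auto simp: overcrowded_def)
    qed
    have "?P t" if t: "0 \<le> t" "t \<le> T" for t
    proof (cases "t = 0")
      case True
      then show ?thesis using rat[of 0] t by simp
    next
      case False
      have "\<exists>q. max 0 (t - 1 / real (Suc k)) < of_rat q \<and> of_rat q < t" for k
        using False t by (intro of_rat_dense) auto
      then obtain q where q: "\<And>k. max 0 (t - 1 / real (Suc k)) < of_rat (q k)" "\<And>k. of_rat (q k) < t" by metis
      have qlim: "(\<lambda>k. of_rat (q k)) \<longlonglongrightarrow> t"
      proof (rule real_tendsto_sandwich)
        show "\<forall>\<^sub>F k in sequentially. t - 1 / real (Suc k) \<le> of_rat (q k)"
          using q(1) by (auto intro!: always_eventually less_imp_le)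
        show "\<forall>\<^sub>F k in sequentially. of_rat (q k) \<le> t"
          using q(2) by (auto intro!: always_eventually less_imp_le)
        have "(\<lambda>k. t - 1 / real (Suc k)) \<longlonglongrightarrow> t - 0"
          using LIMSEQ_inverse_real_of_nat by (intro tendsto_diff tendsto_const) (simp add: inverse_eq_divide)
        then show "(\<lambda>k. t - 1 / real (Suc k)) \<longlonglongrightarrow> t" by simp
      qed simp
      have cont: "continuous_on UNIV (\<lambda>t. ou_coeff B n t \<omega>)" for n
      proof -
        have c: "continuous_on UNIV (\<lambda>t. B n j (exp t) \<omega>)" if "j \<in> {1, 2}" for j
        proof (rule continuous_on_compose2[of "{0..}" "\<lambda>t. B n j t \<omega>" UNIV exp])
          show "continuous_on {0..} (\<lambda>t. B n j t \<omega>)" using reg that unfolding regular_def by blast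
          show "continuous_on UNIV (exp :: real \<Rightarrow> real)" by (intro continuous_intros)
        qed auto
        show ?thesis unfolding ou_coeff_def
          by (intro continuous_on_mult continuous_on_add continuous_on_of_real continuous_on_exp continuous_on_divide
              continuous_on_minus continuous_on_id continuous_on_const c) auto
      qed
      have "(\<lambda>k n. ou_coeff B n (of_rat (q k)) \<omega>) \<longlonglongrightarrow> (\<lambda>n. ou_coeff B n t \<omega>)"
        by (rule continuous_on_tendsto_compose[OF continuous_on_coordinatewise_then_product[OF cont] qlim]) auto
      moreover have "?P (of_rat (q k))" for k
        using q[of k] t by (intro rat) auto
      ultimately show ?thesis
        using closed_overcrowded[OF R, of N "real L", unfolded closed_sequential_limits, rule_format,
          of "\<lambda>k n. ou_coeff B n (of_rat (q k)) \<omega>" "\<lambda>n. ou_coeff B n t \<omega>"] by blast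
    qed
    then show "\<omega> \<in> many_zeros_event M B T R N"
      using P \<omega> by (auto simp: many_zeros_event_def)
  qed
qed

text \<open>The two events agree on regular paths, hence up to a null set; this also shows that the
  original event is measurable in the completion.\<close>

lemma many_zeros_prob_eq:
  assumes R: "R > 0"
  shows "many_zeros_prob M B T R N = prob (rational_event T R N)"
proof -
  note m = rational_event_measurable[OF R, of T N]
  have "AE \<omega> in M. \<omega> \<in> rational_event T R N \<longleftrightarrow> \<omega> \<in> many_zeros_event M B T R N"
    using AE_regular AE_space by eventually_elim (use many_zeros_event_rational[OF R] in auto)
  then have ae: "AE \<omega> in completion M. \<omega> \<in> rational_event T R N \<longleftrightarrow> \<omega> \<in> many_zeros_event M B T R N"
    by (rule AE_completion)
  have m': "many_zeros_event M B T R N \<in> sets (completion M)"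
    by (rule completion.in_sets_AE[OF ae]) (use m in \<open>auto simp: many_zeros_event_def\<close>)
  have "measure (completion M) (rational_event T R N) = measure (completion M) (many_zeros_event M B T R N)"
    by (rule measure_eq_AE[OF ae]) (use m m' in auto)
  then show ?thesis using m by (simp add: many_zeros_prob_def)
qed

end

section \<open>The upper bound\<close>

text \<open>The factor \<open>(R / (r - R)) ^ N\<close> of \<open>zero_count_value_bound\<close> at
  \<open>r = big_radius R N\<close>.\<close>

definition jensen_factor :: "real \<Rightarrow> nat \<Rightarrow> real" where
  "jensen_factor R N = (R / ((R + 1) * sqrt (real N))) ^ N"

text \<open>Order \<open>sqrt N\<close> balances the gain \<open>r ^ (- N)\<close> against the
  growth \<open>exp (O(r\<^sup>2))\<close> of the weights. The factor \<open>R + 1\<close> keeps the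
  base of \<open>jensen_factor\<close> at most \<open>R / (R + 1)\<close> for every
  \<open>N >= 1\<close>.\<close>

definition big_radius :: "real \<Rightarrow> nat \<Rightarrow> real" where
  "big_radius R N = R + (R + 1) * sqrt (real N)"

text \<open>The weights \<open>n + 3\<close> are the thresholds \<open>3 + k\<close> of the Chernoff
  bound.\<close>

definition weight_sum :: "real \<Rightarrow> real" where
  "weight_sum r = (\<Sum>n. (real n + 3) * (r ^ n / sqrt (fact n)))"

text \<open>Chosen so that the window for \<open>B 0 1\<close> has half-width
  \<open>upper_scale R N / (2 * sqrt h)\<close>. The constant is \<open>64 = 16 * 2 * 2\<close>:
  from the level \<open>K\<close> of good times, from passing from modulus to a real component, and
  from the 2 in this formula.\<close>

definition upper_scale :: "real \<Rightarrow> nat \<Rightarrow> real" where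
  "upper_scale R N = 64 * (R + 1) * jensen_factor R N * weight_sum (big_radius R N)"

lemma weight_sum_ge_3:
  assumes "r \<ge> 0" shows "weight_sum r \<ge> 3"
proof -
  have "(\<Sum>n\<in>{0}. (real n + 3) * (r ^ n / sqrt (fact n))) \<le> weight_sum r"
    unfolding weight_sum_def using assms by (intro sum_le_suminf gaf_weight_linear_summable) auto
  then show ?thesis by simp
qed

text \<open>The sum on the right omits the constant term, which makes it independent of the left-hand
  side; this costs the factor \<open>R + 1\<close>.\<close>

lemma entire_zeros_imp_small_constant_term:
  assumes R: "R > 0" and N: "N \<ge> 1" and b: "\<And>n. cmod (c n) \<le> L * (real n + 1)"
    and z: "enat N \<le> zero_count (gaf_series c) (cball 0 R)"
  shows "cmod (c 0) \<le> (R + 1) * jensen_factor R N *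
    (\<Sum>n. cmod (c (Suc n)) * (big_radius R N ^ Suc n / sqrt (fact (Suc n))))"
proof -
  define r \<rho> where "r = big_radius R N" and "\<rho> = jensen_factor R N"
  define S where "S = (\<Sum>n. cmod (c (Suc n)) * (r ^ Suc n / sqrt (fact (Suc n))))"
  have sN: "sqrt (real N) \<ge> 1" using N by simp
  have rR: "r - R = (R + 1) * sqrt (real N)" by (simp add: r_def big_radius_def)
  have "(R + 1) * 1 \<le> (R + 1) * sqrt (real N)" using R sN by (intro mult_left_mono) auto
  then have r: "r \<ge> 2 * R" "R + 1 \<le> (R + 1) * sqrt (real N)" using rR by auto
  have sm: "summable (\<lambda>n. cmod (c n) * (r ^ n / sqrt (fact n)))" by (rule gaf_series_summable[OF b])
  have max: "cmod (gaf_series c z) \<le> cmod (c 0) + S" if "cmod z = r" for z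
  proof -
    have g: "cmod (c n * (z ^ n / of_real (sqrt (fact n)))) = cmod (c n) * (r ^ n / sqrt (fact n))" for n
      by (simp only: gaf_term_norm that)
    have "cmod (gaf_series c z) \<le> (\<Sum>n. cmod (c n) * (r ^ n / sqrt (fact n)))"
      unfolding gaf_series_def using summable_norm[of "\<lambda>n. c n * (z ^ n / of_real (sqrt (fact n)))"] sm by (simp only: g)
    also have "\<dots> = cmod (c 0) + S" unfolding S_def using suminf_split_head[OF sm] by simp
    finally show ?thesis .
  qed
  have "cmod (gaf_series c 0) \<le> (R / (r - R)) ^ N * (cmod (c 0) + S)"
    by (rule zero_count_value_bound[OF gaf_series_holomorphic[OF b] R r(1) z max])
  then have 1: "cmod (c 0) \<le> \<rho> * (cmod (c 0) + S)"
    by (simp add: gaf_series_0 rR \<rho>_def jensen_factor_def)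
  \<comment> \<open>Since \<open>\<rho>\<close> is at most \<open>R / (R + 1)\<close>, the term
    \<open>\<rho> * cmod (c 0)\<close> can be moved to the left-hand side.\<close>
  have base: "0 \<le> R / ((R + 1) * sqrt (real N))" "R / ((R + 1) * sqrt (real N)) \<le> R / (R + 1)"
    using R r by (auto intro!: divide_left_mono)
  have "R / (R + 1) \<le> 1" using R by simp
  with base have "\<rho> \<le> (R / ((R + 1) * sqrt (real N))) ^ 1"
    unfolding \<rho>_def jensen_factor_def using N by (intro power_decreasing) auto
  with base have \<rho>: "\<rho> \<le> R / (R + 1)" by simp
  have "1 / (R + 1) \<le> 1 - \<rho>" using \<rho> R by (simp add: field_simps)
  then have "1 / (R + 1) * cmod (c 0) \<le> (1 - \<rho>) * cmod (c 0)" by (intro mult_right_mono) auto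
  also have "\<dots> \<le> \<rho> * S" using 1 by (simp add: algebra_simps)
  finally show ?thesis using R by (simp add: field_simps S_def r_def \<rho>_def)
qed

text \<open>Markov's inequality for counting: if the mean is at most \<open>K / 2\<close>, at most
  half of the terms exceed \<open>K\<close>.\<close>

lemma card_large_terms:
  fixes f :: "nat \<Rightarrow> real"
  assumes nn: "\<And>i. i < n \<Longrightarrow> f i \<ge> 0" and K: "K > 0" and s: "(\<Sum>i<n. f i) \<le> real n * (K / 2)"
  shows "real n / 2 \<le> real (card {i \<in> {..<n}. f i \<le> K})"
proof -
  define G where "G = {i \<in> {..<n}. f i \<le> K}"
  have "real (card ({..<n} - G)) * K \<le> (\<Sum>i\<in>{..<n} - G. f i)"
    by (rule sum_bounded_below) (auto simp: G_def)
  also have "\<dots> \<le> (\<Sum>i<n. f i)" by (rule sum_mono2) (use nn in auto)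
  also note s
  finally have "real (card ({..<n} - G)) * K \<le> real n / 2 * K" by simp
  then have "real (card ({..<n} - G)) \<le> real n / 2" using K by simp
  moreover have "G \<subseteq> {..<n}" by (auto simp: G_def)
  then have "card ({..<n} - G) = n - card G" "card G \<le> n"
    using card_mono[of "{..<n}" G] card_Diff_subset[of G "{..<n}"] finite_subset[of G "{..<n}"] by auto
  ultimately have "real n / 2 \<le> real (card G)" by (simp add: of_nat_diff)
  then show ?thesis by (simp only: G_def)
qed

section \<open>Sampling the coefficients at grid times\<close>

context gaf begin

abbreviation grid :: "nat \<Rightarrow> nat \<Rightarrow> real \<Rightarrow> nat \<Rightarrow> 'a \<Rightarrow> real" where
  "grid k j h i \<omega> \<equiv> exp (- (real i * h) / 2) * B k j (exp (real i * h)) \<omega>"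

text \<open>A union over all coefficients of positive index. The threshold grows with the index, so
  that the probabilities form a series dominated by a geometric one; the slower-than-exponential
  growth is harmless against the weights \<open>r ^ k / sqrt (fact k)\<close>.\<close>

definition exceptional :: "real \<Rightarrow> nat \<Rightarrow> 'a set" where
  "exceptional h n = {\<omega> \<in> space M. \<exists>k. \<exists>j\<in>{1, 2}. (\<Sum>i<n. \<bar>grid (Suc k) j h i \<omega>\<bar>) \<ge> 4 / sqrt h * (real n * (3 + real (Suc k)))}"

lemma grid_measurable [measurable]: "j \<in> {1, 2} \<Longrightarrow> (\<lambda>\<omega>. grid k j h i \<omega>) \<in> borel_measurable M"
proof -
  assume "j \<in> {1, 2}"
  from brownian_motion.W_measurable[OF bm[OF this], of "exp (real i * h)" k]
  have [measurable]: "B k j (exp (real i * h)) \<in> borel_measurable M" by simp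
  show ?thesis by measurable
qed

lemma exceptional_bound:
  assumes h: "0 < h" "h \<le> 1" and n: "n \<ge> 1"
  shows "exceptional h n \<in> events" "prob (exceptional h n) \<le> 4 * exp (1 / (2 * h)) * exp (- real n)"
proof -
  define A where "A k j = {\<omega> \<in> space M. (\<Sum>i<n. \<bar>grid (Suc k) j h i \<omega>\<bar>) \<ge> 4 / sqrt h * (real n * (3 + real (Suc k)))}" for k j
  have A: "A k j \<in> events" if "j \<in> {1, 2}" for k j
  proof -
    have [measurable]: "(\<lambda>\<omega>. grid (Suc k) j h i \<omega>) \<in> borel_measurable M" for i by (rule grid_measurable[OF that])
    show ?thesis unfolding A_def by measurable
  qed
  have eq: "exceptional h n = (\<Union>k. A k 1 \<union> A k 2)"
    by (auto simp: exceptional_def A_def)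
  show "exceptional h n \<in> events" unfolding eq using A by auto
  define E where "E = exp (1 / (2 * h))"
  have Ab: "prob (A k j) \<le> 2 * E * (exp (- real n) * (1 / 2) ^ Suc k)" if "j \<in> {1, 2}" for k j
  proof -
    have "prob (A k j) \<le> 2 * E * exp (- (real n * (1 + real (Suc k))))"
      unfolding A_def E_def by (rule brownian_motion.ou_sum_tail[OF bm[OF that] h])
    also have "exp (- (real n * (1 + real (Suc k)))) = exp (- real n) * exp (- real n) ^ Suc k"
      by (simp add: exp_of_nat_mult[symmetric] exp_add[symmetric] algebra_simps)
    also have "\<dots> \<le> exp (- real n) * (1 / 2) ^ Suc k"
    proof -
      have "2 \<le> exp (1::real)" using exp_ge_add_one_self[of 1] by simp
      also have "\<dots> \<le> exp (real n)" using n by simp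
      finally have "exp (- real n) \<le> 1 / 2" by (simp add: exp_minus inverse_eq_divide frac_le)
      then show ?thesis by (intro mult_left_mono power_mono) auto
    qed
    finally show ?thesis by (simp add: E_def)
  qed
  let ?c = "\<lambda>k. 2 * E * exp (- real n) * (1 / 2) ^ k"
  have Ak: "prob (A k 1 \<union> A k 2) \<le> ?c k" for k
  proof -
    have "prob (A k 1 \<union> A k 2) \<le> prob (A k 1) + prob (A k 2)" by (rule measure_Un_le) (use A in auto)
    also have "\<dots> \<le> 2 * E * (exp (- real n) * (1 / 2) ^ Suc k) + 2 * E * (exp (- real n) * (1 / 2) ^ Suc k)"
      by (intro add_mono Ab) auto
    finally show ?thesis by simp
  qed
  have cs: "?c sums (2 * E * exp (- real n) * 2)"
    using sums_mult[OF geometric_sums[of "1/2::real"], of "2 * E * exp (- real n)"] by simp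
  have sm: "summable (\<lambda>k. prob (A k 1 \<union> A k 2))"
    by (rule summable_comparison_test'[OF sums_summable[OF cs], of 0])
       (use Ak in \<open>simp only: real_norm_def abs_of_nonneg[OF measure_nonneg]\<close>)
  have "prob (exceptional h n) \<le> (\<Sum>k. prob (A k 1 \<union> A k 2))"
    unfolding eq by (rule finite_measure_subadditive_countably[OF _ sm]) (use A in auto)
  also have "\<dots> \<le> (\<Sum>k. ?c k)" by (rule suminf_le[OF Ak sm sums_summable[OF cs]])
  also have "\<dots> = 4 * E * exp (- real n)" using cs by (simp add: sums_iff)
  finally show "prob (exceptional h n) \<le> 4 * exp (1 / (2 * h)) * exp (- real n)" by (simp add: E_def)
qed

text \<open>Stated for an arbitrary process on an arbitrary space, so that it can also be evaluated
  on the space of paths, where it visibly depends on the coefficients of positive index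
  only.\<close>

definition rest :: "(nat \<Rightarrow> nat \<Rightarrow> real \<Rightarrow> 'b \<Rightarrow> real) \<Rightarrow> real \<Rightarrow> real \<Rightarrow> 'b \<Rightarrow> real" where
  "rest B' r t \<omega> = (\<Sum>k. cmod (ou_coeff B' (Suc k) t \<omega>) * (r ^ Suc k / sqrt (fact (Suc k))))"

lemma rest_summable:
  assumes "regular \<omega>" "t \<ge> 0"
  shows "summable (\<lambda>k. cmod (ou_coeff B (Suc k) t \<omega>) * (r ^ Suc k / sqrt (fact (Suc k))))"
proof -
  obtain L where L: "\<And>k s. 0 \<le> s \<Longrightarrow> s \<le> t \<Longrightarrow> cmod (ou_coeff B k s \<omega>) \<le> real L * (real k + 1)"
    using regular_coeff_bound[OF assms(1)] by blast
  have "summable (\<lambda>k. cmod (ou_coeff B k t \<omega>) * (r ^ k / sqrt (fact k)))"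
    by (rule gaf_series_summable[where L = "real L"], rule L) (use assms in auto)
  then show ?thesis using summable_Suc_iff[of "\<lambda>k. cmod (ou_coeff B k t \<omega>) * (r ^ k / sqrt (fact k))"] by blast
qed

lemma rest_nonneg:
  assumes "regular \<omega>" "r \<ge> 0" "t \<ge> 0"
  shows "rest B r t \<omega> \<ge> 0"
  unfolding rest_def by (rule suminf_nonneg[OF rest_summable]) (use assms in auto)

text \<open>Summing over times before summing over coefficients lets the bound for each single
  coefficient apply; \<open>8 = 4 + 4\<close> accounts for the two real components.\<close>

lemma rest_sum_bound:
  assumes h: "0 < h" and r: "r \<ge> 0" and reg: "regular \<omega>" and \<omega>: "\<omega> \<in> space M" "\<omega> \<notin> exceptional h n"
  shows "(\<Sum>i<n. rest B r (real i * h) \<omega>) \<le> real n * (8 / sqrt h * weight_sum r)"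
proof -
  define w where "w k = r ^ k / sqrt (fact k)" for k :: nat
  have w: "w k \<ge> 0" for k using r by (simp add: w_def)
  define a where "a i k = cmod (ou_coeff B k (real i * h) \<omega>)" for i k
  have sm: "summable (\<lambda>k. a i (Suc k) * w (Suc k))" for i
    unfolding a_def w_def by (rule rest_summable[OF reg]) (use h in simp)
  have le: "(\<Sum>i<n. a i (Suc k) * w (Suc k)) \<le> real n * (8 / sqrt h) * ((real (Suc k) + 3) * w (Suc k))" for k
  proof -
    have X: "(\<Sum>i<n. \<bar>grid (Suc k) j h i \<omega>\<bar>) \<le> 4 / sqrt h * (real n * (3 + real (Suc k)))" if "j \<in> {1, 2}" for j
    proof -
      have "\<not> 4 / sqrt h * (real n * (3 + real (Suc k))) \<le> (\<Sum>i<n. \<bar>grid (Suc k) j h i \<omega>\<bar>)"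
        using \<omega> that unfolding exceptional_def by blast
      then show ?thesis by simp
    qed
    have "(\<Sum>i<n. a i (Suc k)) \<le> (\<Sum>i<n. \<bar>grid (Suc k) 1 h i \<omega>\<bar> + \<bar>grid (Suc k) 2 h i \<omega>\<bar>)"
      unfolding a_def by (intro sum_mono ou_coeff_norm)
    also have "\<dots> \<le> 4 / sqrt h * (real n * (3 + real (Suc k))) + 4 / sqrt h * (real n * (3 + real (Suc k)))"
      unfolding sum.distrib by (intro add_mono X) auto
    finally have "(\<Sum>i<n. a i (Suc k)) \<le> real n * (8 / sqrt h) * (real (Suc k) + 3)" by (simp add: algebra_simps add_divide_distrib)
    from mult_right_mono[OF this w[of "Suc k"]] show ?thesis by (simp only: sum_distrib_right mult.assoc)
  qed
  have ws: "summable (\<lambda>k. (real k + 3) * w k)" unfolding w_def by (rule gaf_weight_linear_summable[OF r])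
  have ws': "summable (\<lambda>k. (real (Suc k) + 3) * w (Suc k))" using ws summable_Suc_iff[of "\<lambda>k. (real k + 3) * w k"] by simp
  have "(\<Sum>i<n. rest B r (real i * h) \<omega>) = (\<Sum>k. \<Sum>i<n. a i (Suc k) * w (Suc k))"
    unfolding rest_def a_def[symmetric] w_def[symmetric] by (rule suminf_sum[symmetric]) (use sm in auto)
  also have "\<dots> \<le> (\<Sum>k. real n * (8 / sqrt h) * ((real (Suc k) + 3) * w (Suc k)))"
    by (rule suminf_le[OF le]) (use sm ws' in \<open>auto intro!: summable_sum summable_mult simp del: of_nat_Suc\<close>)
  also have "\<dots> = real n * (8 / sqrt h) * (\<Sum>k. (real (Suc k) + 3) * w (Suc k))"
    by (rule suminf_mult[OF ws'])
  also have "\<dots> \<le> real n * (8 / sqrt h) * weight_sum r"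
    using suminf_split_head[OF ws] w[of 0] h by (intro mult_left_mono) (auto simp: weight_sum_def w_def)
  finally show ?thesis by (simp only: mult.assoc)
qed

text \<open>The event is split according to the value \<open>H\<close> of \<open>G\<close>. For each
  \<open>H\<close>, independence factorizes the probability and \<open>ou_confined\<close> bounds
  one factor uniformly; the other factors add up to at most 1, so the number of subsets
  \<open>H\<close> does not enter.\<close>

lemma confined_given_rest:
  fixes n :: nat and r K h x d :: real
  assumes h: "0 < h" and x: "x \<ge> 0" "d \<le> x * sqrt (1 - exp (- h))"
  defines "G \<equiv> \<lambda>\<omega>. {i \<in> {..<n}. rest B r (real i * h) \<omega> \<le> K}" and "q \<equiv> normal_density 0 1 (x + 1)"
  assumes q: "q \<le> 1"
  shows "prob {\<omega> \<in> space M. real n / 2 \<le> real (card (G \<omega>)) \<and> (\<forall>i\<in>G \<omega>. \<bar>grid 0 1 h i \<omega>\<bar> \<le> d)} \<le> exp (- (q * (real n / 2 - 1)))"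
    "{\<omega> \<in> space M. real n / 2 \<le> real (card (G \<omega>)) \<and> (\<forall>i\<in>G \<omega>. \<bar>grid 0 1 h i \<omega>\<bar> \<le> d)} \<in> events"
proof -
  define PS where "PS = (\<Pi>\<^sub>M t\<in>{0::real..}. borel :: real measure)"
  define Y where "Y = (\<lambda>(n, j) \<omega>. \<lambda>t\<in>{0..}. B n j t \<omega>)"
  define I0 :: "(nat \<times> nat) set" where "I0 = {(0, 1)}"
  define I1 :: "(nat \<times> nat) set" where "I1 = {(k, j). k \<ge> 1 \<and> j \<in> {1, 2}}"
  have ind: "indep_vars (\<lambda>_. PS) Y (UNIV \<times> {1, 2})" using indep_paths by (simp add: PS_def Y_def)
  let ?M0 = "\<Pi>\<^sub>M i\<in>I0. PS" and ?M1 = "\<Pi>\<^sub>M i\<in>I1. PS"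
  let ?Y0 = "\<lambda>\<omega>. \<lambda>i\<in>I0. Y i \<omega>" and ?Y1 = "\<lambda>\<omega>. \<lambda>i\<in>I1. Y i \<omega>"
  have iv: "indep_var ?M0 ?Y0 ?M1 ?Y1"
    by (rule indep_var_restrict[OF ind]) (auto simp: I0_def I1_def)
  have rv: "?Y0 \<in> measurable M ?M0" "?Y1 \<in> measurable M ?M1"
    using indep_var_rv1[OF iv] indep_var_rv2[OF iv] by auto
  \<comment> \<open>The canonical process on the space of paths, so that \<open>rest B'\<close> is \<open>rest B\<close> as a function of the
    paths.\<close>
  define B' :: "nat \<Rightarrow> nat \<Rightarrow> real \<Rightarrow> (nat \<times> nat \<Rightarrow> real \<Rightarrow> real) \<Rightarrow> real" where "B' = (\<lambda>n j t y. y (n, j) t)"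
  have B': "B' k j t \<in> borel_measurable (\<Pi>\<^sub>M i\<in>I. PS)" if "(k, j) \<in> I" "t \<ge> 0" for k j t I
  proof -
    have "(\<lambda>y. y (k, j)) \<in> measurable (\<Pi>\<^sub>M i\<in>I. PS) PS" by (rule measurable_component_singleton[OF that(1)])
    moreover have "(\<lambda>p. p t) \<in> borel_measurable PS" unfolding PS_def using that by (intro measurable_component_singleton) auto
    ultimately show ?thesis unfolding B'_def by (rule measurable_compose)
  qed
  define G' where "G' y = {i \<in> {..<n}. rest B' r (real i * h) y \<le> K}" for y
  define E' where "E' H y \<longleftrightarrow> (\<forall>i\<in>H. \<bar>exp (- (real i * h) / 2) * B' 0 1 (exp (real i * h)) y\<bar> \<le> d)" for H y
  have G: "G' (?Y1 \<omega>) = G \<omega>" for \<omega>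
    by (simp add: G'_def G_def rest_def ou_coeff_def B'_def Y_def I1_def)
  have E: "E' H (?Y0 \<omega>) \<longleftrightarrow> (\<forall>i\<in>H. \<bar>grid 0 1 h i \<omega>\<bar> \<le> d)" for H \<omega>
    by (simp add: E'_def B'_def Y_def I0_def)
  have [measurable]: "rest B' r t \<in> borel_measurable ?M1" for t
  proof -
    have [measurable]: "B' (Suc k) 1 (exp t) \<in> borel_measurable ?M1" "B' (Suc k) 2 (exp t) \<in> borel_measurable ?M1" for k
      by (auto intro!: B' simp: I1_def)
    show ?thesis unfolding rest_def[abs_def] ou_coeff_def by measurable
  qed
  have mG: "{y \<in> space ?M1. G' y = H} \<in> sets ?M1" for H
  proof (cases "H \<subseteq> {..<n}")
    case True
    have "{y \<in> space ?M1. G' y = H} = {y \<in> space ?M1. \<forall>i\<in>{..<n}. rest B' r (real i * h) y \<le> K \<longleftrightarrow> i \<in> H}"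
      using True by (auto simp: G'_def)
    also have "\<dots> \<in> sets ?M1" by measurable
    finally show ?thesis .
  next
    case False
    then have "{y \<in> space ?M1. G' y = H} = {}" by (auto simp: G'_def)
    then show ?thesis by (simp only: sets.empty_sets)
  qed
  have mE: "{y \<in> space ?M0. E' H y} \<in> sets ?M0" if "finite H" for H
  proof -
    have [measurable]: "B' 0 1 (exp t) \<in> borel_measurable ?M0" for t by (rule B') (auto simp: I0_def)
    show ?thesis unfolding E'_def by (intro sets.sets_Collect_finite_All that) measurable
  qed
  define F where "F H = {\<omega> \<in> space M. G \<omega> = H \<and> (\<forall>i\<in>H. \<bar>grid 0 1 h i \<omega>\<bar> \<le> d)}" for H
  have sp: "?Y0 \<omega> \<in> space ?M0" "?Y1 \<omega> \<in> space ?M1" if "\<omega> \<in> space M" for \<omega>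
    using measurable_space[OF rv(1) that] measurable_space[OF rv(2) that] by auto
  have pre: "?Y1 -` {y \<in> space ?M1. G' y = H} \<inter> space M = {\<omega> \<in> space M. G \<omega> = H}"
    "?Y0 -` {y \<in> space ?M0. E' H y} \<inter> space M = {\<omega> \<in> space M. \<forall>i\<in>H. \<bar>grid 0 1 h i \<omega>\<bar> \<le> d}" for H
    using sp unfolding E[symmetric] G[symmetric] by auto
  have m1: "{\<omega> \<in> space M. G \<omega> = H} \<in> events" for H
    using measurable_sets[OF rv(2) mG[of H]] unfolding pre .
  have m2: "{\<omega> \<in> space M. \<forall>i\<in>H. \<bar>grid 0 1 h i \<omega>\<bar> \<le> d} \<in> events" if "finite H" for H
    using measurable_sets[OF rv(1) mE[OF that]] unfolding pre .
  have mF: "F H \<in> events" if "finite H" for H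
  proof -
    have "F H = {\<omega> \<in> space M. G \<omega> = H} \<inter> {\<omega> \<in> space M. \<forall>i\<in>H. \<bar>grid 0 1 h i \<omega>\<bar> \<le> d}" by (auto simp: F_def)
    then show ?thesis using m1 m2[OF that] by auto
  qed
  have F: "prob (F H) \<le> prob {\<omega> \<in> space M. G \<omega> = H} * exp (- (q * (real n / 2 - 1)))"
    if H: "finite H" "real n / 2 \<le> real (card H)" for H
  proof -
    have "prob ((\<lambda>\<omega>. (?Y0 \<omega>, ?Y1 \<omega>)) -` ({y \<in> space ?M0. E' H y} \<times> {y \<in> space ?M1. G' y = H}) \<inter> space M) =
      prob (?Y0 -` {y \<in> space ?M0. E' H y} \<inter> space M) * prob (?Y1 -` {y \<in> space ?M1. G' y = H} \<inter> space M)"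
      by (rule indep_varD[OF iv mE[OF H(1)] mG])
    moreover have "(\<lambda>\<omega>. (?Y0 \<omega>, ?Y1 \<omega>)) -` ({y \<in> space ?M0. E' H y} \<times> {y \<in> space ?M1. G' y = H}) \<inter> space M = F H"
      using sp unfolding F_def E[symmetric] G[symmetric] by auto
    ultimately have "prob (F H) = prob {\<omega> \<in> space M. \<forall>i\<in>H. \<bar>grid 0 1 h i \<omega>\<bar> \<le> d} * prob {\<omega> \<in> space M. G \<omega> = H}"
      by (simp only: pre)
    also have "\<dots> \<le> (1 - q) ^ card (H - {0}) * prob {\<omega> \<in> space M. G \<omega> = H}"
      unfolding q_def by (intro mult_right_mono brownian_motion.ou_confined[OF bm h H(1) x]) auto
    also have "(1 - q) ^ card (H - {0}) \<le> exp (- (q * (real n / 2 - 1)))"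
    proof -
      \<comment> \<open>The \<open>- 1\<close> in the exponent pays for index 0, which
        \<open>ou_confined\<close> leaves out.\<close>
      have "card H \<le> Suc (card (H - {0}))" using H(1) by (metis card_Suc_Diff1 card_Diff_singleton_if diff_Suc_1 le_SucI order_refl)
      then have c: "real n / 2 - 1 \<le> real (card (H - {0}))" using H(2) by linarith
      have "(1 - q) ^ card (H - {0}) \<le> exp (- q) ^ card (H - {0})"
        using q exp_ge_add_one_self[of "- q"] by (intro power_mono) auto
      also have "\<dots> = exp (- (q * real (card (H - {0}))))" by (simp add: exp_of_nat_mult[symmetric] mult.commute)
      also have "\<dots> \<le> exp (- (q * (real n / 2 - 1)))"
        using mult_left_mono[OF c, of q] by (simp add: q_def)
      finally show ?thesis .
    qed
    finally show ?thesis by (simp add: mult.commute mult_right_mono)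
  qed
  define HH where "HH = {H \<in> Pow {..<n}. real n / 2 \<le> real (card H)}"
  have HH: "finite HH" "\<And>H. H \<in> HH \<Longrightarrow> finite H" unfolding HH_def using finite_subset by auto
  have eq: "{\<omega> \<in> space M. real n / 2 \<le> real (card (G \<omega>)) \<and> (\<forall>i\<in>G \<omega>. \<bar>grid 0 1 h i \<omega>\<bar> \<le> d)} = (\<Union>H\<in>HH. F H)"
    by (auto simp: HH_def F_def G_def)
  show "{\<omega> \<in> space M. real n / 2 \<le> real (card (G \<omega>)) \<and> (\<forall>i\<in>G \<omega>. \<bar>grid 0 1 h i \<omega>\<bar> \<le> d)} \<in> events"
    unfolding eq using HH mF by auto
  have "prob (\<Union>H\<in>HH. F H) \<le> (\<Sum>H\<in>HH. prob (F H))"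
    by (rule measure_UNION_le) (use HH mF in auto)
  also have "\<dots> \<le> (\<Sum>H\<in>HH. prob {\<omega> \<in> space M. G \<omega> = H} * exp (- (q * (real n / 2 - 1))))"
  proof (rule sum_mono)
    fix H assume H: "H \<in> HH"
    show "prob (F H) \<le> prob {\<omega> \<in> space M. G \<omega> = H} * exp (- (q * (real n / 2 - 1)))"
      by (rule F[OF HH(2)[OF H]]) (use H in \<open>simp add: HH_def\<close>)
  qed
  also have "\<dots> = prob (\<Union>H\<in>HH. {\<omega> \<in> space M. G \<omega> = H}) * exp (- (q * (real n / 2 - 1)))"
  proof -
    have "prob (\<Union>H\<in>HH. {\<omega> \<in> space M. G \<omega> = H}) = (\<Sum>H\<in>HH. prob {\<omega> \<in> space M. G \<omega> = H})"
      by (rule finite_measure_finite_Union[OF HH(1)]) (use m1 in \<open>auto simp: disjoint_family_on_def\<close>)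
    then show ?thesis by (simp only: sum_distrib_right)
  qed
  also have "\<dots> \<le> 1 * exp (- (q * (real n / 2 - 1)))" by (intro mult_right_mono) auto
  finally show "prob {\<omega> \<in> space M. real n / 2 \<le> real (card (G \<omega>)) \<and> (\<forall>i\<in>G \<omega>. \<bar>grid 0 1 h i \<omega>\<bar> \<le> d)} \<le> exp (- (q * (real n / 2 - 1)))"
    unfolding eq by simp
qed

lemma many_zeros_prob_le_grid:
  assumes R: "R > 0" and N: "N \<ge> 1" and h: "0 < h" "h \<le> 1" and n: "n \<ge> 1" "(real n - 1) * h \<le> T"
    and x: "x \<ge> 0" "upper_scale R N / (2 * sqrt h) \<le> x * sqrt (1 - exp (- h))"
  shows "many_zeros_prob M B T R N \<le>
    4 * exp (1 / (2 * h)) * exp (- real n) + exp (- (normal_density 0 1 (x + 1) * (real n / 2 - 1)))"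
proof -
  define r where "r = big_radius R N"
  define d where "d = upper_scale R N / (2 * sqrt h)"
  \<comment> \<open>Twice the bound \<open>8 / sqrt h * weight_sum r\<close> for the time average of
    \<open>rest\<close>, so that half of the times are good. Then \<open>d\<close> is
    \<open>2 * (R + 1) * jensen_factor R N * K\<close>.\<close>
  define K where "K = 16 / sqrt h * weight_sum r"
  have r0: "r \<ge> 0" using R by (simp add: r_def big_radius_def)
  have "weight_sum r > 0" using weight_sum_ge_3[OF r0] by simp
  then have K: "K > 0" using h by (simp add: K_def)
  define G where "G \<omega> = {i \<in> {..<n}. rest B r (real i * h) \<omega> \<le> K}" for \<omega>
  define E where "E = {\<omega> \<in> space M. real n / 2 \<le> real (card (G \<omega>)) \<and> (\<forall>i\<in>G \<omega>. \<bar>grid 0 1 h i \<omega>\<bar> \<le> d)}"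
  have E: "prob E \<le> exp (- (normal_density 0 1 (x + 1) * (real n / 2 - 1)))" "E \<in> events"
    unfolding E_def G_def by (intro confined_given_rest[OF h(1) x(1)] x(2)[folded d_def] normal_density_le_1)+
  note U = exceptional_bound[OF h n(1)]
  have "many_zeros_prob M B T R N = prob (rational_event T R N)" by (rule many_zeros_prob_eq[OF R])
  also have "\<dots> \<le> prob (exceptional h n \<union> E)"
  proof (rule finite_measure_mono_AE)
    show "AE \<omega> in M. \<omega> \<in> rational_event T R N \<longrightarrow> \<omega> \<in> exceptional h n \<union> E"
      using AE_regular AE_space
    proof eventually_elim
      case (elim \<omega>)
      have "\<omega> \<in> E" if z: "\<omega> \<in> rational_event T R N" and ne: "\<omega> \<notin> exceptional h n"
      proof -
        have z: "enat N \<le> zero_count (planar_gaf B t \<omega>) (cball 0 R)" if "0 \<le> t" "t \<le> T" for t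
        proof -
          have "\<omega> \<in> many_zeros_event M B T R N" using z many_zeros_event_rational[OF R elim, of T N] by blast
          then show ?thesis using that by (simp add: many_zeros_event_def)
        qed
        have "(\<Sum>i<n. rest B r (real i * h) \<omega>) \<le> real n * (8 / sqrt h * weight_sum r)"
          by (rule rest_sum_bound[OF h(1) r0 elim ne])
        also have "8 / sqrt h * weight_sum r = K / 2" by (simp add: K_def)
        finally have "real n / 2 \<le> real (card (G \<omega>))" unfolding G_def
          by (intro card_large_terms K rest_nonneg elim(1) r0) (use h in auto)
        moreover have "\<bar>grid 0 1 h i \<omega>\<bar> \<le> d" if i: "i \<in> G \<omega>" for i
        proof -
          have i': "i < n" "rest B r (real i * h) \<omega> \<le> K" using i by (auto simp: G_def)
          have "real i * h \<le> (real n - 1) * h" using i'(1) h by (intro mult_right_mono) auto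
          then have t: "0 \<le> real i * h" "real i * h \<le> T"
            using order_trans[OF \<open>real i * h \<le> (real n - 1) * h\<close> n(2)] h by auto
          obtain L where L: "\<And>k s. 0 \<le> s \<Longrightarrow> s \<le> T \<Longrightarrow> cmod (ou_coeff B k s \<omega>) \<le> real L * (real k + 1)"
            using regular_coeff_bound[OF elim(1)] by blast
          have "cmod (ou_coeff B 0 (real i * h) \<omega>) \<le> (R + 1) * jensen_factor R N * rest B r (real i * h) \<omega>"
            unfolding rest_def r_def
            by (rule entire_zeros_imp_small_constant_term[OF R N L[OF t]])
               (use z[OF t] in \<open>simp add: planar_gaf_series\<close>)
          also have "\<dots> \<le> (R + 1) * jensen_factor R N * K"
            using i'(2) R by (intro mult_left_mono) (auto simp: jensen_factor_def)
          finally have "\<bar>grid 0 1 h i \<omega>\<bar> \<le> 2 * ((R + 1) * jensen_factor R N * K)"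
            using ou_coeff_norm(2)[of "real i * h" B 0 \<omega>] by simp
          also have "\<dots> = d" using h by (simp add: d_def K_def upper_scale_def r_def field_simps)
          finally show ?thesis .
        qed
        ultimately show ?thesis using elim by (simp add: E_def)
      qed
      then show ?case by blast
    qed
  qed (use E U in auto)
  also have "\<dots> \<le> prob (exceptional h n) + prob E" by (rule measure_Un_le) (use E U in auto)
  finally show ?thesis using E U by linarith
qed

lemma one_minus_exp_ge:
  fixes h :: real assumes "0 \<le> h" "h \<le> 1" shows "h / 2 \<le> 1 - exp (- h)"
proof -
  have "(1 - h / 2) * (1 + h) \<ge> 1" using assms mult_left_le[of h h] by (simp add: algebra_simps)
  also have "(1 - h / 2) * (1 + h) \<le> (1 - h / 2) * exp h"
    using assms by (intro mult_left_mono) (auto simp: exp_ge_add_one_self)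
  finally show ?thesis by (simp add: exp_minus field_simps)
qed

lemma many_zeros_prob_upper:
  assumes R: "R > 0" and N: "N \<ge> 1"
  defines "D \<equiv> upper_scale R N"
  defines "lam \<equiv> normal_density 0 1 (max 1 D + 1) / (2 * min 1 D)"
  shows "\<exists>C>0. \<forall>T\<ge>0. many_zeros_prob M B T R N \<le> C * exp (- lam * T)"
proof -
  \<comment> \<open>For \<open>D <= 1\<close> the choice \<open>h = D\<close> makes the window
    \<open>sqrt D / 2\<close>, comparable to the typical increment \<open>sqrt h\<close>, so
    \<open>x = 1\<close> works; for \<open>D > 1\<close> take \<open>h = 1\<close> and
    \<open>x = D\<close>. Both cases read \<open>x = D / h\<close>.\<close>
  define h where "h = min 1 D"
  define q where "q = normal_density 0 1 (max 1 D + 1)"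
  have q: "0 < q" "q \<le> 1" by (auto simp: q_def normal_density_pos normal_density_le_1)
  have "0 < jensen_factor R N" using R N by (simp add: jensen_factor_def)
  moreover have "0 < weight_sum (big_radius R N)"
    using weight_sum_ge_3[of "big_radius R N"] R by (simp add: big_radius_def)
  ultimately have D: "D > 0" using R by (simp add: D_def upper_scale_def)
  then have h: "0 < h" "h \<le> 1" by (auto simp: h_def)
  have Dh: "max 1 D = D / h" using D by (auto simp: h_def max_def min_def)
  have x: "D / (2 * sqrt h) \<le> max 1 D * sqrt (1 - exp (- h))"
  proof -
    have "sqrt h / 2 \<le> sqrt (h / 2)"
    proof (rule real_le_rsqrt)
      show "(sqrt h / 2)\<^sup>2 \<le> h / 2" using h by (simp add: power_divide)
    qed
    also have "\<dots> \<le> sqrt (1 - exp (- h))" using one_minus_exp_ge[of h] h by simp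
    finally have "D / h * (sqrt h / 2) \<le> max 1 D * sqrt (1 - exp (- h))"
      unfolding Dh using D h by (intro mult_left_mono) auto
    moreover have "D / h * (sqrt h / 2) = D / (2 * sqrt h)"
    proof -
      have "sqrt h / h = 1 / sqrt h" using h by (simp add: real_div_sqrt field_simps)
      then show ?thesis using h by (simp add: field_simps)
    qed
    ultimately show ?thesis by simp
  qed
  define C where "C = 4 * exp (1 / (2 * h)) + exp q"
  have "many_zeros_prob M B T R N \<le> C * exp (- lam * T)" if T: "T \<ge> 0" for T
  proof -
    define n where "n = nat \<lfloor>T / h\<rfloor> + 1"
    have "0 \<le> T / h" using T h by simp
    then have n: "real n - 1 \<le> T / h" "T / h \<le> real n" "n \<ge> 1" unfolding n_def by linarith+
    have "(real n - 1) * h \<le> T" using n(1) h by (simp add: field_simps)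
    from many_zeros_prob_le_grid[OF R N h n(3) this _ x[unfolded D_def]]
    have "many_zeros_prob M B T R N \<le> 4 * exp (1 / (2 * h)) * exp (- real n) + exp (- (q * (real n / 2 - 1)))"
      by (simp add: q_def D_def)
    also have "exp (- real n) \<le> exp (- (q / 2 * real n))"
      using q mult_right_mono[of "q / 2" 1 "real n"] by simp
    also have "exp (- (q * (real n / 2 - 1))) = exp q * exp (- (q / 2 * real n))"
      by (simp add: exp_add[symmetric] algebra_simps)
    finally have "many_zeros_prob M B T R N \<le> C * exp (- (q / 2 * real n))"
      by (simp add: C_def distrib_right)
    also have "exp (- (q / 2 * real n)) \<le> exp (- lam * T)"
    proof -
      have "lam * T = q / 2 * (T / h)" by (simp add: lam_def q_def h_def)
      also have "\<dots> \<le> q / 2 * real n" using n(2) q by (intro mult_left_mono) auto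
      finally show ?thesis by simp
    qed
    finally show ?thesis by (simp add: C_def add_pos_pos)
  qed
  moreover have "C > 0" by (simp add: C_def add_pos_pos)
  ultimately show ?thesis by blast
qed

end

section \<open>The lower bound\<close>

definition gaf_majorant :: "real \<Rightarrow> real" where
  "gaf_majorant x = 2 * exp (2 * x\<^sup>2)"

lemma gaf_majorant_pos: "gaf_majorant x > 0" by (simp add: gaf_majorant_def)

text \<open>Since \<open>fact N * fact m\<close> divides \<open>fact (N + m)\<close>, the terms
  beyond \<open>N\<close> are controlled by the term of degree \<open>N\<close> times the same
  series.\<close>

lemma gaf_weight_shift:
  assumes "R > 0"
  shows "R ^ (N + m) / sqrt (fact (N + m)) \<le> (R ^ N / sqrt (fact N)) * (R ^ m / sqrt (fact m))"
proof -
  have "fact N * fact m \<le> (fact (N + m) :: real)"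
  proof -
    have "(fact N * fact m :: nat) dvd fact (N + m)" by (rule fact_fact_dvd_fact)
    then have "(fact N * fact m :: nat) \<le> fact (N + m)" by (rule dvd_imp_le) simp
    then have "real (fact N * fact m) \<le> real (fact (N + m))" by (simp only: of_nat_le_iff)
    then show ?thesis by simp
  qed
  then have "sqrt (fact N) * sqrt (fact m) \<le> sqrt (fact (N + m))"
    by (simp only: real_sqrt_mult[symmetric] real_sqrt_le_iff)
  then have "R ^ (N + m) / sqrt (fact (N + m)) \<le> R ^ (N + m) / (sqrt (fact N) * sqrt (fact m))"
    using assms by (intro divide_left_mono) auto
  then show ?thesis by (simp add: power_add)
qed

text \<open>On the circle of radius \<open>R\<close> the leading term is at least
  \<open>K / 2 * w N\<close>, while the terms below and above it contribute at most
  \<open>K * w N / 8\<close> each. The growth \<open>2 ^ m\<close> of the higher coefficients is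
  absorbed by doubling the radius in \<open>gaf_majorant (2 * R)\<close>.\<close>

lemma dominant_coefficient_zeros:
  fixes c :: "nat \<Rightarrow> complex"
  assumes R: "R > 0" and b: "\<And>n. cmod (c n) \<le> L' * (real n + 1)" and L: "0 < L"
    and small: "\<And>k. k < N \<Longrightarrow> cmod (c k) \<le> 4 * \<delta>"
    and large: "K / 2 \<le> cmod (c N)"
    and tail: "\<And>m. cmod (c (N + Suc m)) \<le> 2 * L * 2 ^ Suc m"
    and K: "16 * L * gaf_majorant (2 * R) \<le> K"
    and \<delta>: "0 \<le> \<delta>" "32 * \<delta> * gaf_majorant R \<le> K * (R ^ N / sqrt (fact N))"
  shows "enat N \<le> zero_count (gaf_series c) (cball 0 R)"
proof -
  define w where "w k = R ^ k / sqrt (fact k)" for k :: nat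
  have w: "w k > 0" for k using R by (simp add: w_def)
  have K0: "K > 0" using K L gaf_majorant_pos[of "2 * R"] by (smt (verit) mult_pos_pos)
  define g where "g k = (if k = N then 0 else cmod (c k)) * w k" for k
  have g0: "0 \<le> g k" for k using w[of k] by (auto simp: g_def)
  have sc: "summable (\<lambda>n. cmod (c n) * w n)" unfolding w_def by (rule gaf_series_summable[OF b])
  have sg: "summable g"
    by (rule summable_comparison_test'[OF sc, of 0]) (use w in \<open>auto simp: g_def less_imp_le\<close>)
  have sN: "summable (\<lambda>k. g (k + Suc N))" using sg summable_iff_shift by blast
  have t2: "2 * L * 2 ^ Suc m * w (N + Suc m) \<le> 2 * L * w N * ((2 * R) ^ Suc m / sqrt (fact (Suc m)))" for m
  proof -
    have "2 * L * 2 ^ Suc m * w (N + Suc m) \<le> 2 * L * 2 ^ Suc m * (w N * (R ^ Suc m / sqrt (fact (Suc m))))"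
      using gaf_weight_shift[OF R, of N "Suc m"] L unfolding w_def by (intro mult_left_mono) auto
    also have "\<dots> = 2 * L * w N * ((2 * R) ^ Suc m / sqrt (fact (Suc m)))"
      by (simp only: power_mult_distrib) (simp only: mult_ac times_divide_eq_right)
    finally show ?thesis .
  qed
  have gt: "g (m + Suc N) \<le> 2 * L * w N * ((2 * R) ^ Suc m / sqrt (fact (Suc m)))" for m
  proof -
    have "g (m + Suc N) = cmod (c (N + Suc m)) * w (N + Suc m)" by (simp add: g_def add.commute)
    also have "\<dots> \<le> 2 * L * 2 ^ Suc m * w (N + Suc m)"
      using tail[of m] w[of "N + Suc m"] by (intro mult_right_mono) auto
    also note t2
    finally show ?thesis .
  qed
  have s2: "summable (\<lambda>m. (2 * R) ^ m / sqrt (fact m))" by (rule gaf_weight_summable(1)) (use R in simp)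
  have s2': "summable (\<lambda>m. (2 * R) ^ Suc m / sqrt (fact (Suc m)))"
    using s2 summable_Suc_iff[of "\<lambda>m. (2 * R) ^ m / sqrt (fact m)"] by blast
  have "(\<Sum>k. g (k + Suc N)) \<le> (\<Sum>m. 2 * L * w N * ((2 * R) ^ Suc m / sqrt (fact (Suc m))))"
    by (rule suminf_le[OF gt sN summable_mult[OF s2']])
  also have "\<dots> = 2 * L * w N * (\<Sum>m. (2 * R) ^ Suc m / sqrt (fact (Suc m)))" by (rule suminf_mult[OF s2'])
  also have "\<dots> \<le> 2 * L * w N * gaf_majorant (2 * R)"
  proof (rule mult_left_mono)
    have "(\<Sum>m. (2 * R) ^ Suc m / sqrt (fact (Suc m))) \<le> (\<Sum>m. (2 * R) ^ m / sqrt (fact m))"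
      using suminf_split_head[OF s2] by simp
    also have "\<dots> \<le> gaf_majorant (2 * R)" unfolding gaf_majorant_def by (rule gaf_weight_summable(2)) (use R in simp)
    finally show "(\<Sum>m. (2 * R) ^ Suc m / sqrt (fact (Suc m))) \<le> gaf_majorant (2 * R)" .
    show "0 \<le> 2 * L * w N" using L w[of N] by simp
  qed
  also have "\<dots> = (16 * L * gaf_majorant (2 * R)) * w N / 8" by simp
  also have "\<dots> \<le> K * w N / 8" using mult_right_mono[OF K, of "w N"] w[of N] by simp
  finally have tail_sum: "(\<Sum>k. g (k + Suc N)) \<le> K * w N / 8" .
  have "(\<Sum>k<Suc N. g k) = (\<Sum>k<N. g k)" by (simp add: g_def)
  also have "\<dots> \<le> (\<Sum>k<N. 4 * \<delta> * w k)"
    using small w by (intro sum_mono) (auto simp: g_def less_imp_le intro!: mult_right_mono)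
  also have "\<dots> = 4 * \<delta> * (\<Sum>k<N. w k)" by (simp add: sum_distrib_left)
  also have "\<dots> \<le> 4 * \<delta> * gaf_majorant R"
  proof (rule mult_left_mono)
    have "(\<Sum>k<N. w k) \<le> (\<Sum>k. w k)"
      using w R unfolding w_def by (intro sum_le_suminf gaf_weight_summable(1)) auto
    also have "\<dots> \<le> gaf_majorant R" unfolding gaf_majorant_def w_def by (rule gaf_weight_summable(2)) (use R in simp)
    finally show "(\<Sum>k<N. w k) \<le> gaf_majorant R" .
  qed (use \<delta> in simp)
  also have "\<dots> \<le> K * w N / 8" using \<delta>(2) by (simp add: w_def)
  finally have head_sum: "(\<Sum>k<Suc N. g k) \<le> K * w N / 8" .
  have total: "suminf g < K / 2 * w N"
  proof -
    have "suminf g = (\<Sum>k. g (k + Suc N)) + (\<Sum>k<Suc N. g k)" by (rule suminf_split_initial_segment[OF sg])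
    also have "\<dots> \<le> K * w N / 4" using tail_sum head_sum by simp
    also have "\<dots> < K / 2 * w N" using K0 w[of N] by simp
    finally show ?thesis .
  qed
  have cN: "c N \<noteq> 0" using large K0 by auto
  define a where "a = c N / of_real (sqrt (fact N))"
  have a: "a \<noteq> 0" using cN by (simp add: a_def)
  have "zero_count (gaf_series c) (ball 0 R) = zero_count (\<lambda>z. a * z ^ N) (ball 0 R)"
  proof (rule rouche_zero_count[OF _ gaf_series_holomorphic[OF b] R])
    show "(\<lambda>z. a * z ^ N) holomorphic_on UNIV" by (intro holomorphic_intros)
    fix z :: complex assume z: "cmod z = R"
    let ?f = "\<lambda>n. (if n = N then 0 else c n) * (z ^ n / of_real (sqrt (fact n)))"
    have nf: "cmod (?f n) = g n" for n by (simp only: gaf_term_norm z) (simp add: g_def w_def)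
    have s1: "(\<lambda>n. if n = N then a * z ^ N else 0) sums (a * z ^ N)"
      by (rule sums_single[of N "\<lambda>_. a * z ^ N"])
    have "(\<lambda>n. c n * (z ^ n / of_real (sqrt (fact n))) - (if n = N then a * z ^ N else 0)) sums (gaf_series c z - a * z ^ N)"
      by (rule sums_diff[OF gaf_series_sums[OF b] s1])
    moreover have "(\<lambda>n. c n * (z ^ n / of_real (sqrt (fact n))) - (if n = N then a * z ^ N else 0)) = ?f"
      by (auto simp: fun_eq_iff a_def)
    ultimately have "gaf_series c z - a * z ^ N = suminf ?f" by (simp add: sums_iff)
    then have "cmod (gaf_series c z - a * z ^ N) \<le> suminf g"
      using summable_norm[of ?f] sg by (simp only: nf)
    also note total
    also have "K / 2 * w N \<le> cmod (c N) * w N" using large w[of N] by (intro mult_right_mono) auto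
    also have "\<dots> = cmod (a * z ^ N)" by (simp add: a_def w_def norm_mult norm_divide norm_power z)
    finally show "cmod (gaf_series c z - a * z ^ N) < cmod (a * z ^ N)" .
  qed
  also have "\<dots> = enat N" by (rule zero_count_monom[OF a R])
  finally show ?thesis
    using zero_count_mono[OF gaf_series_holomorphic[OF b], of "ball 0 R" "cball 0 R"] by force
qed

lemma one_minus_ge_exp:
  fixes x :: real assumes "0 \<le> x" "x \<le> 1 / 2" shows "exp (- (2 * x)) \<le> 1 - x"
proof -
  have "1 \<le> (1 - x) * (1 + 2 * x)"
    using assms mult_left_mono[of x "1/2" x] by (simp add: algebra_simps)
  also have "\<dots> \<le> (1 - x) * exp (2 * x)"
    using assms by (intro mult_left_mono) (auto simp: exp_ge_add_one_self)
  finally show ?thesis by (simp add: exp_minus field_simps)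
qed

text \<open>For \<open>L = 100 * 2 ^ Suc m\<close> the failure probability per block is at most
  \<open>27 / 125 * (1 / 2) ^ Suc m\<close>, small enough for \<open>1 - x >= exp (- 2 * x)\<close>;
  as \<open>ln 4 >= 1\<close>, at most \<open>T + 3\<close> factors occur. The exponents are
  summable in \<open>m\<close>.\<close>

lemma stays_tail_exp:
  assumes W: "brownian_motion M W" and T: "T \<ge> 0"
  shows "exp (- ((T + 3) / 2 * (1 / 2) ^ Suc m)) \<le>
    measure M {\<omega> \<in> space M. brownian_motion.stays W T {- (100 * 2 ^ Suc m)..100 * 2 ^ Suc m} \<omega>}"
proof -
  define x :: real where "x = 21600000 / (100 * 2 ^ Suc m) ^ 4"
  have l4: "1 \<le> ln (4::real)" using e_less_272 by (subst ln_ge_iff) auto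
  have x: "x = 27 / 125 * (1 / 16) ^ Suc m"
  proof -
    have "((2::real) ^ Suc m) ^ 4 = (2 ^ 4) ^ Suc m"
      by (simp only: power_mult[symmetric] mult.commute)
    also have "(2::real) ^ 4 = 16" by simp
    finally show ?thesis by (simp add: x_def power_mult_distrib power_divide del: power_Suc)
  qed
  have x16: "x \<le> 27 / 125 * (1 / 2) ^ Suc m" unfolding x by (intro mult_left_mono power_mono) auto
  have "(1 / 2 :: real) ^ Suc m \<le> 1" by (intro power_le_one) auto
  then have x2: "0 \<le> x" "x \<le> 1 / 2" using x16 by (auto simp: x)
  define n where "n = nat \<lceil>T\<rceil> + 1"
  have n: "T \<le> real n" "real n \<le> T + 2" "0 < n" using T unfolding n_def by linarith+
  have "real n * 1 \<le> real n * ln 4" using l4 by (intro mult_left_mono) auto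
  then have Tn: "T \<le> real n * ln 4" using n by linarith
  have "0 \<le> (1 / 2 :: real) ^ Suc m" by simp
  then have "2 * x \<le> 1 / 2 * (1 / 2) ^ Suc m" using x16 by linarith
  moreover have "real (Suc n) \<le> T + 3" using n(2) by simp
  ultimately have "real (Suc n) * (2 * x) \<le> (T + 3) * (1 / 2 * (1 / 2) ^ Suc m)"
    using mult_mono[of "real (Suc n)" "T + 3" "2 * x" "1 / 2 * (1 / 2) ^ Suc m"] x2(1) T by linarith
  then have "exp (- ((T + 3) / 2 * (1 / 2) ^ Suc m)) \<le> exp (- (2 * x)) ^ Suc n"
    unfolding exp_of_nat_mult[symmetric] exp_le_cancel_iff by simp
  also have "\<dots> \<le> (1 - x) ^ Suc n" using one_minus_ge_exp[OF x2] by (intro power_mono) auto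
  also have "\<dots> \<le> measure M {\<omega> \<in> space M. brownian_motion.stays W T {- (100 * 2 ^ Suc m)..100 * 2 ^ Suc m} \<omega>}"
    unfolding x_def by (rule brownian_motion.stays_tail[OF W _ Tn n(3)]) (use x2 in \<open>auto simp: x_def\<close>)
  finally show ?thesis .
qed

text \<open>The fourth root of \<open>fact N\<close> balances the two costs: \<open>\<delta>\<close>
  is of order \<open>K / sqrt (fact N)\<close> up to \<open>exp (O(N))\<close>, so
  \<open>K\<^sup>2\<close> and \<open>1 / \<delta>\<^sup>2\<close> agree to this accuracy. The
  constant is \<open>1600 = 16 * 100\<close> with \<open>L = 100\<close> in
  \<open>dominant_coefficient_zeros\<close>.\<close>

definition lower_K :: "real \<Rightarrow> nat \<Rightarrow> real" where
  "lower_K R N = 1600 * gaf_majorant (2 * R) * sqrt (sqrt (fact N))"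

text \<open>The largest value that \<open>dominant_coefficient_zeros\<close> allows for the given
  \<open>K\<close>.\<close>

definition lower_delta :: "real \<Rightarrow> nat \<Rightarrow> real" where
  "lower_delta R N = lower_K R N * (R ^ N / sqrt (fact N)) / (32 * gaf_majorant R)"

text \<open>The terms are the costs of \<open>2 * N\<close> real paths kept small, of one real path
  kept large, and, in the final 1, of all higher coefficients together.\<close>

definition lower_rate :: "real \<Rightarrow> nat \<Rightarrow> real" where
  "lower_rate R N = 2 * real N * (ln 4 / ln (1 + (lower_delta R N)\<^sup>2 / 800)) +
    ln (1 / (500 * tail_const)) / ln (1 + tail_const / (lower_K R N)\<^sup>2) + 1"

lemma lower_K_ge: "lower_K R N \<ge> 1" "1600 * gaf_majorant (2 * R) \<le> lower_K R N"
proof -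
  have s: "1 \<le> sqrt (sqrt (fact N :: real))" by (simp add: fact_ge_1)
  show 1: "1600 * gaf_majorant (2 * R) \<le> lower_K R N"
    unfolding lower_K_def using mult_left_mono[OF s, of "1600 * gaf_majorant (2 * R)"] gaf_majorant_pos[of "2 * R"] by simp
  have "1 \<le> exp (2 * (2 * R)\<^sup>2)" by simp
  then have "1 \<le> 1600 * gaf_majorant (2 * R)" unfolding gaf_majorant_def by linarith
  with 1 show "lower_K R N \<ge> 1" by simp
qed

lemma lower_delta_pos: "R > 0 \<Longrightarrow> lower_delta R N > 0"
  using lower_K_ge(1)[of R N] gaf_majorant_pos[of R] by (simp add: lower_delta_def)

context gaf begin

text \<open>At \<open>k = N\<close> only the real component is constrained, since one large
  component already makes the modulus large.\<close>

definition window :: "real \<Rightarrow> nat \<Rightarrow> nat \<times> nat \<Rightarrow> real set" where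
  "window R N = (\<lambda>(k, j). if k < N then {- (2 * lower_delta R N)..2 * lower_delta R N}
     else if k = N then (if j = 1 then {lower_K R N..} else UNIV)
     else {- (100 * 2 ^ (k - N))..100 * 2 ^ (k - N)})"

definition window_event :: "real \<Rightarrow> real \<Rightarrow> nat \<Rightarrow> nat \<times> nat \<Rightarrow> 'a set" where
  "window_event T R N = (\<lambda>(k, j). {\<omega> \<in> space M. brownian_motion.stays (B k j) T (window R N (k, j)) \<omega>})"

lemma window_borel: "window R N i \<in> sets borel"
  by (cases i) (auto simp: window_def)

lemma window_event_measurable: "j \<in> {1, 2} \<Longrightarrow> window_event T R N (k, j) \<in> events"
  using brownian_motion.stays_measurable[OF bm window_borel, of j k T R N "(k, j)"]
  by (simp add: window_event_def)

lemma windows_imp_rational_event: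
  assumes R: "R > 0" and reg: "regular \<omega>" and \<omega>: "\<omega> \<in> space M"
    and w: "\<And>k j. j \<in> {1, 2} \<Longrightarrow> \<omega> \<in> window_event T R N (k, j)"
  shows "\<omega> \<in> rational_event T R N"
proof -
  obtain L where L: "\<And>n t. 0 \<le> t \<Longrightarrow> t \<le> T \<Longrightarrow> cmod (ou_coeff B n t \<omega>) \<le> real L * (real n + 1)"
    using regular_coeff_bound[OF reg] by blast
  have "(\<lambda>n. ou_coeff B n (of_rat q) \<omega>) \<in> overcrowded R N (real L)" if q: "of_rat q \<in> {0..T}" for q
  proof -
    define t :: real where "t = of_rat q"
    have t: "0 \<le> t" "t \<le> T" "t \<in> \<rat>" using q by (auto simp: t_def)
    define X where "X k j = exp (- t / 2) * B k j (exp t) \<omega>" for k j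
    have X: "X k j \<in> window R N (k, j)" if "j \<in> {1, 2}" for k j
      using w[OF that, of k] t that unfolding window_event_def X_def
      by (simp add: brownian_motion.stays_def[OF bm])
    have "enat N \<le> zero_count (gaf_series (\<lambda>n. ou_coeff B n t \<omega>)) (cball 0 R)"
    proof (rule dominant_coefficient_zeros[OF R L[OF t(1,2)], where L = 100 and \<delta> = "lower_delta R N" and K = "lower_K R N"])
      fix k assume "k < N"
      then have "\<bar>X k 1\<bar> \<le> 2 * lower_delta R N" "\<bar>X k 2\<bar> \<le> 2 * lower_delta R N"
        using X[of 1 k] X[of 2 k] by (auto simp: window_def abs_le_iff)
      then show "cmod (ou_coeff B k t \<omega>) \<le> 4 * lower_delta R N"
        using ou_coeff_norm(1)[of B k t \<omega>] unfolding X_def by linarith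
    next
      have "lower_K R N \<le> X N 1" using X[of 1 N] by (simp add: window_def)
      then show "lower_K R N / 2 \<le> cmod (ou_coeff B N t \<omega>)"
        using ou_coeff_norm(2)[of t B N \<omega>] unfolding X_def by linarith
    next
      fix m
      have "\<bar>X (N + Suc m) 1\<bar> \<le> 100 * 2 ^ Suc m" "\<bar>X (N + Suc m) 2\<bar> \<le> 100 * 2 ^ Suc m"
        using X[of 1 "N + Suc m"] X[of 2 "N + Suc m"] by (auto simp: window_def abs_le_iff simp del: power_Suc)
      then show "cmod (ou_coeff B (N + Suc m) t \<omega>) \<le> 2 * 100 * 2 ^ Suc m"
        using ou_coeff_norm(1)[of B "N + Suc m" t \<omega>] unfolding X_def by linarith
    next
      show "16 * 100 * gaf_majorant (2 * R) \<le> lower_K R N" using lower_K_ge(2)[of R N] by simp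
      show "0 \<le> lower_delta R N" using lower_delta_pos[OF R, of N] by simp
      show "32 * lower_delta R N * gaf_majorant R \<le> lower_K R N * (R ^ N / sqrt (fact N))"
        using gaf_majorant_pos[of R] by (simp add: lower_delta_def)
    qed auto
    then show ?thesis using L[OF t(1,2)] by (simp add: overcrowded_def t_def)
  qed
  then show ?thesis using \<omega> by (auto simp: rational_event_def)
qed

text \<open>Restricting to rational times makes each event the preimage of a measurable set
  \<open>A i\<close> of paths, to which independence of whole paths applies.\<close>

lemma window_events_indep:
  assumes "finite J" "J \<noteq> {}" "J \<subseteq> UNIV \<times> {1, 2}"
  shows "prob (\<Inter>i\<in>J. window_event T R N i) = (\<Prod>i\<in>J. prob (window_event T R N i))"
proof -
  let ?PS = "\<Pi>\<^sub>M t\<in>{0::real..}. borel :: real measure"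
  define Y where "Y = (\<lambda>(n, j) \<omega>. \<lambda>t\<in>{0::real..}. B n j t \<omega>)"
  define A where "A i = {p \<in> space ?PS. \<forall>r. of_rat r \<in> {0..T} \<longrightarrow> exp (- of_rat r / 2) * p (exp (of_rat r)) \<in> window R N i}" for i
  have A: "A i \<in> sets ?PS" for i
  proof -
    have [measurable]: "(\<lambda>p. p (exp t)) \<in> borel_measurable ?PS" for t :: real
      by (rule measurable_component_singleton) simp
    have [measurable]: "window R N i \<in> sets borel" by (rule window_borel)
    show ?thesis unfolding A_def by measurable
  qed
  have eq: "Y i -` A i \<inter> space M = window_event T R N i" if "i \<in> J" for i
  proof -
    obtain k j where i: "i = (k, j)" by (cases i)
    have j: "j \<in> {1, 2}" using that assms(3) i by auto
    show ?thesis unfolding i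
      by (auto simp: Y_def A_def window_event_def brownian_motion.stays_def[OF bm[OF j]] space_PiM Rats_def)
  qed
  have "indep_vars (\<lambda>_. ?PS) Y (UNIV \<times> {1, 2})" using indep_paths by (simp add: Y_def)
  from indep_varsD[OF this assms(2,1,3), of A] A show ?thesis using eq by simp
qed

lemma many_zeros_prob_lower:
  assumes R: "R > 0"
  shows "\<exists>c>0. \<forall>T\<ge>0. c * exp (- lower_rate R N * T) \<le> many_zeros_prob M B T R N"
proof -
  define ls where "ls = ln 4 / ln (1 + (lower_delta R N)\<^sup>2 / 800)"
  define ll where "ll = ln (1 / (500 * tail_const)) / ln (1 + tail_const / (lower_K R N)\<^sup>2)"
  define rate where "rate k j = (if k < N then ls else if j = (1::nat) then ll else 0)" for k j
  have "\<exists>c>0. \<forall>T\<ge>0. c * exp (- rate k j * T) \<le> prob (window_event T R N (k, j))" if k: "k \<le> N" and j: "j \<in> {1, 2}" for k j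
  proof (cases "k < N")
    case True
    then show ?thesis using brownian_motion.stays_small[OF bm[OF j], of "lower_delta R N" k] lower_delta_pos[OF R, of N]
      by (simp add: window_event_def window_def rate_def ls_def)
  next
    case False
    then have kN: "k = N" using k by simp
    show ?thesis
    proof (cases "j = 1")
      case True
      then show ?thesis using brownian_motion.stays_large[OF bm[OF j], of "lower_K R N" k] lower_K_ge(1)[of R N] kN
        by (simp add: window_event_def window_def rate_def ll_def)
    next
      case False
      then have "window_event T R N (k, j) = space M" for T
        using kN by (simp add: window_event_def window_def brownian_motion.stays_def[OF bm[OF j]])
      then show ?thesis using False kN by (intro exI[of _ 1]) (auto simp: rate_def prob_space)
    qed
  qed
  then have "\<forall>k j. \<exists>c. k \<le> N \<longrightarrow> j \<in> {1, 2} \<longrightarrow> c > 0 \<and> (\<forall>T\<ge>0. c * exp (- rate k j * T) \<le> prob (window_event T R N (k, j)))"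
    by blast
  then obtain c where c: "\<And>k j. k \<le> N \<Longrightarrow> j \<in> {1, 2} \<Longrightarrow> c k j > 0"
    "\<And>k j T. k \<le> N \<Longrightarrow> j \<in> {1, 2} \<Longrightarrow> T \<ge> 0 \<Longrightarrow> c k j * exp (- rate k j * T) \<le> prob (window_event T R N (k, j))"
    unfolding choice_iff by blast
  define C where "C = (\<Prod>k\<le>N. c k 1 * c k 2)"
  have C: "C > 0" unfolding C_def by (intro prod_pos mult_pos_pos c) auto
  have main: "C * exp (- 3) * exp (- lower_rate R N * T) \<le> many_zeros_prob M B T R N" if T: "T \<ge> 0" for T
  proof -
    define Q where "Q k = prob (window_event T R N (k, 1)) * prob (window_event T R N (k, 2))" for k
    have Q0: "Q k \<ge> 0" for k by (simp add: Q_def)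
    have "C * exp (- (2 * real N * ls + ll) * T) \<le> (\<Prod>k\<le>N. Q k)"
    proof -
      have "(\<Sum>k\<le>N. rate k 1 + rate k 2) = (\<Sum>k<N. rate k 1 + rate k 2) + ll"
        by (simp add: rate_def lessThan_Suc_atMost[symmetric])
      also have "(\<Sum>k<N. rate k 1 + rate k 2) = 2 * real N * ls" by (simp add: rate_def)
      finally have "C * exp (- (2 * real N * ls + ll) * T) = C * exp (\<Sum>k\<le>N. - (rate k 1 + rate k 2) * T)"
        by (simp only: sum_distrib_right[symmetric] sum_negf)
      also have "\<dots> = (\<Prod>k\<le>N. (c k 1 * exp (- rate k 1 * T)) * (c k 2 * exp (- rate k 2 * T)))"
        unfolding C_def exp_sum[OF finite_atMost] prod.distrib[symmetric]
        by (intro prod.cong) (simp_all add: algebra_simps flip: exp_add)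
      also have "\<dots> \<le> (\<Prod>k\<le>N. Q k)"
        unfolding Q_def using c T
        by (intro prod_mono conjI mult_mono mult_nonneg_nonneg) (auto simp: less_imp_le)
      finally show ?thesis .
    qed
    have tailQ: "exp (- ((T + 3) * (1 / 2) ^ Suc m)) \<le> Q (N + Suc m)" for m
    proof -
      have e: "exp (- ((T + 3) / 2 * (1 / 2) ^ Suc m)) \<le> prob (window_event T R N (N + Suc m, j))" if "j \<in> {1, 2}" for j
        using stays_tail_exp[OF bm[OF that, of "N + Suc m"] T, of m] by (simp add: window_event_def window_def del: power_Suc)
      have "exp (- ((T + 3) * (1 / 2) ^ Suc m)) = exp (- ((T + 3) / 2 * (1 / 2) ^ Suc m)) * exp (- ((T + 3) / 2 * (1 / 2) ^ Suc m))"
        by (simp add: exp_add[symmetric])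
      also have "\<dots> \<le> Q (N + Suc m)" unfolding Q_def by (intro mult_mono e) auto
      finally show ?thesis .
    qed
    have fin: "C * exp (- (2 * real N * ls + ll) * T) * exp (- (T + 3)) \<le> (\<Prod>k\<le>N + m. Q k)" for m
    proof -
      \<comment> \<open>The cost of the first \<open>m\<close> higher coefficients is
        \<open>T + 3\<close> times the geometric sum \<open>1 - (1 / 2) ^ m\<close>, hence at most
        \<open>T + 3\<close> for every \<open>m\<close>.\<close>
      have "C * exp (- (2 * real N * ls + ll) * T) * exp (- ((T + 3) * (1 - (1 / 2) ^ m))) \<le> (\<Prod>k\<le>N + m. Q k)"
      proof (induction m)
        case 0
        then show ?case using \<open>C * exp (- (2 * real N * ls + ll) * T) \<le> (\<Prod>k\<le>N. Q k)\<close> by simp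
      next
        case (Suc m)
        have "C * exp (- (2 * real N * ls + ll) * T) * exp (- ((T + 3) * (1 - (1 / 2) ^ Suc m))) =
          C * exp (- (2 * real N * ls + ll) * T) * exp (- ((T + 3) * (1 - (1 / 2) ^ m))) * exp (- ((T + 3) * (1 / 2) ^ Suc m))"
        proof -
          have "- ((T + 3) * (1 - (1 / 2) ^ Suc m)) = - ((T + 3) * (1 - (1 / 2) ^ m)) + - ((T + 3) * (1 / 2) ^ Suc m)"
            by (simp add: algebra_simps)
          then show ?thesis by (simp only: exp_add mult.assoc)
        qed
        also have "\<dots> \<le> (\<Prod>k\<le>N + m. Q k) * Q (N + Suc m)"
          using Suc.IH tailQ[of m] by (intro mult_mono prod_nonneg) (auto simp: Q0)
        also have "\<dots> = (\<Prod>k\<le>N + Suc m. Q k)" by simp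
        finally show ?case .
      qed
      moreover have "exp (- (T + 3)) \<le> exp (- ((T + 3) * (1 - (1 / 2) ^ m)))"
      proof -
        have "(1 - (1 / 2) ^ m :: real) \<le> 1" by simp
        from mult_left_mono[OF this, of "T + 3"] T show ?thesis
          by (simp only: exp_le_cancel_iff neg_le_iff_le mult_1_right)
      qed
      ultimately show ?thesis
        using C mult_left_mono[of "exp (- (T + 3))" "exp (- ((T + 3) * (1 - (1 / 2) ^ m)))" "C * exp (- (2 * real N * ls + ll) * T)"]
        by (meson exp_ge_zero less_imp_le mult_nonneg_nonneg order_trans)
    qed
    \<comment> \<open>Independence is available for finitely many events at a time; the bound is
      uniform in \<open>m\<close> and passes to the decreasing limit.\<close>
    define D where "D m = (\<Inter>i\<in>{..N + m} \<times> {1, 2}. window_event T R N i)" for m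
    have Dm: "D m \<in> events" for m
      unfolding D_def by (intro sets.finite_INT) (auto intro!: window_event_measurable)
    have PD: "prob (D m) = (\<Prod>k\<le>N + m. Q k)" for m
    proof -
      have "prob (D m) = (\<Prod>i\<in>{..N + m} \<times> {1, 2}. prob (window_event T R N i))"
        unfolding D_def by (rule window_events_indep) auto
      also have "\<dots> = (\<Prod>k\<le>N + m. \<Prod>j\<in>{1, 2}. prob (window_event T R N (k, j)))"
        unfolding prod.cartesian_product by (rule prod.cong) auto
      also have "\<dots> = (\<Prod>k\<le>N + m. Q k)" by (simp add: Q_def)
      finally show ?thesis .
    qed
    have "(\<lambda>m. prob (D m)) \<longlonglongrightarrow> prob (\<Inter>m. D m)"
    proof (rule finite_Lim_measure_decseq)
      show "decseq D" unfolding D_def decseq_def by fastforce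
    qed (use Dm in auto)
    then have "C * exp (- (2 * real N * ls + ll) * T) * exp (- (T + 3)) \<le> prob (\<Inter>m. D m)"
      using fin PD by (intro LIMSEQ_le_const) auto
    also have "\<dots> \<le> prob (rational_event T R N)"
    proof (rule finite_measure_mono_AE)
      show "AE \<omega> in M. \<omega> \<in> (\<Inter>m. D m) \<longrightarrow> \<omega> \<in> rational_event T R N"
        using AE_regular AE_space
      proof eventually_elim
        case (elim \<omega>)
        show ?case
        proof
          assume "\<omega> \<in> (\<Inter>m. D m)"
          then have "\<omega> \<in> D k" for k by blast
          then have "\<omega> \<in> window_event T R N (k, j)" if "j \<in> {1, 2}" for k j
            using that unfolding D_def by (meson INT_iff SigmaI atMost_iff le_add2)
          then show "\<omega> \<in> rational_event T R N" by (intro windows_imp_rational_event[OF R elim])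
        qed
      qed
    qed (rule rational_event_measurable[OF R])
    also have "C * exp (- (2 * real N * ls + ll) * T) * exp (- (T + 3)) = C * exp (- 3) * exp (- lower_rate R N * T)"
    proof -
      have "- (2 * real N * ls + ll) * T + - (T + 3) = - 3 + - lower_rate R N * T"
        by (simp add: lower_rate_def ls_def ll_def algebra_simps)
      then have "exp (- (2 * real N * ls + ll) * T) * exp (- (T + 3)) = exp (- 3) * exp (- lower_rate R N * T)"
        by (simp only: exp_add[symmetric])
      then show ?thesis by (simp only: mult.assoc)
    qed
    finally show ?thesis by (simp only: many_zeros_prob_eq[OF R])
  qed
  show ?thesis using C main by (intro exI[of _ "C * exp (- 3)"]) auto
qed

end

section \<open>Exponential rates\<close>

lemma Limsup_log_prob_le:
  fixes p :: "real \<Rightarrow> real"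
  assumes p0: "\<And>T. p T \<ge> 0" and C: "C > 0" and le: "\<And>T. T \<ge> 0 \<Longrightarrow> p T \<le> C * exp (- lam * T)"
  shows "Limsup at_top (\<lambda>T. log_prob (p T) / ereal T) \<le> ereal (- lam)"
proof -
  have lim: "((\<lambda>T. ereal (ln C / T + - lam)) \<longlongrightarrow> ereal (0 + - lam)) at_top"
    by (intro tendsto_intros tendsto_divide_0[OF tendsto_const]) (simp add: filterlim_at_top_imp_at_infinity filterlim_ident)
  have "Limsup at_top (\<lambda>T. log_prob (p T) / ereal T) \<le> Limsup at_top (\<lambda>T. ereal (ln C / T + - lam))"
  proof (rule Limsup_mono)
    show "\<forall>\<^sub>F T in at_top. log_prob (p T) / ereal T \<le> ereal (ln C / T + - lam)"
      using eventually_gt_at_top[of 0]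
    proof eventually_elim
      case (elim T)
      show ?case
      proof (cases "p T = 0")
        case False
        then have pT: "p T > 0" using p0[of T] by simp
        then have "ln (p T) \<le> ln (C * exp (- lam * T))" using le[of T] elim by simp
        also have "\<dots> = ln C + - lam * T" using C by (simp add: ln_mult)
        finally have "ln (p T) / T \<le> ln C / T + - lam" using elim by (simp add: field_simps)
        then show ?thesis using False elim by (simp add: log_prob_def)
      qed (use elim in \<open>simp add: log_prob_def\<close>)
    qed
  qed
  also have "\<dots> = ereal (- lam)" using lim_imp_Limsup[OF _ lim] by simp
  finally show ?thesis .
qed

lemma Liminf_log_prob_ge:
  fixes p :: "real \<Rightarrow> real"
  assumes c: "c > 0" and ge: "\<And>T. T \<ge> 0 \<Longrightarrow> c * exp (- lam * T) \<le> p T"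
  shows "ereal (- lam) \<le> Liminf at_top (\<lambda>T. log_prob (p T) / ereal T)"
proof -
  have lim: "((\<lambda>T. ereal (ln c / T + - lam)) \<longlongrightarrow> ereal (0 + - lam)) at_top"
    by (intro tendsto_intros tendsto_divide_0[OF tendsto_const]) (simp add: filterlim_at_top_imp_at_infinity filterlim_ident)
  have "ereal (- lam) = Liminf at_top (\<lambda>T. ereal (ln c / T + - lam))" using lim_imp_Liminf[OF _ lim] by simp
  also have "\<dots> \<le> Liminf at_top (\<lambda>T. log_prob (p T) / ereal T)"
  proof (rule Liminf_mono)
    show "\<forall>\<^sub>F T in at_top. ereal (ln c / T + - lam) \<le> log_prob (p T) / ereal T"
      using eventually_gt_at_top[of 0]
    proof eventually_elim
      case (elim T)
      have pos: "0 < c * exp (- lam * T)" using c by simp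
      then have pT: "p T > 0" using ge[of T] elim by linarith
      have "ln c + - lam * T = ln (c * exp (- lam * T))" using c by (simp add: ln_mult)
      also have "\<dots> \<le> ln (p T)" using ge[of T] elim pos pT by (simp only: ln_le_cancel_iff)
      finally have "(ln c + - lam * T) / T \<le> ln (p T) / T" using elim by (intro divide_right_mono) auto
      moreover have "(ln c + - lam * T) / T = ln c / T + - lam" using elim by (simp add: field_simps)
      ultimately have "ln c / T + - lam \<le> ln (p T) / T" by simp
      then show ?case using pT elim by (simp add: log_prob_def)
    qed
  qed
  finally show ?thesis .
qed

section \<open>Growth of the rates in \<open>N\<close>\<close>

definition upper_rate :: "real \<Rightarrow> nat \<Rightarrow> real" where
  "upper_rate R N = normal_density 0 1 (max 1 (upper_scale R N) + 1) / (2 * min 1 (upper_scale R N))"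

text \<open>The linear factor is absorbed by \<open>n + 3 <= 3 * 2 ^ n\<close>, that is, by doubling
  the radius.\<close>

lemma weight_sum_le:
  assumes "r \<ge> 0" shows "weight_sum r \<le> 6 * exp (8 * r\<^sup>2)"
proof -
  have "weight_sum r \<le> (\<Sum>n. 3 * ((2 * r) ^ n / sqrt (fact n)))"
    unfolding weight_sum_def
  proof (rule suminf_le)
    fix n :: nat
    have "real n + 1 \<le> 2 ^ n" using less_exp[of n] by (metis Suc_leI of_nat_Suc of_nat_le_iff of_nat_numeral of_nat_power add.commute)
    then have "real n + 3 \<le> 3 * 2 ^ n" by simp
    then have "(real n + 3) * (r ^ n / sqrt (fact n)) \<le> 3 * 2 ^ n * (r ^ n / sqrt (fact n))"
      using assms by (intro mult_right_mono) auto
    then show "(real n + 3) * (r ^ n / sqrt (fact n)) \<le> 3 * ((2 * r) ^ n / sqrt (fact n))"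
      by (simp add: power_mult_distrib)
  qed (use assms in \<open>intro gaf_weight_linear_summable summable_mult gaf_weight_summable(1); simp\<close>)+
  also have "\<dots> = 3 * (\<Sum>n. (2 * r) ^ n / sqrt (fact n))"
    by (rule suminf_mult[OF gaf_weight_summable(1)]) (use assms in simp)
  also have "\<dots> \<le> 3 * (2 * exp (2 * (2 * r)\<^sup>2))"
    by (intro mult_left_mono gaf_weight_summable(2)) (use assms in auto)
  finally show ?thesis by (simp add: power_mult_distrib)
qed

lemma upper_scale_pos:
  assumes "R > 0" "N \<ge> 1" shows "upper_scale R N > 0"
proof -
  have "0 < jensen_factor R N" using assms by (simp add: jensen_factor_def)
  moreover have "0 < weight_sum (big_radius R N)"
    using weight_sum_ge_3[of "big_radius R N"] assms by (simp add: big_radius_def)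
  ultimately show ?thesis using assms by (simp add: upper_scale_def)
qed

text \<open>Only \<open>jensen_factor\<close> contributes to the order \<open>N * ln N\<close>.
  Since \<open>big_radius R N\<close> is at most \<open>2 * (R + 1) * sqrt N\<close>, the weights
  contribute the linear term; \<open>384 = 64 * 6\<close>.\<close>

lemma ln_upper_scale_le:
  assumes R: "R > 0" and N: "N \<ge> 1"
  shows "ln (upper_scale R N) \<le> ln (384 * (R + 1)) + 32 * (R + 1)\<^sup>2 * real N - real N * ln (real N) / 2"
proof -
  have sN: "sqrt (real N) \<ge> 1" using N by simp
  have "jensen_factor R N \<le> (1 / sqrt (real N)) ^ N"
    unfolding jensen_factor_def
  proof (rule power_mono)
    have "R / ((R + 1) * sqrt (real N)) = R / (R + 1) * (1 / sqrt (real N))" by simp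
    also have "\<dots> \<le> 1 * (1 / sqrt (real N))" using R by (intro mult_right_mono) auto
    finally show "R / ((R + 1) * sqrt (real N)) \<le> 1 / sqrt (real N)" by simp
  qed (use R in simp)
  also have "\<dots> = exp (- (real N * ln (real N) / 2))"
  proof -
    have "1 / sqrt (real N) = exp (- (ln (real N) / 2))"
      using N by (simp add: exp_minus inverse_eq_divide ln_sqrt[symmetric])
    then show ?thesis by (simp add: exp_of_nat_mult[symmetric])
  qed
  finally have J: "jensen_factor R N \<le> exp (- (real N * ln (real N) / 2))" .
  have "big_radius R N \<le> 2 * (R + 1) * sqrt (real N)"
  proof -
    have "R * 1 \<le> R * sqrt (real N)" using R sN by (intro mult_left_mono) auto
    moreover have "2 * (R + 1) * sqrt (real N) = 2 * (R * sqrt (real N)) + 2 * sqrt (real N)"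
      "(R + 1) * sqrt (real N) = R * sqrt (real N) + sqrt (real N)" by (simp_all add: algebra_simps)
    ultimately show ?thesis using sN unfolding big_radius_def by linarith
  qed
  then have "(big_radius R N)\<^sup>2 \<le> (2 * (R + 1) * sqrt (real N))\<^sup>2"
    using R by (intro power_mono) (auto simp: big_radius_def)
  also have "\<dots> = 4 * (R + 1)\<^sup>2 * real N" by (simp only: power_mult_distrib) simp
  finally have r: "8 * (big_radius R N)\<^sup>2 \<le> 32 * (R + 1)\<^sup>2 * real N" by (simp add: mult_ac)
  have "weight_sum (big_radius R N) \<le> 6 * exp (8 * (big_radius R N)\<^sup>2)"
    by (rule weight_sum_le) (use R in \<open>simp add: big_radius_def\<close>)
  also have "\<dots> \<le> 6 * exp (32 * (R + 1)\<^sup>2 * real N)" using r by simp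
  finally have W: "weight_sum (big_radius R N) \<le> 6 * exp (32 * (R + 1)\<^sup>2 * real N)" .
  have W0: "0 \<le> weight_sum (big_radius R N)"
    using weight_sum_ge_3[of "big_radius R N"] R by (simp add: big_radius_def)
  have "upper_scale R N \<le> 64 * (R + 1) * exp (- (real N * ln (real N) / 2)) * (6 * exp (32 * (R + 1)\<^sup>2 * real N))"
    unfolding upper_scale_def using J W W0 R
    by (intro mult_mono) (auto simp: jensen_factor_def)
  also have "\<dots> = (384 * (R + 1)) * exp (32 * (R + 1)\<^sup>2 * real N - real N * ln (real N) / 2)"
    unfolding diff_conv_add_uminus exp_add by simp
  finally have "ln (upper_scale R N) \<le> ln ((384 * (R + 1)) * exp (32 * (R + 1)\<^sup>2 * real N - real N * ln (real N) / 2))"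
    using upper_scale_pos[OF R N] R by (subst ln_le_cancel_iff) auto
  also have "\<dots> = ln (384 * (R + 1)) + (32 * (R + 1)\<^sup>2 * real N - real N * ln (real N) / 2)"
    using R by (subst ln_mult) auto
  finally show ?thesis by simp
qed

lemma upper_rate_pos: "R > 0 \<Longrightarrow> N \<ge> 1 \<Longrightarrow> upper_rate R N > 0"
  using upper_scale_pos[of R N] by (simp add: upper_rate_def normal_density_pos)

lemma linear_less_n_ln_n:
  fixes a b e :: real assumes "e > 0"
  shows "\<forall>\<^sub>F N in sequentially. a + b * real N \<le> e * (real N * ln (real N))"
  using assms by real_asymp

lemma ln_upper_rate_ge:
  assumes R: "R > 0"
  shows "\<forall>\<^sub>F N in sequentially. 1 / 6 * (real N * ln (real N)) \<le> ln (upper_rate R N)"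
proof -
  define a where "a = ln (384 * (R + 1))"
  define b where "b = 32 * (R + 1)\<^sup>2"
  define q where "q = normal_density 0 1 2 / 2"
  have q: "q > 0" by (simp add: q_def normal_density_pos)
  have e1: "\<forall>\<^sub>F N in sequentially. a + b * real N \<le> 1 / 2 * (real N * ln (real N))" by (rule linear_less_n_ln_n) simp
  \<comment> \<open>The true exponent is 1/2, so the surplus \<open>1 / 3 = 1 / 2 - 1 / 6\<close> is
    free to absorb the linear term and the constant.\<close>
  have e2: "\<forall>\<^sub>F N in sequentially. (a - ln q) + b * real N \<le> 1 / 3 * (real N * ln (real N))" by (rule linear_less_n_ln_n) simp
  show ?thesis using e1 e2 eventually_ge_at_top[of 1]
  proof eventually_elim
    case (elim N)
    note D0 = upper_scale_pos[OF R elim(3)]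
    have D: "ln (upper_scale R N) \<le> a + b * real N - real N * ln (real N) / 2"
      using ln_upper_scale_le[OF R elim(3)] by (simp add: a_def b_def)
    then have "ln (upper_scale R N) \<le> 0" using elim(1) by simp
    then have D1: "upper_scale R N \<le> 1" using D0 by (simp add: ln_le_zero_iff)
    then have "upper_rate R N = q / upper_scale R N" by (simp add: upper_rate_def q_def max_def min_def)
    then have "ln (upper_rate R N) = ln q - ln (upper_scale R N)" using q D0 by (simp add: ln_div)
    then show ?case using D elim(2) by linarith
  qed
qed

text \<open>Turns the rates with \<open>ln (1 + x)\<close> in the denominator into
  \<open>1 / x\<close>; it rests on \<open>ln (1 + x) >= x / (1 + x)\<close>.\<close>

lemma inverse_ln_le:
  fixes x :: real assumes "x > 0" shows "1 / ln (1 + x) \<le> 1 + 1 / x"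
proof -
  have "x / (1 + x) \<le> ln (1 + x)"
    using ln_le_minus_one[of "1 / (1 + x)"] assms by (simp add: ln_div field_simps)
  moreover have "x / (1 + x) > 0" "ln (1 + x) > 0" using assms by auto
  ultimately have "1 / ln (1 + x) \<le> 1 / (x / (1 + x))" by (intro divide_left_mono mult_pos_pos) auto
  also have "\<dots> = 1 + 1 / x" using assms by (simp add: field_simps)
  finally show ?thesis .
qed

lemma sqrt_fact_le: "N \<ge> 1 \<Longrightarrow> sqrt (fact N) \<le> exp (real N * ln (real N) / 2)"
proof -
  assume N: "N \<ge> 1"
  have "(fact N :: real) \<le> real N ^ N" using fact_le_power[of N, where 'a = real] by simp
  also have "\<dots> = exp (real N * ln (real N))" using N by (simp add: exp_of_nat_mult)
  finally have "sqrt (fact N) \<le> sqrt (exp (real N * ln (real N)))" by simp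
  also have "\<dots> = exp (real N * ln (real N) / 2)"
    by (rule real_sqrt_unique) (simp_all add: exp_double[symmetric])
  finally show ?thesis .
qed

lemma lower_rate_ge_1: "R > 0 \<Longrightarrow> lower_rate R N \<ge> 1"
proof -
  assume R: "R > 0"
  have "0 \<le> ln (1 / (500 * tail_const))" using tail_const by (intro ln_ge_zero) auto
  moreover have "0 \<le> ln (1 + x)" if "0 \<le> x" for x :: real using that by (intro ln_ge_zero) auto
  ultimately show ?thesis unfolding lower_rate_def using tail_const
    by (auto intro!: add_nonneg_nonneg mult_nonneg_nonneg divide_nonneg_nonneg)
qed

text \<open>Both \<open>K\<^sup>2\<close> and \<open>1 / \<delta>\<^sup>2\<close> are
  \<open>sqrt (fact N)\<close> times at most an exponential in \<open>N\<close>, and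
  \<open>fact N <= N ^ N\<close>.\<close>

lemma lower_rate_le:
  assumes R: "R > 0"
  shows "\<exists>A b. A > 0 \<and> (\<forall>N\<ge>1. lower_rate R N \<le> A * exp (b * real N) * exp (real N * ln (real N) / 2))"
proof -
  define s where "s N = sqrt (fact N :: real)" for N :: nat
  have s: "s N \<ge> 1" for N by (simp add: s_def fact_ge_1)
  define m where "m = 1600 * gaf_majorant (2 * R)"
  have m: "m > 0" using gaf_majorant_pos[of "2 * R"] by (simp add: m_def)
  have K2: "(lower_K R N)\<^sup>2 = m\<^sup>2 * s N" for N by (simp add: lower_K_def m_def s_def power_mult_distrib)
  define g where "g = (32 * gaf_majorant R)\<^sup>2 / m\<^sup>2"
  have g: "g > 0" using m gaf_majorant_pos[of R] by (simp add: g_def)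
  \<comment> \<open>\<open>2 * \<bar>ln R\<bar>\<close> pays for the power
    \<open>R ^ (- 2 * N)\<close> in \<open>1 / \<delta>\<^sup>2\<close>, and the 1 for the number of
    small paths, by \<open>N <= exp N\<close>.\<close>
  define b where "b = 2 * \<bar>ln R\<bar> + 1"
  have d2: "1 / (lower_delta R N)\<^sup>2 \<le> g * s N * exp (2 * \<bar>ln R\<bar> * real N)" for N
  proof -
    have "(lower_delta R N)\<^sup>2 = m\<^sup>2 * s N * (R ^ N)\<^sup>2 / ((s N)\<^sup>2 * (32 * gaf_majorant R)\<^sup>2)"
      by (simp add: lower_delta_def power_mult_distrib power_divide K2 s_def)
    then have "1 / (lower_delta R N)\<^sup>2 = 1 / (m\<^sup>2 * s N * (R ^ N)\<^sup>2 / ((s N)\<^sup>2 * (32 * gaf_majorant R)\<^sup>2))"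
      by (simp only:)
    also have "\<dots> = g * s N * (1 / (R ^ N)\<^sup>2)"
      using s[of N] m R gaf_majorant_pos[of R] by (simp add: g_def power2_eq_square field_simps)
    also have "1 / (R ^ N)\<^sup>2 = exp (- 2 * ln R * real N)"
    proof -
      have "R ^ N = exp (real N * ln R)" using R by (simp add: exp_of_nat_mult)
      then have "(R ^ N)\<^sup>2 = exp (2 * (real N * ln R))" by (simp only: exp_double)
      then show ?thesis by (simp add: exp_minus inverse_eq_divide mult_ac)
    qed
    also have "\<dots> \<le> exp (2 * \<bar>ln R\<bar> * real N)"
      unfolding exp_le_cancel_iff by (intro mult_right_mono) auto
    finally show ?thesis using g s[of N] by (simp add: mult_left_mono)
  qed
  define q where "q = ln (1 / (500 * tail_const))"
  have q: "q \<ge> 0" unfolding q_def using tail_const by (intro ln_ge_zero) auto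
  define A where "A = 4 * (1 + 800 * g) + q * (1 + m\<^sup>2 / tail_const) + 1"
  have "0 \<le> q * (1 + m\<^sup>2 / tail_const)" using q tail_const by (intro mult_nonneg_nonneg) auto
  then have A: "A > 0" unfolding A_def by (intro add_nonneg_pos add_nonneg_nonneg) (use g in auto)
  have "lower_rate R N \<le> A * exp (b * real N) * exp (real N * ln (real N) / 2)" if N: "N \<ge> 1" for N
  proof -
    let ?E = "exp (2 * \<bar>ln R\<bar> * real N)"
    define F where "F = exp (b * real N) * s N"
    have E1: "?E \<ge> 1" by simp
    have bE: "exp (b * real N) = ?E * exp (real N)" by (simp add: b_def distrib_right exp_add)
    have b1: "exp (b * real N) \<ge> 1" by (simp add: b_def)
    have F1: "F \<ge> s N" unfolding F_def using mult_right_mono[OF b1, of "s N"] s[of N] by simp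
    have F0: "F \<ge> 1" using F1 s[of N] by linarith
    have "ln 4 \<le> (2::real)"
      using ln_le_minus_one[of 2] ln_mult[of 2 "2::real"] by simp
    then have "ln 4 / ln (1 + (lower_delta R N)\<^sup>2 / 800) \<le> 2 * (1 / ln (1 + (lower_delta R N)\<^sup>2 / 800))"
      using lower_delta_pos[OF R, of N] by (simp add: divide_right_mono)
    also have "\<dots> \<le> 2 * (1 + 1 / ((lower_delta R N)\<^sup>2 / 800))"
      using lower_delta_pos[OF R, of N] by (intro mult_left_mono inverse_ln_le) auto
    also have "\<dots> \<le> 2 * (1 + 800 * (g * s N * ?E))" using d2[of N] by simp
    also have "\<dots> \<le> 2 * (s N * ?E + 800 * (g * s N * ?E))"
      using mult_mono[OF s[of N] E1] s[of N] by simp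
    also have "\<dots> = 2 * (1 + 800 * g) * (s N * ?E)" by (simp add: algebra_simps)
    finally have ls: "ln 4 / ln (1 + (lower_delta R N)\<^sup>2 / 800) \<le> 2 * (1 + 800 * g) * (s N * ?E)" .
    have "real N \<le> exp (real N)" using exp_ge_add_one_self[of "real N"] by linarith
    then have "2 * real N * (ln 4 / ln (1 + (lower_delta R N)\<^sup>2 / 800)) \<le> 2 * exp (real N) * (2 * (1 + 800 * g) * (s N * ?E))"
      using ls lower_delta_pos[OF R, of N] by (intro mult_mono) (auto intro!: divide_nonneg_nonneg ln_ge_zero)
    also have "\<dots> = 4 * (1 + 800 * g) * F" by (simp add: F_def bE mult_ac)
    finally have 1: "2 * real N * (ln 4 / ln (1 + (lower_delta R N)\<^sup>2 / 800)) \<le> 4 * (1 + 800 * g) * F" .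
    have K0: "lower_K R N > 0" using lower_K_ge(1)[of R N] by linarith
    have "q / ln (1 + tail_const / (lower_K R N)\<^sup>2) = q * (1 / ln (1 + tail_const / (lower_K R N)\<^sup>2))" by simp
    also have "\<dots> \<le> q * (1 + 1 / (tail_const / (lower_K R N)\<^sup>2))"
      using tail_const K0 q by (intro mult_left_mono inverse_ln_le) auto
    also have "\<dots> = q * (1 + m\<^sup>2 / tail_const * s N)" by (simp add: K2)
    also have "\<dots> \<le> q * (F + m\<^sup>2 / tail_const * F)"
      using F0 F1 tail_const q by (intro mult_left_mono add_mono) auto
    also have "\<dots> = q * (1 + m\<^sup>2 / tail_const) * F" by (simp add: algebra_simps)
    finally have 2: "q / ln (1 + tail_const / (lower_K R N)\<^sup>2) \<le> q * (1 + m\<^sup>2 / tail_const) * F" .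
    have "lower_rate R N \<le> 4 * (1 + 800 * g) * F + q * (1 + m\<^sup>2 / tail_const) * F + 1 * F"
      unfolding lower_rate_def q_def[symmetric] using 1 2 F0 by linarith
    also have "\<dots> = A * exp (b * real N) * s N" by (simp add: A_def F_def algebra_simps)
    also have "\<dots> \<le> A * exp (b * real N) * exp (real N * ln (real N) / 2)"
      using sqrt_fact_le[OF N] A by (intro mult_left_mono) (auto simp: s_def)
    finally show ?thesis .
  qed
  then show ?thesis using A by blast
qed

text \<open>The exact deficit of the exponent, cut off at 0, so that the bound holds for every
  \<open>N >= 2\<close> by definition and only its convergence to 0 is asymptotic. The same device
  serves for \<open>eps_lower\<close>.\<close>

definition eps_upper :: "real \<Rightarrow> nat \<Rightarrow> real" where
  "eps_upper R N = max 0 (1 / 6 - ln (upper_rate R N) / (real N * ln (real N)))"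

definition eps_lower :: "real \<Rightarrow> nat \<Rightarrow> real" where
  "eps_lower R N = max 0 (ln (lower_rate R N) / (real N * ln (real N)) - 1 / 2)"

lemma n_ln_n_pos: "N \<ge> 2 \<Longrightarrow> real N * ln (real N) > 0"
  by simp

lemma eps_upper_tendsto:
  assumes "R > 0" shows "eps_upper R \<longlonglongrightarrow> 0"
proof (rule tendsto_eventually)
  show "\<forall>\<^sub>F N in sequentially. eps_upper R N = 0"
    using ln_upper_rate_ge[OF assms] eventually_ge_at_top[of 2]
    by eventually_elim (use n_ln_n_pos in \<open>auto simp: eps_upper_def le_divide_eq\<close>)
qed

lemma eps_lower_tendsto:
  assumes R: "R > 0" shows "eps_lower R \<longlonglongrightarrow> 0"
proof -
  obtain A b where A: "A > 0" and le: "\<And>N. N \<ge> 1 \<Longrightarrow> lower_rate R N \<le> A * exp (b * real N) * exp (real N * ln (real N) / 2)"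
    using lower_rate_le[OF R] by blast
  have lim: "(\<lambda>N. \<bar>ln A + b * real N\<bar> / (real N * ln (real N))) \<longlonglongrightarrow> 0"
  proof -
    have "(\<lambda>N. (ln A + b * real N) / (real N * ln (real N))) \<longlonglongrightarrow> 0" by real_asymp
    then have "(\<lambda>N. \<bar>(ln A + b * real N) / (real N * ln (real N))\<bar>) \<longlonglongrightarrow> 0" by (rule tendsto_rabs_zero)
    moreover have "\<forall>\<^sub>F N in sequentially. \<bar>(ln A + b * real N) / (real N * ln (real N))\<bar> = \<bar>ln A + b * real N\<bar> / (real N * ln (real N))"
      using eventually_ge_at_top[of 2] by eventually_elim (use n_ln_n_pos in \<open>auto simp: abs_divide abs_mult\<close>)
    ultimately show ?thesis by (rule Lim_transform_eventually)
  qed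
  show ?thesis
  proof (rule real_tendsto_sandwich[OF _ _ tendsto_const lim])
    show "\<forall>\<^sub>F N in sequentially. 0 \<le> eps_lower R N" by (simp add: eps_lower_def)
    show "\<forall>\<^sub>F N in sequentially. eps_lower R N \<le> \<bar>ln A + b * real N\<bar> / (real N * ln (real N))"
      using eventually_ge_at_top[of 2]
    proof eventually_elim
      case (elim N)
      note P = n_ln_n_pos[OF elim]
      have "ln (lower_rate R N) \<le> ln (A * exp (b * real N) * exp (real N * ln (real N) / 2))"
        using le[of N] lower_rate_ge_1[OF R, of N] elim A by (subst ln_le_cancel_iff) auto
      also have "\<dots> = ln A + b * real N + real N * ln (real N) / 2" using A by (simp add: ln_mult)
      finally have "ln (lower_rate R N) / (real N * ln (real N)) \<le> (\<bar>ln A + b * real N\<bar> + real N * ln (real N) / 2) / (real N * ln (real N))"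
        using P by (intro divide_right_mono) auto
      also have "\<dots> = \<bar>ln A + b * real N\<bar> / (real N * ln (real N)) + 1 / 2"
    proof -
      have "(x + y / 2) / y = x / y + 1 / 2" if "y > 0" for x y :: real using that by (simp add: field_simps)
      from this[OF P] show ?thesis .
    qed
      finally show ?case using P by (simp add: eps_lower_def)
    qed
  qed
qed

lemma exp_eps_upper_le:
  assumes "R > 0" "N \<ge> 2"
  shows "exp ((1 / 6 - eps_upper R N) * (real N * ln (real N))) \<le> upper_rate R N"
proof -
  note P = n_ln_n_pos[OF assms(2)]
  have "(1 / 6 - eps_upper R N) * (real N * ln (real N)) \<le> ln (upper_rate R N) / (real N * ln (real N)) * (real N * ln (real N))"
    using P by (intro mult_right_mono) (auto simp: eps_upper_def)
  also have "\<dots> = ln (upper_rate R N)" using less_imp_neq[OF P] nonzero_divide_eq_eq[of "real N * ln (real N)" "ln (upper_rate R N)"] by metis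
  finally show ?thesis using upper_rate_pos[of R N] assms by (simp add: ln_ge_iff)
qed

lemma lower_rate_le_exp_eps:
  assumes "R > 0" "N \<ge> 2"
  shows "lower_rate R N \<le> exp ((1 / 2 + eps_lower R N) * (real N * ln (real N)))"
proof -
  note P = n_ln_n_pos[OF assms(2)]
  have "ln (lower_rate R N) = ln (lower_rate R N) / (real N * ln (real N)) * (real N * ln (real N))"
    using less_imp_neq[OF P] nonzero_divide_eq_eq[of "real N * ln (real N)" "ln (lower_rate R N)"] by metis
  also have "\<dots> \<le> (1 / 2 + eps_lower R N) * (real N * ln (real N))"
    using P by (intro mult_right_mono) (auto simp: eps_lower_def)
  finally have "exp (ln (lower_rate R N)) \<le> exp ((1 / 2 + eps_lower R N) * (real N * ln (real N)))" by simp
  then show ?thesis using lower_rate_ge_1[OF assms(1), of N] by simp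
qed

theorem theorem3:
  "\<exists>\<epsilon>\<^sub>1 \<epsilon>\<^sub>2 :: real \<Rightarrow> nat \<Rightarrow> real.
     (\<forall>R>0. \<epsilon>\<^sub>1 R \<longlonglongrightarrow> 0 \<and> \<epsilon>\<^sub>2 R \<longlonglongrightarrow> 0) \<and>
     (\<forall>(M :: 'a measure) (B :: nat \<Rightarrow> nat \<Rightarrow> real \<Rightarrow> 'a \<Rightarrow> real).
        independent_brownian_motions M B \<longrightarrow>
        (\<forall>R>0. \<forall>N\<ge>2.
           Limsup at_top (\<lambda>T :: real. log_prob (many_zeros_prob M B T R N) / ereal T)
             \<le> ereal (- exp ((1 / 6 - \<epsilon>\<^sub>1 R N) * (real N * ln (real N)))) \<and>
           Liminf at_top (\<lambda>T :: real. log_prob (many_zeros_prob M B T R N) / ereal T)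
             \<ge> ereal (- exp ((1 / 2 + \<epsilon>\<^sub>2 R N) * (real N * ln (real N))))))"
proof (rule exI[of _ eps_upper], rule exI[of _ eps_lower], intro conjI allI impI)
  fix M :: "'a measure" and B :: "nat \<Rightarrow> nat \<Rightarrow> real \<Rightarrow> 'a \<Rightarrow> real" and R :: real and N :: nat
  assume ibm: "independent_brownian_motions M B" and R: "R > 0" and N: "N \<ge> 2"
  interpret prob_space M using ibm by (simp add: independent_brownian_motions_def)
  interpret gaf M B by unfold_locales (rule ibm)
  have N1: "N \<ge> 1" using N by simp
  obtain C where C: "C > 0" "\<And>T. T \<ge> 0 \<Longrightarrow> many_zeros_prob M B T R N \<le> C * exp (- upper_rate R N * T)"
    using many_zeros_prob_upper[OF R N1] unfolding upper_rate_def by blast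
  have "Limsup at_top (\<lambda>T :: real. log_prob (many_zeros_prob M B T R N) / ereal T) \<le> ereal (- upper_rate R N)"
    by (rule Limsup_log_prob_le[OF _ C]) (simp_all add: many_zeros_prob_def)
  also have "\<dots> \<le> ereal (- exp ((1 / 6 - eps_upper R N) * (real N * ln (real N))))"
    using exp_eps_upper_le[OF R N] by simp
  finally show "Limsup at_top (\<lambda>T :: real. log_prob (many_zeros_prob M B T R N) / ereal T)
      \<le> ereal (- exp ((1 / 6 - eps_upper R N) * (real N * ln (real N))))" .
  obtain c where c: "c > 0" "\<And>T. T \<ge> 0 \<Longrightarrow> c * exp (- lower_rate R N * T) \<le> many_zeros_prob M B T R N"
    using many_zeros_prob_lower[OF R, of N] by blast
  have "ereal (- exp ((1 / 2 + eps_lower R N) * (real N * ln (real N)))) \<le> ereal (- lower_rate R N)"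
    using lower_rate_le_exp_eps[OF R N] by simp
  also have "\<dots> \<le> Liminf at_top (\<lambda>T :: real. log_prob (many_zeros_prob M B T R N) / ereal T)"
    by (rule Liminf_log_prob_ge[OF c])
  finally show "ereal (- exp ((1 / 2 + eps_lower R N) * (real N * ln (real N))))
      \<le> Liminf at_top (\<lambda>T :: real. log_prob (many_zeros_prob M B T R N) / ereal T)" .
qed (auto intro: eps_upper_tendsto eps_lower_tendsto)

end
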